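(* Let $R$ be an integral domain and let $M$ be a short exact sequence of $R$-modules $0\to\mathbf{A}\xrightarrow{\iota}\mathbf{B}\xrightarrow{v}\mathbf{C}\to0$, considered as a structure in an $\mathbf{A}$-$\mathbf{C}$-enrichment $\mathcal{L}$ of the pure three-sorted language of this sequence of $R$-modules. Assume: (1) $\mathbf{A}$ is a pure submodule of $\mathbf{B}$ (in the sense of module theory); (2) $\mathbf{C}$ is torsion free; (3) for any $l\in R\setminus\{0\}$, the quotient $\mathbf{C}/l\mathbf{C}$ is finite and the preimage in $\mathbf{B}$ of any coset $c+l\mathbf{C}$ contains an element which is algebraic over $\emptyset$. Let $e\in M^{\mathrm{eq}}$, $E:=\mathrm{acl}^{\mathrm{eq}}(e)$ and $\Delta:=\mathbf{C}(E)$. Then $e\in\mathrm{dcl}^{\mathrm{eq}}(\mathbf{C}^{\mathrm{eq}}(E)\,\mathbf{B}_\Delta^{\mathrm{eq}}(E))$, where $\mathbf{B}_\Delta$ denotes the union of the fibres $\mathbf{B}_\delta:=v^{-1}(\delta)$ for $\delta\in\Delta$.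
   Context: The pure three-sorted language has the $R$-module structure on each of $\mathbf{A},\mathbf{B},\mathbf{C}$ and the maps $\iota,v$; an $\mathbf{A}$-$\mathbf{C}$-enrichment adds arbitrary structure (possibly new sorts) involving only $\mathbf{A}$ or only $\mathbf{C}$. Pure submodule: $\mathbf{A}\cap r\mathbf{B}=r\mathbf{A}$ for all $r\in R$. For a set $D$ of elements (a union of definable sets), $D^{\mathrm{eq}}(E)$ denotes the set of elements of $E$ of the form $[d]_F$ with $d$ a finite tuple from $D$ and $F$ a $\emptyset$-definable equivalence relation.
   Formalization: If e is an imaginary involving new sorts of the enrichment, tuples from those new sorts are also allowed in C^eq(E) (C-side) and B_Δ^eq(E) (A-side); otherwise the claim fails for an element of an infinite structureless new sort. For e over A, B, C it is as stated. *)

theory Defs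
  imports Main "HOL.Modules"
begin

section \<open>Many-sorted first-order logic\<close>

record ('s, 'f, 'p) language =
  sorts :: "'s set"
  funs :: "'f set"
  fdom :: "'f \<Rightarrow> 's list"
  fcod :: "'f \<Rightarrow> 's"
  rels :: "'p set"
  rdom :: "'p \<Rightarrow> 's list"

record ('s, 'u, 'f, 'p) struct =
  univ :: "'s \<Rightarrow> 'u set"
  fint :: "'f \<Rightarrow> 'u list \<Rightarrow> 'u"
  rint :: "'p \<Rightarrow> 'u list \<Rightarrow> bool"

text \<open>Variables are de Bruijn indices into a list: a sort context for typing, a list of elements
  for evaluation.\<close>

datatype 'f trm = Var nat | App 'f "'f trm list"

datatype ('s, 'f, 'p) fm =
    Eq "'f trm" "'f trm"
  | Rel 'p "'f trm list"
  | Neg "('s, 'f, 'p) fm"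
  | Conj "('s, 'f, 'p) fm" "('s, 'f, 'p) fm"
  | Ex 's "('s, 'f, 'p) fm"

inductive wt_trm :: "('s, 'f, 'p) language \<Rightarrow> 's list \<Rightarrow> 'f trm \<Rightarrow> 's \<Rightarrow> bool"
  for L \<Gamma> where
  "n < length \<Gamma> \<Longrightarrow> wt_trm L \<Gamma> (Var n) (\<Gamma> ! n)"
| "f \<in> funs L \<Longrightarrow> list_all2 (wt_trm L \<Gamma>) ts (fdom L f) \<Longrightarrow> wt_trm L \<Gamma> (App f ts) (fcod L f)"

primrec wf_fm :: "('s, 'f, 'p) language \<Rightarrow> 's list \<Rightarrow> ('s, 'f, 'p) fm \<Rightarrow> bool" where
  "wf_fm L \<Gamma> (Eq t u) \<longleftrightarrow> (\<exists>s. wt_trm L \<Gamma> t s \<and> wt_trm L \<Gamma> u s)"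
| "wf_fm L \<Gamma> (Rel p ts) \<longleftrightarrow> p \<in> rels L \<and> list_all2 (wt_trm L \<Gamma>) ts (rdom L p)"
| "wf_fm L \<Gamma> (Neg \<phi>) \<longleftrightarrow> wf_fm L \<Gamma> \<phi>"
| "wf_fm L \<Gamma> (Conj \<phi> \<psi>) \<longleftrightarrow> wf_fm L \<Gamma> \<phi> \<and> wf_fm L \<Gamma> \<psi>"
| "wf_fm L \<Gamma> (Ex s \<phi>) \<longleftrightarrow> s \<in> sorts L \<and> wf_fm L (s # \<Gamma>) \<phi>"

primrec val :: "('s, 'u, 'f, 'p) struct \<Rightarrow> 'u list \<Rightarrow> 'f trm \<Rightarrow> 'u" where
  "val M xs (Var n) = xs ! n"
| "val M xs (App f ts) = fint M f (map (val M xs) ts)"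

primrec sat :: "('s, 'u, 'f, 'p) struct \<Rightarrow> 'u list \<Rightarrow> ('s, 'f, 'p) fm \<Rightarrow> bool" where
  "sat M xs (Eq t u) \<longleftrightarrow> val M xs t = val M xs u"
| "sat M xs (Rel p ts) \<longleftrightarrow> rint M p (map (val M xs) ts)"
| "sat M xs (Neg \<phi>) \<longleftrightarrow> \<not> sat M xs \<phi>"
| "sat M xs (Conj \<phi> \<psi>) \<longleftrightarrow> sat M xs \<phi> \<and> sat M xs \<psi>"
| "sat M xs (Ex s \<phi>) \<longleftrightarrow> (\<exists>x\<in>univ M s. sat M (x # xs) \<phi>)"

definition tuples :: "('s, 'u, 'f, 'p) struct \<Rightarrow> 's list \<Rightarrow> 'u list set" where
  "tuples M ss = listset (map (univ M) ss)"

definition is_language :: "('s, 'f, 'p) language \<Rightarrow> bool" where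
  "is_language L \<longleftrightarrow>
     (\<forall>f\<in>funs L. set (fdom L f) \<subseteq> sorts L \<and> fcod L f \<in> sorts L) \<and>
     (\<forall>p\<in>rels L. set (rdom L p) \<subseteq> sorts L)"

definition is_struct :: "('s, 'f, 'p) language \<Rightarrow> ('s, 'u, 'f, 'p) struct \<Rightarrow> bool" where
  "is_struct L M \<longleftrightarrow>
     (\<forall>f\<in>funs L. \<forall>us\<in>tuples M (fdom L f). fint M f us \<in> univ M (fcod L f))"

text \<open>Universes of distinct sorts need not be disjoint, so an element of a structure is a pair of
  its sort and its value. Sets of parameters are sets of such pairs.\<close>

definition elems :: "('s, 'f, 'p) language \<Rightarrow> ('s, 'u, 'f, 'p) struct \<Rightarrow> ('s \<times> 'u) set" where
  "elems L M = {(s, x). s \<in> sorts L \<and> x \<in> univ M s}"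

definition definable_over ::
  "('s, 'f, 'p) language \<Rightarrow> ('s, 'u, 'f, 'p) struct \<Rightarrow> ('s \<times> 'u) set \<Rightarrow> 's list \<Rightarrow> 'u list set \<Rightarrow> bool"
  where
  "definable_over L M P ss X \<longleftrightarrow> set ss \<subseteq> sorts L \<and>
     (\<exists>ps \<phi>. set ps \<subseteq> P \<inter> elems L M \<and> wf_fm L (ss @ map fst ps) \<phi> \<and>
        X = {xs \<in> tuples M ss. sat M (xs @ map snd ps) \<phi>})"

definition acl ::
  "('s, 'f, 'p) language \<Rightarrow> ('s, 'u, 'f, 'p) struct \<Rightarrow> ('s \<times> 'u) set \<Rightarrow> ('s \<times> 'u) set" where
  "acl L M P = {(s, x). \<exists>X. definable_over L M P [s] X \<and> finite X \<and> [x] \<in> X}"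

definition dcl ::
  "('s, 'f, 'p) language \<Rightarrow> ('s, 'u, 'f, 'p) struct \<Rightarrow> ('s \<times> 'u) set \<Rightarrow> ('s \<times> 'u) set" where
  "dcl L M P = {(s, x). definable_over L M P [s] {[x]}}"


section \<open>Imaginaries\<close>

text \<open>\<open>Quot ss F\<close> is the sort of classes of the equivalence relation \<open>F\<close> on the product of the
  sorts \<open>ss\<close>; there is one such sort for each \<open>\<emptyset>\<close>-definable \<open>F\<close>.\<close>

datatype ('s, 'u) eq_sort = Home 's | Quot "'s list" "('u list \<times> 'u list) set"

datatype 'u eq_elem = Real (the_real: 'u) | Class "'u list set"

datatype ('s, 'u, 'f) eq_fun = Old 'f | Proj "'s list" "('u list \<times> 'u list) set"

definition definable_equiv ::
  "('s, 'f, 'p) language \<Rightarrow> ('s, 'u, 'f, 'p) struct \<Rightarrow> 's list \<Rightarrow> ('u list \<times> 'u list) set \<Rightarrow> bool"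
  where
  "definable_equiv L M ss F \<longleftrightarrow>
     equiv (tuples M ss) F \<and> definable_over L M {} (ss @ ss) {xs @ ys | xs ys. (xs, ys) \<in> F}"

definition eq_language ::
  "('s, 'f, 'p) language \<Rightarrow> ('s, 'u, 'f, 'p) struct \<Rightarrow>
   (('s, 'u) eq_sort, ('s, 'u, 'f) eq_fun, 'p) language" where
  "eq_language L M =
     \<lparr> sorts = Home ` sorts L \<union> {Quot ss F | ss F. definable_equiv L M ss F},
       funs = Old ` funs L \<union> {Proj ss F | ss F. definable_equiv L M ss F},
       fdom = (\<lambda>h. case h of Old f \<Rightarrow> map Home (fdom L f) | Proj ss F \<Rightarrow> map Home ss),
       fcod = (\<lambda>h. case h of Old f \<Rightarrow> Home (fcod L f) | Proj ss F \<Rightarrow> Quot ss F),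
       rels = rels L,
       rdom = (\<lambda>p. map Home (rdom L p)) \<rparr>"

definition eq_struct ::
  "('s, 'u, 'f, 'p) struct \<Rightarrow> (('s, 'u) eq_sort, 'u eq_elem, ('s, 'u, 'f) eq_fun, 'p) struct" where
  "eq_struct M =
     \<lparr> univ = (\<lambda>\<sigma>. case \<sigma> of Home s \<Rightarrow> Real ` univ M s | Quot ss F \<Rightarrow> Class ` (tuples M ss // F)),
       fint = (\<lambda>h us. case h of
           Old f \<Rightarrow> Real (fint M f (map the_real us))
         | Proj ss F \<Rightarrow> Class (F `` {map the_real us})),
       rint = (\<lambda>p us. rint M p (map the_real us)) \<rparr>"

type_synonym ('s, 'u) imag = "('s, 'u) eq_sort \<times> 'u eq_elem"

definition eq_elems :: "('s, 'f, 'p) language \<Rightarrow> ('s, 'u, 'f, 'p) struct \<Rightarrow> ('s, 'u) imag set" where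
  "eq_elems L M = elems (eq_language L M) (eq_struct M)"

definition acl_eq ::
  "('s, 'f, 'p) language \<Rightarrow> ('s, 'u, 'f, 'p) struct \<Rightarrow> ('s, 'u) imag set \<Rightarrow> ('s, 'u) imag set" where
  "acl_eq L M P = acl (eq_language L M) (eq_struct M) P"

definition dcl_eq ::
  "('s, 'f, 'p) language \<Rightarrow> ('s, 'u, 'f, 'p) struct \<Rightarrow> ('s, 'u) imag set \<Rightarrow> ('s, 'u) imag set" where
  "dcl_eq L M P = dcl (eq_language L M) (eq_struct M) P"

text \<open>\<open>eq_part L M D E\<close> is $D^{\mathrm{eq}}(E)$.\<close>

definition eq_part ::
  "('s, 'f, 'p) language \<Rightarrow> ('s, 'u, 'f, 'p) struct \<Rightarrow> ('s \<times> 'u) set \<Rightarrow> ('s, 'u) imag set \<Rightarrow>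
   ('s, 'u) imag set" where
  "eq_part L M D E =
     E \<inter> {(Quot ss F, Class (F `` {d})) | ss F d.
            definable_equiv L M ss F \<and> d \<in> tuples M ss \<and> set (zip ss d) \<subseteq> D}"

text \<open>The sorts of the original structure over which an imaginary sort is formed.\<close>

primrec base_sorts :: "('s, 'u) eq_sort \<Rightarrow> 's set" where
  "base_sorts (Home s) = {s}"
| "base_sorts (Quot ss F) = set ss"


section \<open>Modules\<close>

definition short_exact ::
  "('r::comm_ring_1 \<Rightarrow> 'a::ab_group_add \<Rightarrow> 'a) \<Rightarrow> ('r \<Rightarrow> 'b::ab_group_add \<Rightarrow> 'b) \<Rightarrow>
   ('r \<Rightarrow> 'c::ab_group_add \<Rightarrow> 'c) \<Rightarrow> ('a \<Rightarrow> 'b) \<Rightarrow> ('b \<Rightarrow> 'c) \<Rightarrow> bool" where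
  "short_exact scA scB scC \<iota> v \<longleftrightarrow>
     module_hom scA scB \<iota> \<and> module_hom scB scC v \<and>
     inj \<iota> \<and> range \<iota> = {b. v b = 0} \<and> surj v"

definition pure_submodule ::
  "('r::comm_ring_1 \<Rightarrow> 'b::ab_group_add \<Rightarrow> 'b) \<Rightarrow> 'b set \<Rightarrow> bool" where
  "pure_submodule sc N \<longleftrightarrow> module.subspace sc N \<and> (\<forall>r. N \<inter> range (sc r) = sc r ` N)"

definition torsion_free ::
  "('r::comm_ring_1 \<Rightarrow> 'c::ab_group_add \<Rightarrow> 'c) \<Rightarrow> bool" where
  "torsion_free sc \<longleftrightarrow> (\<forall>r c. sc r c = 0 \<longrightarrow> r = 0 \<or> c = 0)"

definition mult_coset ::
  "('r \<Rightarrow> 'c::ab_group_add \<Rightarrow> 'c) \<Rightarrow> 'r \<Rightarrow> 'c \<Rightarrow> 'c set" where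
  "mult_coset sc l c = {c + sc l d | d. True}"


section \<open>Enrichments of short exact sequences\<close>

text \<open>An enrichment of a module \<open>\<A>\<close> is a structure, in an arbitrary many-sorted language, having
  \<open>\<A>\<close> as its sort \<open>Core\<close> and otherwise only new sorts.\<close>

datatype 'x side_sort = Core | New 'x

datatype ('a, 'u) side_elem = CoreEl (the_core: 'a) | NewEl 'u

definition side_enrichment ::
  "('x side_sort, 'f, 'p) language \<Rightarrow> ('x side_sort, ('a, 'u) side_elem, 'f, 'p) struct \<Rightarrow> bool" where
  "side_enrichment L M \<longleftrightarrow> is_language L \<and> is_struct L M \<and>
     Core \<in> sorts L \<and> univ M Core = range CoreEl \<and> (\<forall>x. univ M (New x) \<subseteq> range NewEl)"

text \<open>Given an enrichment of \<open>\<A>\<close> and one of \<open>\<C>\<close>, the enriched sequence is their disjoint union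
  together with \<open>\<B>\<close>, the module operations and the two maps of the sequence. Hence
  no symbol other than those of the pure language mentions two of the three parts.\<close>

datatype ('x, 'y) seq_sort = SA "'x side_sort" | SB | SC "'y side_sort"

datatype ('a, 'u, 'b, 'c, 'w) seq_elem =
  EA (the_EA: "('a, 'u) side_elem") | EB (the_EB: 'b) | EC (the_EC: "('c, 'w) side_elem")

datatype 'r mod_op = Zero | Plus | Minus | Scale 'r

primrec mod_op_arity :: "'r mod_op \<Rightarrow> nat" where
  "mod_op_arity Zero = 0"
| "mod_op_arity Plus = 2"
| "mod_op_arity Minus = 1"
| "mod_op_arity (Scale r) = 1"

primrec mod_op_int ::
  "('r \<Rightarrow> 'm::ab_group_add \<Rightarrow> 'm) \<Rightarrow> 'r mod_op \<Rightarrow> 'm list \<Rightarrow> 'm" where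
  "mod_op_int sc Zero us = 0"
| "mod_op_int sc Plus us = us ! 0 + us ! 1"
| "mod_op_int sc Minus us = - (us ! 0)"
| "mod_op_int sc (Scale r) us = sc r (us ! 0)"

datatype ('r, 'f, 'g) seq_fun =
  OpA "'r mod_op" | OpB "'r mod_op" | OpC "'r mod_op" | Iota | Vee | FunA 'f | FunC 'g

datatype ('p, 'q) seq_rel = RelA 'p | RelC 'q

primrec seq_fdom ::
  "('x side_sort, 'f, 'p) language \<Rightarrow> ('y side_sort, 'g, 'q) language \<Rightarrow>
   ('r, 'f, 'g) seq_fun \<Rightarrow> ('x, 'y) seq_sort list" where
  "seq_fdom LA LC (OpA h) = replicate (mod_op_arity h) (SA Core)"
| "seq_fdom LA LC (OpB h) = replicate (mod_op_arity h) SB"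
| "seq_fdom LA LC (OpC h) = replicate (mod_op_arity h) (SC Core)"
| "seq_fdom LA LC Iota = [SA Core]"
| "seq_fdom LA LC Vee = [SB]"
| "seq_fdom LA LC (FunA f) = map SA (fdom LA f)"
| "seq_fdom LA LC (FunC g) = map SC (fdom LC g)"

primrec seq_fcod ::
  "('x side_sort, 'f, 'p) language \<Rightarrow> ('y side_sort, 'g, 'q) language \<Rightarrow>
   ('r, 'f, 'g) seq_fun \<Rightarrow> ('x, 'y) seq_sort" where
  "seq_fcod LA LC (OpA h) = SA Core"
| "seq_fcod LA LC (OpB h) = SB"
| "seq_fcod LA LC (OpC h) = SC Core"
| "seq_fcod LA LC Iota = SB"
| "seq_fcod LA LC Vee = SC Core"
| "seq_fcod LA LC (FunA f) = SA (fcod LA f)"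
| "seq_fcod LA LC (FunC g) = SC (fcod LC g)"

definition seq_language ::
  "('x side_sort, 'f, 'p) language \<Rightarrow> ('y side_sort, 'g, 'q) language \<Rightarrow>
   (('x, 'y) seq_sort, ('r, 'f, 'g) seq_fun, ('p, 'q) seq_rel) language" where
  "seq_language LA LC =
     \<lparr> sorts = SA ` sorts LA \<union> {SB} \<union> SC ` sorts LC,
       funs = range OpA \<union> range OpB \<union> range OpC \<union> {Iota, Vee} \<union> FunA ` funs LA \<union> FunC ` funs LC,
       fdom = seq_fdom LA LC,
       fcod = seq_fcod LA LC,
       rels = RelA ` rels LA \<union> RelC ` rels LC,
       rdom = (\<lambda>P. case P of RelA p \<Rightarrow> map SA (rdom LA p) | RelC q \<Rightarrow> map SC (rdom LC q)) \<rparr>"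

definition seq_struct ::
  "('r \<Rightarrow> 'a::ab_group_add \<Rightarrow> 'a) \<Rightarrow> ('r \<Rightarrow> 'b::ab_group_add \<Rightarrow> 'b) \<Rightarrow>
   ('r \<Rightarrow> 'c::ab_group_add \<Rightarrow> 'c) \<Rightarrow> ('a \<Rightarrow> 'b) \<Rightarrow> ('b \<Rightarrow> 'c) \<Rightarrow>
   ('x side_sort, ('a, 'u) side_elem, 'f, 'p) struct \<Rightarrow>
   ('y side_sort, ('c, 'w) side_elem, 'g, 'q) struct \<Rightarrow>
   (('x, 'y) seq_sort, ('a, 'u, 'b, 'c, 'w) seq_elem, ('r, 'f, 'g) seq_fun, ('p, 'q) seq_rel) struct"
  where
  "seq_struct scA scB scC \<iota> v MA MC =
     \<lparr> univ = (\<lambda>\<sigma>. case \<sigma> of SA s \<Rightarrow> EA ` univ MA s | SB \<Rightarrow> range EB | SC s \<Rightarrow> EC ` univ MC s),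
       fint = (\<lambda>h us. case h of
           OpA k \<Rightarrow> EA (CoreEl (mod_op_int scA k (map (the_core \<circ> the_EA) us)))
         | OpB k \<Rightarrow> EB (mod_op_int scB k (map the_EB us))
         | OpC k \<Rightarrow> EC (CoreEl (mod_op_int scC k (map (the_core \<circ> the_EC) us)))
         | Iota \<Rightarrow> EB (\<iota> (the_core (the_EA (us ! 0))))
         | Vee \<Rightarrow> EC (CoreEl (v (the_EB (us ! 0))))
         | FunA f \<Rightarrow> EA (fint MA f (map the_EA us))
         | FunC g \<Rightarrow> EC (fint MC g (map the_EC us))),
       rint = (\<lambda>P us. case P of
           RelA p \<Rightarrow> rint MA p (map the_EA us)
         | RelC q \<Rightarrow> rint MC q (map the_EC us)) \<rparr>"

text \<open>The points $\mathbf{C}(E)$ of the sort \<open>\<C>\<close> lying in a set \<open>E\<close> of imaginaries.\<close>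

definition C_points ::
  "(('x, 'y) seq_sort, ('a, 'u, 'b, 'c, 'w) seq_elem) imag set \<Rightarrow> 'c set" where
  "C_points E = {c. (Home (SC Core), Real (EC (CoreEl c))) \<in> E}"

text \<open>The sets \<open>\<C>\<close> and $\mathbf{B}_\Delta$, to which are added the new sorts of the
  respective side (\<open>\<A>\<close> being embedded as the fibre over \<open>0\<close>) that belong to \<open>S\<close>. For an imaginary
  formed over new sorts these cannot be omitted: an element of an infinite new sort without any
  structure is not definable from imaginaries of \<open>\<A>\<close>, \<open>\<B>\<close> and \<open>\<C>\<close>. If \<open>S\<close> contains no new sort, these are
  exactly \<open>\<C>\<close> and $\mathbf{B}_\Delta$.\<close>

definition C_set ::
  "(('x, 'y) seq_sort, ('a, 'u, 'b, 'c, 'w) seq_elem, 'f, 'p) struct \<Rightarrow> ('x, 'y) seq_sort set \<Rightarrow>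
   (('x, 'y) seq_sort \<times> ('a, 'u, 'b, 'c, 'w) seq_elem) set" where
  "C_set M S =
     {(SC Core, EC (CoreEl c)) | c. True} \<union>
     {(SC (New y), x) | y x. SC (New y) \<in> S \<and> x \<in> univ M (SC (New y))}"

definition B_fibres ::
  "(('x, 'y) seq_sort, ('a, 'u, 'b, 'c, 'w) seq_elem, 'f, 'p) struct \<Rightarrow> ('b \<Rightarrow> 'c) \<Rightarrow> 'c set \<Rightarrow>
   ('x, 'y) seq_sort set \<Rightarrow> (('x, 'y) seq_sort \<times> ('a, 'u, 'b, 'c, 'w) seq_elem) set" where
  "B_fibres M v \<Delta> S =
     {(SB, EB b) | b. v b \<in> \<Delta>} \<union>
     {(SA (New y), x) | y x. SA (New y) \<in> S \<and> x \<in> univ M (SA (New y))}"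

end

theory Submission
  imports Defs
begin

text \<open>
  Let \<open>e\<close> be the class \<open>X\<close> of a tuple \<open>d\<close> with \<open>\<B>\<close>-part \<open>b\<close> and \<open>c = v b\<close>. Two facts about formulas are
  proved by induction, the quantifier over \<open>\<B>\<close> being handled by eliminating one variable from finitely
  many \<open>R\<close>-linear relations. First, the truth of a formula at \<open>b\<close> is preserved by \<open>b \<mapsto> b + l g\<close> for
  suitable \<open>l \<noteq> 0\<close> and all \<open>g \<in> \<A>\<^sup>n\<close> annihilated by those of finitely many relations that hold for \<open>c\<close>;
  second, since the quotients \<open>\<C>/l\<C>\<close> are finite, a definable subset of a product of fibres of \<open>v\<close>
  and of sorts of \<open>\<C>\<close> is a finite union of rectangles. By a covering argument of B. H. Neumann some
  element of \<open>X\<close> avoids all relations \<open>r\<cdot>c + r'\<cdot>c' = 0\<close> with \<open>r\<cdot>c \<notin> \<Delta>\<close>, so that \<open>X\<close> is invariant under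
  \<open>d \<mapsto> d + l g\<close> as soon as \<open>r\<cdot>g = 0\<close> for the finitely many \<open>r\<close> with \<open>r\<cdot>c \<in> \<Delta>\<close>. Write \<open>c = \<delta> + l v(y)\<close> with \<open>\<delta>\<close>
  algebraic. Then \<open>e\<close> is determined by \<open>p = (b - l y, r\<cdot>y)\<close>, a tuple from \<open>\<B>\<^sub>\<Delta>\<close>, and \<open>q = v(y)\<close>, a tuple
  from \<open>\<C>\<close>. By the second fact the rectangle around \<open>(p, q)\<close> on which \<open>e\<close> is determined has sides with
  finitely many conjugates over \<open>e\<close>, and each side has a code in the respective sorts.
\<close>

section \<open>Definable predicates on blocks of variables\<close>

text \<open>The structure is arbitrary, with no saturation assumed, so algebraicity over
  \<open>e\<close> cannot be read off from automorphisms: each point or code needs a formula with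
  finitely many solutions. Finiteness is therefore proved for formulas, uniformly in parameters,
  with an explicit finite set of relations and a scalar l \<noteq> 0. The enrichments are
  unrestricted, so quantifiers are not eliminated; the inductions only follow how a formula sees
  \<open>\<B>\<close>, namely through linear forms. Eliminating a variable costs a division by its
  coefficient, which l absorbs. Torsion-freeness makes a relation with nonzero leading coefficient
  have at most one solution in \<open>\<C>\<close> and closes \<Delta> under division by l; hence
  r\<cdot>y lies over \<Delta>, as l(r\<cdot>v(y)) is a difference of points of \<Delta>. The
  element y is needed because b lies over c, which need not be in \<Delta>, whereas b - l y lies
  over \<delta>; another y with the same v(y) and r\<cdot>y changes b by an admissible translation.
  Finally, a side of the rectangle is first defined with parameters from the other side; finiteness
  lets these be exchanged for points of the side itself.\<close>

lemma tuples_iff: "xs \<in> tuples M ss \<longleftrightarrow> list_all2 (\<lambda>x s. x \<in> univ M s) xs ss"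
  unfolding tuples_def
  by (induction ss arbitrary: xs) (auto simp: set_Cons_def list_all2_Cons2)

lemma tuples_length: "xs \<in> tuples M ss \<Longrightarrow> length xs = length ss"
  by (simp add: tuples_iff list_all2_lengthD)

lemma tuples_nth: "xs \<in> tuples M ss \<Longrightarrow> i < length ss \<Longrightarrow> xs ! i \<in> univ M (ss ! i)"
  by (simp add: tuples_iff list_all2_conv_all_nth)

lemma tuples_Nil [simp]: "xs \<in> tuples M [] \<longleftrightarrow> xs = []"
  by (simp add: tuples_iff)

lemma tuples_Cons [simp]: "x # xs \<in> tuples M (s # ss) \<longleftrightarrow> x \<in> univ M s \<and> xs \<in> tuples M ss"
  by (simp add: tuples_iff)

lemma tuples_Cons_iff:
  "xs \<in> tuples M (s # ss) \<longleftrightarrow> (\<exists>y ys. xs = y # ys \<and> y \<in> univ M s \<and> ys \<in> tuples M ss)"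
  by (auto simp: tuples_iff list_all2_Cons2)

lemma tuples_append:
  "length xs = length ss \<Longrightarrow>
    xs @ ys \<in> tuples M (ss @ ts) \<longleftrightarrow> xs \<in> tuples M ss \<and> ys \<in> tuples M ts"
  by (simp add: tuples_iff list_all2_append)

lemma tuples_appendI: "xs \<in> tuples M ss \<Longrightarrow> ys \<in> tuples M ts \<Longrightarrow> xs @ ys \<in> tuples M (ss @ ts)"
  by (simp add: tuples_append tuples_length)

lemma tuples_append_iff:
  "zs \<in> tuples M (ss @ ts) \<longleftrightarrow> (\<exists>xs\<in>tuples M ss. \<exists>ys\<in>tuples M ts. zs = xs @ ys)"
proof
  assume "zs \<in> tuples M (ss @ ts)"
  then have "take (length ss) zs @ drop (length ss) zs \<in> tuples M (ss @ ts)" by simp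
  moreover have "length (take (length ss) zs) = length ss"
    using tuples_length[OF \<open>zs \<in> tuples M (ss @ ts)\<close>] by simp
  ultimately show "\<exists>xs\<in>tuples M ss. \<exists>ys\<in>tuples M ts. zs = xs @ ys"
    by (metis append_take_drop_id tuples_append)
qed (auto simp: tuples_appendI)

section \<open>Renaming of variables in terms and formulas\<close>

primrec ren_trm :: "(nat \<Rightarrow> nat) \<Rightarrow> 'f trm \<Rightarrow> 'f trm" where
  "ren_trm h (Var n) = Var (h n)"
| "ren_trm h (App f ts) = App f (map (ren_trm h) ts)"

primrec ren_fm :: "(nat \<Rightarrow> nat) \<Rightarrow> ('s, 'f, 'p) fm \<Rightarrow> ('s, 'f, 'p) fm" where
  "ren_fm h (Eq t u) = Eq (ren_trm h t) (ren_trm h u)"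
| "ren_fm h (Rel p ts) = Rel p (map (ren_trm h) ts)"
| "ren_fm h (Neg \<phi>) = Neg (ren_fm h \<phi>)"
| "ren_fm h (Conj \<phi> \<psi>) = Conj (ren_fm h \<phi>) (ren_fm h \<psi>)"
| "ren_fm h (Ex s \<phi>) = Ex s (ren_fm (case_nat 0 (\<lambda>n. Suc (h n))) \<phi>)"

definition ren_ok :: "(nat \<Rightarrow> nat) \<Rightarrow> 's list \<Rightarrow> 's list \<Rightarrow> bool" where
  "ren_ok h \<Gamma> \<Gamma>' \<longleftrightarrow> (\<forall>i<length \<Gamma>. h i < length \<Gamma>' \<and> \<Gamma>' ! h i = \<Gamma> ! i)"

definition ren_env :: "(nat \<Rightarrow> nat) \<Rightarrow> 's list \<Rightarrow> 'u list \<Rightarrow> 'u list \<Rightarrow> bool" where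
  "ren_env h \<Gamma> xs ys \<longleftrightarrow> (\<forall>i<length \<Gamma>. ys ! h i = xs ! i)"

lemma ren_ok_lift: "ren_ok h \<Gamma> \<Gamma>' \<Longrightarrow> ren_ok (case_nat 0 (\<lambda>n. Suc (h n))) (s # \<Gamma>) (s # \<Gamma>')"
  unfolding ren_ok_def by (auto simp: nth_Cons split: nat.split)

lemma ren_env_lift:
  "ren_env h \<Gamma> xs ys \<Longrightarrow> ren_env (case_nat 0 (\<lambda>n. Suc (h n))) (s # \<Gamma>) (x # xs) (x # ys)"
  unfolding ren_env_def by (auto simp: nth_Cons split: nat.split)

lemma wt_ren: "wt_trm L \<Gamma> t s \<Longrightarrow> ren_ok h \<Gamma> \<Gamma>' \<Longrightarrow> wt_trm L \<Gamma>' (ren_trm h t) s"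
proof (induction rule: wt_trm.induct)
  case (1 n) then show ?case by (metis ren_ok_def ren_trm.simps(1) wt_trm.intros(1))
next
  case (2 f ts) then show ?case
    by (auto intro!: wt_trm.intros simp: list_all2_map1 elim: list_all2_mono)
qed

lemma val_ren: "wt_trm L \<Gamma> t s \<Longrightarrow> ren_env h \<Gamma> xs ys \<Longrightarrow> val M ys (ren_trm h t) = val M xs t"
proof (induction rule: wt_trm.induct)
  case (1 n) then show ?case by (simp add: ren_env_def)
next
  case (2 f ts)
  then have "map (val M ys \<circ> ren_trm h) ts = map (val M xs) ts"
    by (auto simp: list_all2_conv_all_nth in_set_conv_nth)
  then show ?case by (simp only: ren_trm.simps val.simps map_map)
qed

lemma wf_ren: "wf_fm L \<Gamma> \<phi> \<Longrightarrow> ren_ok h \<Gamma> \<Gamma>' \<Longrightarrow> wf_fm L \<Gamma>' (ren_fm h \<phi>)"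
proof (induction \<phi> arbitrary: h \<Gamma> \<Gamma>')
  case (Rel p ts) then show ?case
    by (auto simp: list_all2_map1 elim!: list_all2_mono intro: wt_ren)
next
  case (Ex s \<phi>) then show ?case using ren_ok_lift by fastforce
qed (use wt_ren in \<open>fastforce+\<close>)

lemma sat_ren: "wf_fm L \<Gamma> \<phi> \<Longrightarrow> ren_env h \<Gamma> xs ys \<Longrightarrow> sat M ys (ren_fm h \<phi>) = sat M xs \<phi>"
proof (induction \<phi> arbitrary: h \<Gamma> xs ys)
  case (Eq t u)
  then obtain s where "wt_trm L \<Gamma> t s" "wt_trm L \<Gamma> u s" by auto
  then show ?case by (simp add: val_ren[OF _ Eq(2)])
next
  case (Rel p ts)
  then have "map (val M ys \<circ> ren_trm h) ts = map (val M xs) ts"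
    using val_ren by (fastforce simp: list_all2_conv_all_nth in_set_conv_nth)
  then show ?case by (simp only: ren_fm.simps sat.simps map_map)
next
  case (Ex s \<phi>)
  have "sat M (x # ys) (ren_fm (case_nat 0 (\<lambda>n. Suc (h n))) \<phi>) = sat M (x # xs) \<phi>" for x
    using Ex ren_env_lift by (metis wf_fm.simps(5))
  then show ?case by simp
qed auto

definition env :: "('s, 'u, 'f, 'p) struct \<Rightarrow> 's list list \<Rightarrow> 'u list list \<Rightarrow> bool" where
  "env M \<Gamma>s bs \<longleftrightarrow> list_all2 (\<lambda>b \<Gamma>. b \<in> tuples M \<Gamma>) bs \<Gamma>s"

text \<open>Block definability: the variables of a formula are grouped into tuples, so that the reordering of
  whole tuples replaces de Bruijn arithmetic.\<close>

definition dfb ::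
  "('s, 'f, 'p) language \<Rightarrow> ('s, 'u, 'f, 'p) struct \<Rightarrow> 's list list \<Rightarrow> ('u list list \<Rightarrow> bool) \<Rightarrow> bool"
  where
  "dfb L M \<Gamma>s P \<longleftrightarrow>
     (\<exists>\<phi>. wf_fm L (concat \<Gamma>s) \<phi> \<and> (\<forall>bs. env M \<Gamma>s bs \<longrightarrow> sat M (concat bs) \<phi> = P bs))"

text \<open>The counterpart for terms: a function of the environment stands for the term, so that
  definability proofs never write syntax.\<close>

definition dft ::
  "('s, 'f, 'p) language \<Rightarrow> ('s, 'u, 'f, 'p) struct \<Rightarrow> 's list list \<Rightarrow> ('u list list \<Rightarrow> 'u) \<Rightarrow> 's \<Rightarrow> bool"
  where
  "dft L M \<Gamma>s f s \<longleftrightarrow>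
     (\<exists>t. wt_trm L (concat \<Gamma>s) t s \<and> (\<forall>bs. env M \<Gamma>s bs \<longrightarrow> val M (concat bs) t = f bs))"

lemma env_Nil [simp]: "env M [] bs \<longleftrightarrow> bs = []"
  by (simp add: env_def)

lemma env_Cons [simp]: "env M (\<Gamma> # \<Gamma>s) (b # bs) \<longleftrightarrow> b \<in> tuples M \<Gamma> \<and> env M \<Gamma>s bs"
  by (simp add: env_def)

lemma env_Cons_iff:
  "env M (\<Gamma> # \<Gamma>s) cs \<longleftrightarrow> (\<exists>b bs. cs = b # bs \<and> b \<in> tuples M \<Gamma> \<and> env M \<Gamma>s bs)"
  by (simp add: env_def list_all2_Cons2)

lemma env_length: "env M \<Gamma>s bs \<Longrightarrow> length bs = length \<Gamma>s"
  by (simp add: env_def list_all2_lengthD)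

lemma env_nth: "env M \<Gamma>s bs \<Longrightarrow> i < length \<Gamma>s \<Longrightarrow> bs ! i \<in> tuples M (\<Gamma>s ! i)"
  by (simp add: env_def list_all2_conv_all_nth)

lemma env_concat: "env M \<Gamma>s bs \<Longrightarrow> concat bs \<in> tuples M (concat \<Gamma>s)"
  by (induction \<Gamma>s arbitrary: bs) (auto simp: env_Cons_iff tuples_appendI)

lemma dfb_cong: "dfb L M \<Gamma>s P \<Longrightarrow> (\<And>bs. env M \<Gamma>s bs \<Longrightarrow> P bs = Q bs) \<Longrightarrow> dfb L M \<Gamma>s Q"
  unfolding dfb_def by metis

lemma dft_cong: "dft L M \<Gamma>s f s \<Longrightarrow> (\<And>bs. env M \<Gamma>s bs \<Longrightarrow> f bs = g bs) \<Longrightarrow> dft L M \<Gamma>s g s"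
  unfolding dft_def by metis

lemma dfb_not: "dfb L M \<Gamma>s P \<Longrightarrow> dfb L M \<Gamma>s (\<lambda>bs. \<not> P bs)"
  unfolding dfb_def by (metis sat.simps(3) wf_fm.simps(3))

lemma dfb_conj: "dfb L M \<Gamma>s P \<Longrightarrow> dfb L M \<Gamma>s Q \<Longrightarrow> dfb L M \<Gamma>s (\<lambda>bs. P bs \<and> Q bs)"
  unfolding dfb_def by (metis sat.simps(4) wf_fm.simps(4))

lemma dfb_disj: "dfb L M \<Gamma>s P \<Longrightarrow> dfb L M \<Gamma>s Q \<Longrightarrow> dfb L M \<Gamma>s (\<lambda>bs. P bs \<or> Q bs)"
  by (rule dfb_cong[OF dfb_not[OF dfb_conj[OF dfb_not dfb_not]]]) auto

lemma dfb_imp: "dfb L M \<Gamma>s P \<Longrightarrow> dfb L M \<Gamma>s Q \<Longrightarrow> dfb L M \<Gamma>s (\<lambda>bs. P bs \<longrightarrow> Q bs)"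
  by (rule dfb_cong[OF dfb_disj[OF dfb_not]]) auto

lemma dfb_iff: "dfb L M \<Gamma>s P \<Longrightarrow> dfb L M \<Gamma>s Q \<Longrightarrow> dfb L M \<Gamma>s (\<lambda>bs. P bs \<longleftrightarrow> Q bs)"
  by (rule dfb_cong[OF dfb_conj[OF dfb_imp[of L M \<Gamma>s P Q] dfb_imp[of L M \<Gamma>s Q P]]]) auto

lemma dft_var:
  assumes "k < length \<Gamma>s" "i < length (\<Gamma>s ! k)"
  shows "dft L M \<Gamma>s (\<lambda>bs. bs ! k ! i) (\<Gamma>s ! k ! i)"
proof -
  \<comment> \<open>The position of entry \<open>i\<close> of block \<open>k\<close> in the
    concatenated context.\<close>
  let ?n = "length (concat (take k \<Gamma>s)) + i"
  have split: "xss ! k ! i = concat xss ! (length (concat (take k xss)) + i) \<and>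
      length (concat (take k xss)) + i < length (concat xss)"
    if "k < length xss" "i < length (xss ! k)" for xss :: "'z list list"
  proof -
    have "concat xss = concat (take k xss) @ (xss ! k) @ concat (drop (Suc k) xss)"
      by (metis concat.simps(2) concat_append id_take_nth_drop that(1))
    then show ?thesis using that(2)
      by (metis (no_types, lifting) length_append nat_add_left_cancel_less nth_append nth_append_length_plus trans_less_add1)
  qed
  have "val M (concat bs) (Var ?n) = bs ! k ! i" if "env M \<Gamma>s bs" for bs
  proof -
    have l: "length (bs ! j) = length (\<Gamma>s ! j)" if "j < length \<Gamma>s" for j
      using \<open>env M \<Gamma>s bs\<close> env_nth that tuples_length by metis
    have "map length (take k bs) = map length (take k \<Gamma>s)"
      using env_length[OF that] l assms(1) by (auto intro!: nth_equalityI)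
    then have "length (concat (take k bs)) = length (concat (take k \<Gamma>s))"
      by (simp add: length_concat)
    then show ?thesis using split[of bs] env_length[OF that] l assms by simp
  qed
  moreover have "wt_trm L (concat \<Gamma>s) (Var ?n) (\<Gamma>s ! k ! i)"
    using split[OF assms] wt_trm.intros(1) by metis
  ultimately show ?thesis unfolding dft_def by blast
qed

lemma dft_app:
  assumes "f \<in> funs L" "list_all2 (dft L M \<Gamma>s) fs (fdom L f)"
  shows "dft L M \<Gamma>s (\<lambda>bs. fint M f (map (\<lambda>g. g bs) fs)) (fcod L f)"
proof -
  have "\<forall>i<length fs. \<exists>t. wt_trm L (concat \<Gamma>s) t (fdom L f ! i) \<and>
      (\<forall>bs. env M \<Gamma>s bs \<longrightarrow> val M (concat bs) t = (fs ! i) bs)"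
    using assms(2) by (simp add: list_all2_conv_all_nth dft_def)
  then obtain t where t: "\<And>i. i < length fs \<Longrightarrow> wt_trm L (concat \<Gamma>s) (t i) (fdom L f ! i)"
      "\<And>i bs. i < length fs \<Longrightarrow> env M \<Gamma>s bs \<Longrightarrow> val M (concat bs) (t i) = (fs ! i) bs"
    by metis
  let ?t = "App f (map t [0..<length fs])"
  have "wt_trm L (concat \<Gamma>s) ?t (fcod L f)"
    using assms t(1) by (auto intro!: wt_trm.intros simp: list_all2_conv_all_nth)
  moreover have "val M (concat bs) ?t = fint M f (map (\<lambda>g. g bs) fs)" if "env M \<Gamma>s bs" for bs
    using t(2)[OF _ that] by (auto intro!: arg_cong[where f = "fint M f"] nth_equalityI)
  ultimately show ?thesis unfolding dft_def by blast
qed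

lemma dfb_eq: "dft L M \<Gamma>s f s \<Longrightarrow> dft L M \<Gamma>s g s \<Longrightarrow> dfb L M \<Gamma>s (\<lambda>bs. f bs = g bs)"
  unfolding dfb_def dft_def by (metis sat.simps(1) wf_fm.simps(1))

lemma dfb_ex:
  assumes "dfb L M (\<Gamma> # \<Gamma>s) P" "set \<Gamma> \<subseteq> sorts L"
  shows "dfb L M \<Gamma>s (\<lambda>bs. \<exists>b\<in>tuples M \<Gamma>. P (b # bs))"
proof -
  obtain \<phi> where \<phi>: "wf_fm L (\<Gamma> @ concat \<Gamma>s) \<phi>"
    "\<And>b bs. b \<in> tuples M \<Gamma> \<Longrightarrow> env M \<Gamma>s bs \<Longrightarrow> sat M (b @ concat bs) \<phi> = P (b # bs)"
    using assms(1) unfolding dfb_def by (metis concat.simps(2) env_Cons)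
  have "\<exists>\<psi>. wf_fm L \<Delta> \<psi> \<and> (\<forall>xs. sat M xs \<psi> = (\<exists>b\<in>tuples M \<Gamma>. sat M (b @ xs) \<phi>))"
    if "wf_fm L (\<Gamma> @ \<Delta>) \<phi>" "set \<Gamma> \<subseteq> sorts L" for \<phi> \<Gamma> \<Delta>
    using that
  proof (induction \<Gamma> arbitrary: \<phi>)
    case Nil then show ?case by auto
  next
    \<comment> \<open>The head of the tuple is variable 0, so it is bound first and the remaining
      quantifiers go around \<open>Ex s \<phi>\<close>.\<close>
    case (Cons s \<Gamma>)
    then obtain \<psi> where "wf_fm L \<Delta> \<psi>"
      "\<forall>xs. sat M xs \<psi> = (\<exists>b\<in>tuples M \<Gamma>. sat M (b @ xs) (Ex s \<phi>))"
      using Cons.IH[of "Ex s \<phi>"] by auto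
    moreover have "(\<exists>b\<in>tuples M (s # \<Gamma>). Q b) = (\<exists>b\<in>tuples M \<Gamma>. \<exists>x\<in>univ M s. Q (x # b))" for Q
      by (fastforce simp: tuples_Cons_iff)
    ultimately show ?case by (intro exI[of _ \<psi>]) simp
  qed
  then obtain \<psi> where "wf_fm L (concat \<Gamma>s) \<psi>"
    "\<And>xs. sat M xs \<psi> = (\<exists>b\<in>tuples M \<Gamma>. sat M (b @ xs) \<phi>)"
    using \<phi>(1) assms(2) by blast
  then show ?thesis using \<phi>(2) unfolding dfb_def by (intro exI[of _ \<psi>]) auto
qed

lemma dfb_all:
  assumes "dfb L M (\<Gamma> # \<Gamma>s) P" "set \<Gamma> \<subseteq> sorts L"
  shows "dfb L M \<Gamma>s (\<lambda>bs. \<forall>b\<in>tuples M \<Gamma>. P (b # bs))"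
  by (rule dfb_cong[OF dfb_not[OF dfb_ex[OF dfb_not[OF assms(1)] assms(2)]]]) auto

text \<open>Weakening, exchange and contraction of whole blocks in one rule: the list
  \<open>is\<close> may omit, permute and repeat blocks of the new context.\<close>

lemma dfb_reindex:
  assumes P: "dfb L M \<Gamma>s P" and is_eq: "map ((!) \<Gamma>s') is = \<Gamma>s" and lt: "\<forall>i\<in>set is. i < length \<Gamma>s'"
  shows "dfb L M \<Gamma>s' (\<lambda>bs. P (map ((!) bs) is))"
proof -
  obtain \<phi> where \<phi>: "wf_fm L (concat \<Gamma>s) \<phi>" "\<And>bs. env M \<Gamma>s bs \<Longrightarrow> sat M (concat bs) \<phi> = P bs"
    using P unfolding dfb_def by blast
  define st where "st = (\<lambda>i. length (concat (take i \<Gamma>s')))"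
  \<comment> \<open>\<open>idx\<close> sends each variable of the old context to its position in the
    new one; \<open>st i\<close> is the offset of block \<open>i\<close> there.\<close>
  define idx where "idx = concat (map (\<lambda>i. [st i..<st i + length (\<Gamma>s' ! i)]) is)"
  have block: "map ((!) (concat xss)) [st i..<st i + length (\<Gamma>s' ! i)] = xss ! i \<and>
      (\<forall>j\<in>set [st i..<st i + length (\<Gamma>s' ! i)]. j < length (concat xss))"
    if "map length xss = map length \<Gamma>s'" "i < length \<Gamma>s'" for xss :: "'z list list" and i
  proof -
    have "i < length xss" using that by (metis length_map)
    then have *: "concat xss = concat (take i xss) @ (xss ! i) @ concat (drop (Suc i) xss)"
      by (metis concat.simps(2) concat_append id_take_nth_drop)
    have "length (concat (take i xss)) = st i"
      using that(1) unfolding st_def length_concat by (metis take_map)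
    moreover have "length (xss ! i) = length (\<Gamma>s' ! i)"
      using that by (metis length_map nth_map)
    ultimately show ?thesis
      by (subst *, subst *) (auto simp: nth_append intro!: nth_equalityI)
  qed
  have sel: "map ((!) (concat xss)) idx = concat (map ((!) xss) is)"
    if "map length xss = map length \<Gamma>s'" for xss :: "'z list list"
    unfolding idx_def map_concat using block[OF that] lt by (auto intro!: arg_cong[where f = concat])
  have bnd: "\<forall>j\<in>set idx. j < length (concat \<Gamma>s')"
    unfolding idx_def using block[of \<Gamma>s'] lt by fastforce
  have len: "map ((!) (concat \<Gamma>s')) idx = concat \<Gamma>s"
    using sel[of \<Gamma>s'] is_eq by simp
  have "ren_ok ((!) idx) (concat \<Gamma>s) (concat \<Gamma>s')"
    unfolding ren_ok_def by (metis bnd len length_map nth_map nth_mem)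
  then have "wf_fm L (concat \<Gamma>s') (ren_fm ((!) idx) \<phi>)" using wf_ren \<phi>(1) by blast
  moreover have "sat M (concat bs) (ren_fm ((!) idx) \<phi>) = P (map ((!) bs) is)"
    if "env M \<Gamma>s' bs" for bs
  proof -
    have "map length bs = map length \<Gamma>s'"
      using tuples_length[OF env_nth[OF that]] env_length[OF that] by (auto intro!: nth_equalityI)
    then have "map ((!) (concat bs)) idx = concat (map ((!) bs) is)" by (rule sel)
    then have "ren_env ((!) idx) (concat \<Gamma>s) (concat (map ((!) bs) is)) (concat bs)"
      unfolding ren_env_def by (metis len length_map nth_map)
    moreover have "env M \<Gamma>s (map ((!) bs) is)"
      unfolding env_def is_eq[symmetric] using env_nth[OF that] lt
      by (auto simp: list_all2_conv_all_nth)
    ultimately show ?thesis using \<phi> sat_ren by metis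
  qed
  ultimately show ?thesis unfolding dfb_def by blast
qed

text \<open>The syntax has no constant for truth, so truth is obtained from any predicate already
  known to be definable. This is the reason for the premise \<open>Q\<close> of the rules for finite
  conjunctions and disjunctions that follow.\<close>

lemma dfb_True: 
  assumes "dfb L M \<Gamma>s P" shows "dfb L M \<Gamma>s (\<lambda>bs. True)"
  by (rule dfb_cong[OF dfb_disj[OF assms dfb_not[OF assms]]]) auto

lemma dfb_ball:
  assumes "finite I" "\<And>i. i \<in> I \<Longrightarrow> dfb L M \<Gamma>s (P i)" "dfb L M \<Gamma>s Q"
  shows "dfb L M \<Gamma>s (\<lambda>bs. \<forall>i\<in>I. P i bs)"
  using assms(1,2) by (induction rule: finite_induct) (auto intro: dfb_True[OF assms(3)] dfb_conj)

lemma dfb_bex: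
  assumes "finite I" "\<And>i. i \<in> I \<Longrightarrow> dfb L M \<Gamma>s (P i)" "dfb L M \<Gamma>s Q"
  shows "dfb L M \<Gamma>s (\<lambda>bs. \<exists>i\<in>I. P i bs)"
  by (rule dfb_cong[OF dfb_not[OF dfb_ball[OF assms(1) dfb_not[OF assms(2)] assms(3)]]]) auto

lemma env_concat_split:
  "zs \<in> tuples M (concat \<Gamma>s) \<Longrightarrow> \<exists>bs. env M \<Gamma>s bs \<and> concat bs = zs"
proof (induction \<Gamma>s arbitrary: zs)
  case (Cons \<Gamma> \<Gamma>s)
  then obtain b ys where b: "b \<in> tuples M \<Gamma>" "ys \<in> tuples M (concat \<Gamma>s)" "zs = b @ ys"
    by (auto simp: tuples_append_iff)
  then obtain bs where "env M \<Gamma>s bs" "concat bs = ys" using Cons.IH by blast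
  then show ?case using b by (intro exI[of _ "b # bs"]) simp
qed simp

lemma env_concat_inj: "env M \<Gamma>s bs \<Longrightarrow> env M \<Gamma>s bs' \<Longrightarrow> concat bs = concat bs' \<Longrightarrow> bs = bs'"
proof (induction \<Gamma>s arbitrary: bs bs')
  case (Cons \<Gamma> \<Gamma>s)
  then obtain b cs b' cs' where b: "bs = b # cs" "bs' = b' # cs'" "b \<in> tuples M \<Gamma>" "b' \<in> tuples M \<Gamma>"
    "env M \<Gamma>s cs" "env M \<Gamma>s cs'"
    by (auto simp: env_Cons_iff)
  then have "length b = length b'" using tuples_length by metis
  then show ?case using Cons b by simp
qed simp

text \<open>Only the bracketing of the variables changes, so the same formula serves.\<close>

lemma dfb_regroup:
  assumes P: "dfb L M \<Gamma>s P" and c: "concat \<Gamma>s' = concat \<Gamma>s"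
    and eq: "\<And>bs bs'. env M \<Gamma>s bs \<Longrightarrow> env M \<Gamma>s' bs' \<Longrightarrow> concat bs = concat bs' \<Longrightarrow> P bs = P' bs'"
  shows "dfb L M \<Gamma>s' P'"
proof -
  obtain \<phi> where \<phi>: "wf_fm L (concat \<Gamma>s) \<phi>" "\<forall>bs. env M \<Gamma>s bs \<longrightarrow> sat M (concat bs) \<phi> = P bs"
    using P unfolding dfb_def by blast
  have "sat M (concat bs') \<phi> = P' bs'" if bs': "env M \<Gamma>s' bs'" for bs'
  proof -
    obtain bs where "env M \<Gamma>s bs" "concat bs = concat bs'"
      using env_concat_split[of "concat bs'" M \<Gamma>s] env_concat[OF bs'] c by metis
    then show ?thesis using \<phi>(2) eq[OF _ bs'] by metis
  qed
  then show ?thesis using \<phi>(1) c unfolding dfb_def by metis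
qed

text \<open>\<open>dfb_reindex\<close> moves only whole blocks. A single entry is made a block of
  its own by quantifying over a new block and equating it with the entry.\<close>

lemma dfb_component:
  assumes "dfb L M ([s] # \<Gamma>s) P" "k < length \<Gamma>s" "j < length (\<Gamma>s ! k)" "\<Gamma>s ! k ! j = s" "s \<in> sorts L"
  shows "dfb L M \<Gamma>s (\<lambda>bs. P ([bs ! k ! j] # bs))"
proof -
  have 1: "dft L M ([s] # \<Gamma>s) (\<lambda>bs. bs ! 0 ! 0) s"
    using dft_var[of 0 "[s] # \<Gamma>s" 0] by simp
  have 2: "dft L M ([s] # \<Gamma>s) (\<lambda>bs. bs ! Suc k ! j) s"
    using dft_var[of "Suc k" "[s] # \<Gamma>s" j] assms by simp
  have "dfb L M \<Gamma>s (\<lambda>bs. \<exists>b\<in>tuples M [s]. (b # bs) ! 0 ! 0 = (b # bs) ! Suc k ! j \<and> P (b # bs))"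
    using dfb_ex[OF dfb_conj[OF dfb_eq[OF 1 2] assms(1)]] assms(5) by simp
  then show ?thesis
  proof (rule dfb_cong)
    fix bs assume "env M \<Gamma>s bs"
    then have "bs ! k ! j \<in> univ M s" using env_nth[of M \<Gamma>s bs k] tuples_nth assms by metis
    moreover have "(\<exists>b\<in>tuples M [s]. Q b) = (\<exists>x\<in>univ M s. Q [x])" for Q
      by (auto simp: tuples_Cons_iff)
    ultimately show "(\<exists>b\<in>tuples M [s]. (b # bs) ! 0 ! 0 = (b # bs) ! Suc k ! j \<and> P (b # bs)) = P ([bs ! k ! j] # bs)"
      by auto
  qed
qed

section \<open>Definable sets with parameters and algebraic closure\<close>

lemma definable_overI:
  assumes "dfb L M [ss, map fst ps] P" "set ps \<subseteq> A \<inter> elems L M" "set ss \<subseteq> sorts L"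
  shows "definable_over L M A ss {xs \<in> tuples M ss. P [xs, map snd ps]}"
proof -
  obtain \<phi> where \<phi>: "wf_fm L (concat [ss, map fst ps]) \<phi>"
    "\<forall>bs. env M [ss, map fst ps] bs \<longrightarrow> sat M (concat bs) \<phi> = P bs"
    using assms(1) unfolding dfb_def by blast
  have "map snd ps \<in> tuples M (map fst ps)"
    using assms(2) by (auto simp: tuples_iff list_all2_conv_all_nth elems_def)
      (metis (mono_tags, lifting) case_prodD mem_Collect_eq nth_mem prod.collapse subsetD)
  then have "{xs \<in> tuples M ss. P [xs, map snd ps]} = {xs \<in> tuples M ss. sat M (xs @ map snd ps) \<phi>}"
    using \<phi>(2)[rule_format, of "[_, map snd ps]"] by auto
  then show ?thesis using assms \<phi>(1) unfolding definable_over_def by auto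
qed

text \<open>The parameter list of \<open>definable_over\<close> may repeat the single parameter any
  number of times; the repetitions are contracted to one variable.\<close>

lemma definable_over_singletonE:
  assumes "definable_over L M {(\<sigma>, e)} ss X" "e \<in> univ M \<sigma>"
  obtains P where "dfb L M [ss, [\<sigma>]] P" "X = {xs \<in> tuples M ss. P [xs, [e]]}"
proof -
  obtain ps \<phi> where ps: "set ps \<subseteq> {(\<sigma>, e)}" "wf_fm L (ss @ map fst ps) \<phi>"
    "X = {xs \<in> tuples M ss. sat M (xs @ map snd ps) \<phi>}"
    using assms unfolding definable_over_def by blast
  define k where "k = length ps"
  have "ps = replicate k (\<sigma>, e)" using ps(1) unfolding k_def by (metis replicate_eqI singletonD subsetD)
  then have m: "map fst ps = replicate k \<sigma>" "map snd ps = replicate k e" by simp_all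
  have c: "concat (replicate k [z]) = replicate k z" for z :: 'z by (induction k) auto
  have "dfb L M (ss # replicate k [\<sigma>]) (\<lambda>bs. sat M (concat bs) \<phi>)"
    unfolding dfb_def using ps(2) m c by (intro exI[of _ \<phi>]) simp
  then have "dfb L M [ss, [\<sigma>]] (\<lambda>bs. sat M (concat (map ((!) bs) (0 # replicate k 1))) \<phi>)"
    by (rule dfb_reindex) auto
  then show ?thesis using ps(3) m c by (intro that) auto
qed

text \<open>Transitivity of algebraic closure, coordinatewise for tuples. The defining formula
  quantifies over every tuple that looks like \<open>\<delta>\<close> over \<open>e\<close>, so
  finiteness is demanded for all \<open>\<delta>'\<close> and not only for
  \<open>\<delta>\<close>.\<close>

lemma acl_closed:
  assumes \<delta>: "\<delta> \<in> tuples M \<Gamma>\<delta>" "\<And>j. j < length \<Gamma>\<delta> \<Longrightarrow> (\<Gamma>\<delta> ! j, \<delta> ! j) \<in> acl L M {(\<sigma>, e)}"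
    and e: "(\<sigma>, e) \<in> elems L M"
    and Q: "dfb L M [\<Gamma>, \<Gamma>\<delta>, [\<sigma>]] Q" and \<Gamma>: "set \<Gamma> \<subseteq> sorts L"
    and fin: "\<And>\<delta>'. \<delta>' \<in> tuples M \<Gamma>\<delta> \<Longrightarrow> finite {us \<in> tuples M \<Gamma>. Q [us, \<delta>', [e]]}"
    and us: "us \<in> tuples M \<Gamma>" "Q [us, \<delta>, [e]]" and i: "i < length \<Gamma>"
  shows "(\<Gamma> ! i, us ! i) \<in> acl L M {(\<sigma>, e)}"
proof -
  have eu: "e \<in> univ M \<sigma>" using e by (simp add: elems_def)
  have "\<exists>\<chi>. \<Gamma>\<delta> ! j \<in> sorts L \<and> dfb L M [[\<Gamma>\<delta> ! j], [\<sigma>]] \<chi> \<and>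
      finite {xs \<in> tuples M [\<Gamma>\<delta> ! j]. \<chi> [xs, [e]]} \<and> \<chi> [[\<delta> ! j], [e]]" if j: "j < length \<Gamma>\<delta>" for j
  proof -
    obtain X where X: "definable_over L M {(\<sigma>, e)} [\<Gamma>\<delta> ! j] X" "finite X" "[\<delta> ! j] \<in> X"
      using \<delta>(2)[OF j] by (auto simp: acl_def)
    obtain P where "dfb L M [[\<Gamma>\<delta> ! j], [\<sigma>]] P" "X = {xs \<in> tuples M [\<Gamma>\<delta> ! j]. P [xs, [e]]}"
      using definable_over_singletonE[OF X(1) eu] .
    then show ?thesis using X by (intro exI[of _ P]) (auto simp: definable_over_def)
  qed
  then have "\<forall>j. \<exists>\<chi>. j < length \<Gamma>\<delta> \<longrightarrow> \<Gamma>\<delta> ! j \<in> sorts L \<and> dfb L M [[\<Gamma>\<delta> ! j], [\<sigma>]] \<chi> \<and>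
      finite {xs \<in> tuples M [\<Gamma>\<delta> ! j]. \<chi> [xs, [e]]} \<and> \<chi> [[\<delta> ! j], [e]]"
    by blast
  from choice[OF this] obtain \<chi> where \<chi>0: "\<forall>j. j < length \<Gamma>\<delta> \<longrightarrow> \<Gamma>\<delta> ! j \<in> sorts L \<and>
      dfb L M [[\<Gamma>\<delta> ! j], [\<sigma>]] (\<chi> j) \<and>
      finite {xs \<in> tuples M [\<Gamma>\<delta> ! j]. \<chi> j [xs, [e]]} \<and> \<chi> j [[\<delta> ! j], [e]]" ..
  have \<chi>: "\<And>j. j < length \<Gamma>\<delta> \<Longrightarrow> \<Gamma>\<delta> ! j \<in> sorts L"
    "\<And>j. j < length \<Gamma>\<delta> \<Longrightarrow> dfb L M [[\<Gamma>\<delta> ! j], [\<sigma>]] (\<chi> j)"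
    "\<And>j. j < length \<Gamma>\<delta> \<Longrightarrow> finite {xs \<in> tuples M [\<Gamma>\<delta> ! j]. \<chi> j [xs, [e]]}"
    "\<And>j. j < length \<Gamma>\<delta> \<Longrightarrow> \<chi> j [[\<delta> ! j], [e]]"
    using \<chi>0 by simp_all
  \<comment> \<open>A finite set over \<open>e\<close> that contains \<open>\<delta>\<close>: each
    coordinate satisfies the formula witnessing that the corresponding coordinate of
    \<open>\<delta>\<close> is algebraic.\<close>
  define D where "D = {\<delta>' \<in> tuples M \<Gamma>\<delta>. \<forall>j<length \<Gamma>\<delta>. \<chi> j [[\<delta>' ! j], [e]]}"
  have "finite D"
  proof -
    let ?U = "\<Union>j<length \<Gamma>\<delta>. hd ` {xs \<in> tuples M [\<Gamma>\<delta> ! j]. \<chi> j [xs, [e]]}"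
    have "D \<subseteq> {xs. set xs \<subseteq> ?U \<and> length xs = length \<Gamma>\<delta>}"
    proof (intro subsetI CollectI conjI)
      fix \<delta>' x assume d: "\<delta>' \<in> D" "x \<in> set \<delta>'"
      then obtain j where j: "j < length \<Gamma>\<delta>" "x = \<delta>' ! j"
        by (auto simp: D_def in_set_conv_nth dest: tuples_length)
      then have "[x] \<in> {xs \<in> tuples M [\<Gamma>\<delta> ! j]. \<chi> j [xs, [e]]}"
        using d(1) tuples_nth by (auto simp: D_def)
      then have "x \<in> hd ` {xs \<in> tuples M [\<Gamma>\<delta> ! j]. \<chi> j [xs, [e]]}" by (intro image_eqI[of _ _ "[x]"]) simp_all
      then show "x \<in> ?U" using j(1) by blast
    qed (auto simp: D_def dest: tuples_length)
    moreover have "finite ?U" using \<chi>(3) by blast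
    ultimately show ?thesis using finite_lists_length_eq finite_subset by blast
  qed
  let ?R = "\<lambda>bs. bs ! 0 ! i = bs ! 2 ! 0 \<and> (\<forall>j\<in>{..<length \<Gamma>\<delta>}. \<chi> j [[bs ! 1 ! j], bs ! 3]) \<and> Q [bs ! 0, bs ! 1, bs ! 3]"
  let ?\<Gamma>s = "[\<Gamma>, \<Gamma>\<delta>, [\<Gamma> ! i], [\<sigma>]]"
  have R1: "dfb L M ?\<Gamma>s (\<lambda>bs. bs ! 0 ! i = bs ! 2 ! 0)"
    using dft_var[of 0 ?\<Gamma>s i] dft_var[of 2 ?\<Gamma>s 0] i by (intro dfb_eq[of _ _ _ _ "\<Gamma> ! i"]) simp_all
  have R2: "dfb L M ?\<Gamma>s (\<lambda>bs. \<chi> j [[bs ! 1 ! j], bs ! 3])" if j: "j < length \<Gamma>\<delta>" for j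
  proof -
    have "dfb L M ([\<Gamma>\<delta> ! j] # ?\<Gamma>s) (\<lambda>bs. \<chi> j (map ((!) bs) [0, 4]))"
      by (rule dfb_reindex[OF \<chi>(2)[OF j]]) simp_all
    from dfb_component[OF this, of 1 j] show ?thesis using j \<chi>(1)[OF j] by simp
  qed
  have R3: "dfb L M ?\<Gamma>s (\<lambda>bs. Q [bs ! 0, bs ! 1, bs ! 3])"
    using dfb_reindex[OF Q, of ?\<Gamma>s "[0, 1, 3]"] by simp
  have "dfb L M ?\<Gamma>s ?R" by (intro dfb_conj dfb_ball[OF finite_lessThan _ R1] R1 R2 R3) auto
  then have "dfb L M [\<Gamma>\<delta>, [\<Gamma> ! i], [\<sigma>]] (\<lambda>bs. \<exists>us\<in>tuples M \<Gamma>. ?R (us # bs))"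
    by (rule dfb_ex[OF _ \<Gamma>])
  then have "dfb L M [[\<Gamma> ! i], [\<sigma>]] (\<lambda>bs. \<exists>\<delta>'\<in>tuples M \<Gamma>\<delta>. \<exists>us\<in>tuples M \<Gamma>. ?R (us # \<delta>' # bs))"
    by (rule dfb_ex) (use \<chi>(1) in \<open>auto simp: in_set_conv_nth\<close>)
  then have "dfb L M [[\<Gamma> ! i], map fst [(\<sigma>, e)]] (\<lambda>bs. \<exists>\<delta>'\<in>tuples M \<Gamma>\<delta>. \<exists>us\<in>tuples M \<Gamma>. ?R (us # \<delta>' # bs))"
    by simp
  from definable_overI[OF this, of "{(\<sigma>, e)}"]
  have "definable_over L M {(\<sigma>, e)} [\<Gamma> ! i]
      {xs \<in> tuples M [\<Gamma> ! i]. \<exists>\<delta>'\<in>tuples M \<Gamma>\<delta>. \<exists>us\<in>tuples M \<Gamma>. ?R [us, \<delta>', xs, [e]]}" (is "definable_over _ _ _ _ ?X")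
    using e subsetD[OF \<Gamma> nth_mem[OF i]] by simp
  moreover have "?X \<subseteq> (\<lambda>us. [us ! i]) ` (\<Union>\<delta>'\<in>D. {us \<in> tuples M \<Gamma>. Q [us, \<delta>', [e]]})"
  proof
    fix xs assume "xs \<in> ?X"
    then obtain \<delta>' us where a: "xs \<in> tuples M [\<Gamma> ! i]" "\<delta>' \<in> tuples M \<Gamma>\<delta>" "us \<in> tuples M \<Gamma>" "us ! i = xs ! 0"
      "\<forall>j<length \<Gamma>\<delta>. \<chi> j [[\<delta>' ! j], [e]]" "Q [us, \<delta>', [e]]"
      by auto
    moreover have "xs = [us ! i]" using a(1,4) by (auto simp: tuples_Cons_iff)
    ultimately show "xs \<in> (\<lambda>us. [us ! i]) ` (\<Union>\<delta>'\<in>D. {us \<in> tuples M \<Gamma>. Q [us, \<delta>', [e]]})"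
      unfolding D_def by blast
  qed
  then have "finite ?X"
    by (rule finite_subset) (use \<open>finite D\<close> fin in \<open>auto simp: D_def\<close>)
  moreover have "[us ! i] \<in> ?X"
    using us \<delta>(1) \<chi>(4) tuples_nth[OF us(1) i] by auto
  ultimately show ?thesis unfolding acl_def by blast
qed

section \<open>Definability in the structure of imaginaries\<close>

lemma eq_language_simps:
  "fdom (eq_language L M) (Old f) = map Home (fdom L f)" "fcod (eq_language L M) (Old f) = Home (fcod L f)"
  "fdom (eq_language L M) (Proj ss F) = map Home ss" "fcod (eq_language L M) (Proj ss F) = Quot ss F"
  "rels (eq_language L M) = rels L" "rdom (eq_language L M) p = map Home (rdom L p)"
  "Home s \<in> sorts (eq_language L M) \<longleftrightarrow> s \<in> sorts L"
  "Quot ss F \<in> sorts (eq_language L M) \<longleftrightarrow> definable_equiv L M ss F"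
  "Old f \<in> funs (eq_language L M) \<longleftrightarrow> f \<in> funs L"
  "Proj ss F \<in> funs (eq_language L M) \<longleftrightarrow> definable_equiv L M ss F"
  by (auto simp: eq_language_def)

lemma eq_struct_simps:
  "univ (eq_struct M) (Home s) = Real ` univ M s"
  "univ (eq_struct M) (Quot ss F) = Class ` (tuples M ss // F)"
  "fint (eq_struct M) (Old f) us = Real (fint M f (map the_real us))"
  "fint (eq_struct M) (Proj ss F) us = Class (F `` {map the_real us})"
  "rint (eq_struct M) p us = rint M p (map the_real us)"
  by (simp_all add: eq_struct_def)

lemma wt_lift: "wt_trm L \<Gamma> t s \<Longrightarrow> wt_trm (eq_language L M) (map Home \<Gamma>) (map_trm Old t) (Home s)"
proof (induction rule: wt_trm.induct)
  case (1 n) then show ?case using wt_trm.intros(1)[of n "map Home \<Gamma>"] by simp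
next
  case (2 f ts)
  have "wt_trm (eq_language L M) (map Home \<Gamma>) (App (Old f) (map (map_trm Old) ts))
      (fcod (eq_language L M) (Old f))"
    using 2 by (intro wt_trm.intros(2)) (auto simp: eq_language_simps list_all2_conv_all_nth)
  then show ?case by (simp add: eq_language_simps)
qed

lemma val_lift:
  "wt_trm L \<Gamma> t s \<Longrightarrow> length xs = length \<Gamma> \<Longrightarrow>
    val (eq_struct M) (map Real xs) (map_trm Old t) = Real (val M xs t)"
proof (induction rule: wt_trm.induct)
  case (2 f ts)
  then have "map (\<lambda>t. the_real (val (eq_struct M) (map Real xs) (map_trm Old t))) ts = map (val M xs) ts"
    by (auto simp: list_all2_conv_all_nth in_set_conv_nth)
  then show ?case by (simp add: eq_struct_simps comp_def del: map_eq_conv)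
qed simp

lemma wf_lift: "wf_fm L \<Gamma> \<phi> \<Longrightarrow> wf_fm (eq_language L M) (map Home \<Gamma>) (map_fm Home Old (\<lambda>p. p) \<phi>)"
proof (induction \<phi> arbitrary: \<Gamma>)
  case (Eq t u) then show ?case using wt_lift by fastforce
next
  case (Rel p ts)
  then show ?case by (auto simp: eq_language_simps list_all2_conv_all_nth wt_lift)
next
  case (Ex s \<phi>)
  then have "wf_fm (eq_language L M) (map Home (s # \<Gamma>)) (map_fm Home Old (\<lambda>p. p) \<phi>)"
    by (intro Ex.IH) simp
  then show ?case using Ex.prems by (simp add: eq_language_simps)
qed auto

lemma sat_lift:
  "wf_fm L \<Gamma> \<phi> \<Longrightarrow> length xs = length \<Gamma> \<Longrightarrow>
    sat (eq_struct M) (map Real xs) (map_fm Home Old (\<lambda>p. p) \<phi>) = sat M xs \<phi>"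
proof (induction \<phi> arbitrary: \<Gamma> xs)
  case (Eq t u)
  then obtain s where "wt_trm L \<Gamma> t s" "wt_trm L \<Gamma> u s" by auto
  then show ?case using Eq by (simp add: val_lift)
next
  case (Rel p ts)
  then have "map (\<lambda>t. the_real (val (eq_struct M) (map Real xs) (map_trm Old t))) ts = map (val M xs) ts"
    using val_lift[OF _ Rel(2), of L _ _ M] by (fastforce simp: list_all2_conv_all_nth in_set_conv_nth)
  then show ?case by (simp add: eq_struct_simps comp_def del: map_eq_conv)
next
  case (Ex s \<phi>)
  have "sat (eq_struct M) (map Real (x # xs)) (map_fm Home Old (\<lambda>p. p) \<phi>) = sat M (x # xs) \<phi>" for x
    using Ex by (intro Ex.IH[of "s # \<Gamma>"]) auto
  then show ?case by (simp add: eq_struct_simps)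
qed auto

lemma tuples_lift: "b \<in> tuples (eq_struct M) (map Home \<Gamma>) \<longleftrightarrow> (\<exists>a\<in>tuples M \<Gamma>. b = map Real a)"
proof (induction \<Gamma> arbitrary: b)
  case (Cons s \<Gamma>)
  show ?case
  proof
    assume "b \<in> tuples (eq_struct M) (map Home (s # \<Gamma>))"
    then obtain x a where "b = map Real (x # a)" "x \<in> univ M s" "a \<in> tuples M \<Gamma>"
      using Cons by (auto simp: tuples_Cons_iff eq_struct_simps)
    then show "\<exists>a\<in>tuples M (s # \<Gamma>). b = map Real a" by (intro bexI[of _ "x # a"]) simp_all
  next
    assume "\<exists>a\<in>tuples M (s # \<Gamma>). b = map Real a"
    then obtain x a where "b = Real x # map Real a" "x \<in> univ M s" "a \<in> tuples M \<Gamma>"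
      by (auto simp: tuples_Cons_iff)
    then show "b \<in> tuples (eq_struct M) (map Home (s # \<Gamma>))" using Cons by (auto simp: eq_struct_simps)
  qed
qed simp

lemma env_lift:
  "env (eq_struct M) (map (map Home) \<Gamma>s) bs \<longleftrightarrow> (\<exists>as. env M \<Gamma>s as \<and> bs = map (map Real) as)"
proof (induction \<Gamma>s arbitrary: bs)
  case (Cons \<Gamma> \<Gamma>s)
  show ?case
  proof
    assume "env (eq_struct M) (map (map Home) (\<Gamma> # \<Gamma>s)) bs"
    then obtain a as where "bs = map Real a # map (map Real) as" "a \<in> tuples M \<Gamma>" "env M \<Gamma>s as"
      using Cons by (auto simp: env_Cons_iff tuples_lift)
    then show "\<exists>as. env M (\<Gamma> # \<Gamma>s) as \<and> bs = map (map Real) as" by (intro exI[of _ "a # as"]) simp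
  qed (use Cons in \<open>auto simp: env_Cons_iff tuples_lift\<close>)
qed simp

text \<open>The old formula is kept with renamed sorts and symbols; its quantifiers then range over
  the home sorts, which are copies of the old universes.\<close>

lemma dfb_lift:
  assumes "dfb L M \<Gamma>s P"
  shows "dfb (eq_language L M) (eq_struct M) (map (map Home) \<Gamma>s) (\<lambda>bs. P (map (map the_real) bs))"
proof -
  obtain \<phi> where \<phi>: "wf_fm L (concat \<Gamma>s) \<phi>" "\<forall>bs. env M \<Gamma>s bs \<longrightarrow> sat M (concat bs) \<phi> = P bs"
    using assms unfolding dfb_def by blast
  have "sat (eq_struct M) (concat bs) (map_fm Home Old (\<lambda>p. p) \<phi>) = P (map (map the_real) bs)"
    if bs: "env (eq_struct M) (map (map Home) \<Gamma>s) bs" for bs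
  proof -
    obtain as where as: "env M \<Gamma>s as" "bs = map (map Real) as"
      using bs unfolding env_lift by blast
    have "map (map the_real) bs = as" unfolding as(2) by (simp add: map_idI)
    moreover have "concat bs = map Real (concat as)" unfolding as(2) by (simp add: map_concat)
    ultimately show ?thesis
      using \<phi>(2)[rule_format, OF as(1)] sat_lift[OF \<phi>(1) tuples_length[OF env_concat[OF as(1)]], of M] by simp
  qed
  moreover have "wf_fm (eq_language L M) (concat (map (map Home) \<Gamma>s)) (map_fm Home Old (\<lambda>p. p) \<phi>)"
    using wf_lift[OF \<phi>(1)] by (simp add: map_concat)
  ultimately show ?thesis unfolding dfb_def by blast
qed

lemma definable_equivD:
  assumes "definable_equiv L M ss F"
  shows "equiv (tuples M ss) F" "set ss \<subseteq> sorts L" "dfb L M [ss, ss] (\<lambda>bs. (bs ! 0, bs ! 1) \<in> F)"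
proof -
  show eq: "equiv (tuples M ss) F" and "set ss \<subseteq> sorts L"
    using assms by (auto simp: definable_equiv_def definable_over_def)
  obtain \<phi> where \<phi>: "wf_fm L (ss @ ss) \<phi>"
    "{xs @ ys | xs ys. (xs, ys) \<in> F} = {xs \<in> tuples M (ss @ ss). sat M xs \<phi>}"
    using assms by (auto simp: definable_equiv_def definable_over_def)
  have "sat M (xs @ ys) \<phi> \<longleftrightarrow> (xs, ys) \<in> F" if "xs \<in> tuples M ss" "ys \<in> tuples M ss" for xs ys
  proof
    assume "(xs, ys) \<in> F"
    then show "sat M (xs @ ys) \<phi>" using \<phi>(2) by blast
  next
    assume "sat M (xs @ ys) \<phi>"
    then have "xs @ ys \<in> {xs @ ys | xs ys. (xs, ys) \<in> F}"
      unfolding \<phi>(2) using that by (simp add: tuples_appendI)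
    then obtain xs' ys' where *: "xs @ ys = xs' @ ys'" "(xs', ys') \<in> F" by blast
    then have "xs' \<in> tuples M ss" using eq by (auto simp: equiv_def refl_on_def)
    then have "length xs = length xs'" using that tuples_length by metis
    then show "(xs, ys) \<in> F" using * by simp
  qed
  then show "dfb L M [ss, ss] (\<lambda>bs. (bs ! 0, bs ! 1) \<in> F)"
    unfolding dfb_def using \<phi>(1) by (intro exI[of _ \<phi>]) (auto simp: env_Cons_iff)
qed

lemma definable_equivI:
  assumes "equiv (tuples M ss) F" "set ss \<subseteq> sorts L" "dfb L M [ss, ss] (\<lambda>bs. (bs ! 0, bs ! 1) \<in> F)"
  shows "definable_equiv L M ss F"
proof -
  have "dfb L M [ss @ ss, map fst []] (\<lambda>bs. (take (length ss) (bs ! 0), drop (length ss) (bs ! 0)) \<in> F)"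
    by (rule dfb_regroup[OF assms(3)]) (auto simp: env_Cons_iff tuples_length)
  from definable_overI[OF this, of "{}"]
  have "definable_over L M {} (ss @ ss)
      {xs \<in> tuples M (ss @ ss). (take (length ss) xs, drop (length ss) xs) \<in> F}"
    using assms(2) by simp
  moreover have "{xs \<in> tuples M (ss @ ss). (take (length ss) xs, drop (length ss) xs) \<in> F} =
      {xs @ ys | xs ys. (xs, ys) \<in> F}"
  proof (intro set_eqI iffI)
    fix zs assume "zs \<in> {xs @ ys | xs ys. (xs, ys) \<in> F}"
    then obtain xs ys where *: "zs = xs @ ys" "(xs, ys) \<in> F" by blast
    then have "xs \<in> tuples M ss" "ys \<in> tuples M ss"
      using assms(1) equiv_type by blast+
    then show "zs \<in> {xs \<in> tuples M (ss @ ss). (take (length ss) xs, drop (length ss) xs) \<in> F}"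
      using * by (simp add: tuples_appendI tuples_length)
  next
    fix zs assume "zs \<in> {xs \<in> tuples M (ss @ ss). (take (length ss) xs, drop (length ss) xs) \<in> F}"
    then show "zs \<in> {xs @ ys | xs ys. (xs, ys) \<in> F}"
      by (metis (mono_tags, lifting) append_take_drop_id mem_Collect_eq)
  qed
  ultimately show ?thesis using assms(1) by (simp add: definable_equiv_def)
qed

text \<open>Quotient sorts are reached only through the projections, so a statement about a class is
  made by quantifying over its representatives. \<open>P\<close> need not be invariant under
  \<open>F\<close>.\<close>

lemma dfb_quot:
  assumes P: "dfb (eq_language L M) (eq_struct M) (map Home \<Gamma> # \<Gamma>s) P" and F: "definable_equiv L M \<Gamma> F"
  shows "dfb (eq_language L M) (eq_struct M) ([Quot \<Gamma> F] # \<Gamma>s)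
    (\<lambda>bs. \<exists>b\<in>tuples M \<Gamma>. Class (F `` {b}) = bs ! 0 ! 0 \<and> P (map Real b # tl bs))"
proof -
  let ?L = "eq_language L M" and ?M = "eq_struct M" and ?n = "length \<Gamma>"
  let ?\<Gamma>s = "map Home \<Gamma> # [Quot \<Gamma> F] # \<Gamma>s"
  have "list_all2 (dft ?L ?M ?\<Gamma>s) (map (\<lambda>i bs. bs ! 0 ! i) [0..<?n]) (fdom ?L (Proj \<Gamma> F))"
    using dft_var[of 0 ?\<Gamma>s] by (auto simp: list_all2_conv_all_nth eq_language_simps)
  moreover have "Proj \<Gamma> F \<in> funs ?L" using F by (simp add: eq_language_simps)
  ultimately have 1: "dft ?L ?M ?\<Gamma>s
      (\<lambda>bs. fint ?M (Proj \<Gamma> F) (map (\<lambda>g. g bs) (map (\<lambda>i bs. bs ! 0 ! i) [0..<?n]))) (Quot \<Gamma> F)"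
    using dft_app[of "Proj \<Gamma> F" ?L ?M ?\<Gamma>s] unfolding eq_language_simps by blast
  have 2: "dft ?L ?M ?\<Gamma>s (\<lambda>bs. bs ! 1 ! 0) (Quot \<Gamma> F)"
    using dft_var[of 1 ?\<Gamma>s 0] by simp
  have 3: "dfb ?L ?M ?\<Gamma>s (\<lambda>bs. P (map ((!) bs) (0 # map (\<lambda>i. Suc (Suc i)) [0..<length \<Gamma>s])))"
    by (rule dfb_reindex[OF P]) (auto simp: map_nth comp_def)
  have "set (map Home \<Gamma>) \<subseteq> sorts ?L" using definable_equivD(2)[OF F] by (auto simp: eq_language_simps)
  from dfb_ex[OF dfb_conj[OF dfb_eq[OF 1 2] 3] this]
  show ?thesis
  proof (rule dfb_cong)
    fix bs assume "env ?M ([Quot \<Gamma> F] # \<Gamma>s) bs"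
    then obtain c cs where bs: "bs = c # cs" "length cs = length \<Gamma>s" by (auto simp: env_Cons_iff env_length)
    have [simp]: "map ((!) cs) [0..<length \<Gamma>s] = cs" using bs(2) map_nth by metis
    have *: "fint ?M (Proj \<Gamma> F) (map (\<lambda>g. g ((map Real b) # bs)) (map (\<lambda>i bs. bs ! 0 ! i) [0..<?n])) = Class (F `` {b})"
      if "b \<in> tuples M \<Gamma>" for b
    proof -
      have "map (\<lambda>i. the_real (map Real b ! i)) [0..<?n] = b"
        using tuples_length[OF that] by (auto intro: nth_equalityI)
      then show ?thesis by (simp add: eq_struct_simps comp_def)
    qed
    have "(\<exists>b\<in>tuples ?M (map Home \<Gamma>). Q b) = (\<exists>b\<in>tuples M \<Gamma>. Q (map Real b))" for Q
      unfolding Bex_def tuples_lift by blast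
    then show "(\<exists>b\<in>tuples ?M (map Home \<Gamma>).
        fint ?M (Proj \<Gamma> F) (map (\<lambda>g. g (b # bs)) (map (\<lambda>i bs. bs ! 0 ! i) [0..<?n])) = (b # bs) ! 1 ! 0 \<and>
        P (map ((!) (b # bs)) (0 # map (\<lambda>i. Suc (Suc i)) [0..<length \<Gamma>s]))) =
      (\<exists>b\<in>tuples M \<Gamma>. Class (F `` {b}) = bs ! 0 ! 0 \<and> P (map Real b # tl bs))"
      by (simp add: * del: map_map) (simp add: bs(1) comp_def)
  qed
qed

lemma class_eq_iff: "equiv A F \<Longrightarrow> X \<in> A // F \<Longrightarrow> x \<in> A \<Longrightarrow> F `` {x} = X \<longleftrightarrow> x \<in> X"
  by (metis Image_singleton_iff equiv_class_eq_iff quotientE equiv_class_self)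

text \<open>The class is moved to the last block, the place of the parameter in
  \<open>acl_closed\<close>.\<close>

lemma dfb_class:
  assumes \<Phi>: "dfb L M [ss, \<Gamma>, \<Gamma>\<delta>] \<Phi>" and F: "definable_equiv L M ss F"
  shows "dfb (eq_language L M) (eq_struct M) [map Home \<Gamma>, map Home \<Gamma>\<delta>, [Quot ss F]]
    (\<lambda>bs. \<exists>x\<in>tuples M ss. Class (F `` {x}) = bs ! 2 ! 0 \<and>
       \<Phi> [x, map the_real (bs ! 0), map the_real (bs ! 1)])"
proof -
  have "dfb (eq_language L M) (eq_struct M) (map Home ss # [map Home \<Gamma>, map Home \<Gamma>\<delta>])
      (\<lambda>bs. \<Phi> (map (map the_real) bs))"
    using dfb_lift[OF \<Phi>] by simp
  from dfb_reindex[OF dfb_quot[OF this F], of "[map Home \<Gamma>, map Home \<Gamma>\<delta>, [Quot ss F]]" "[2, 0, 1]"]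
  show ?thesis by (rule dfb_cong) (auto simp: comp_def)
qed

section \<open>Algebraic and definable closure over one imaginary\<close>

context
  fixes L :: "('s, 'f, 'p) language" and M :: "('s, 'u, 'f, 'p) struct" and ss F X
  assumes F: "definable_equiv L M ss F" and X: "X \<in> tuples M ss // F"
begin

lemma imag_elem: "(Quot ss F, Class X) \<in> eq_elems L M"
  using F X by (auto simp: eq_elems_def elems_def eq_language_simps eq_struct_simps)

lemma X_sub: "x \<in> X \<Longrightarrow> x \<in> tuples M ss"
  using X definable_equivD(1)[OF F] by (meson in_quotient_imp_subset subsetD)

lemma Class_eq_iff: "x \<in> tuples M ss \<Longrightarrow> Class (F `` {x}) = Class X \<longleftrightarrow> x \<in> X"
  using class_eq_iff[OF definable_equivD(1)[OF F] X] by simp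

text \<open>\<open>acl_closed\<close> brought back to the original structure: the imaginary is
  present only through an unspecified representative \<open>x\<close> of \<open>X\<close>.\<close>

lemma acl_home:
  assumes \<Phi>: "dfb L M [ss, \<Gamma>, \<Gamma>\<delta>] \<Phi>" and \<Gamma>: "set \<Gamma> \<subseteq> sorts L"
    and \<delta>: "\<delta> \<in> tuples M \<Gamma>\<delta>"
      "\<And>j. j < length \<Gamma>\<delta> \<Longrightarrow> (Home (\<Gamma>\<delta> ! j), Real (\<delta> ! j)) \<in> acl_eq L M {(Quot ss F, Class X)}"
    and us: "us \<in> tuples M \<Gamma>" "x0 \<in> X" "\<Phi> [x0, us, \<delta>]"
    and fin: "\<And>\<delta>'. \<delta>' \<in> tuples M \<Gamma>\<delta> \<Longrightarrow> finite {us \<in> tuples M \<Gamma>. \<exists>x\<in>X. \<Phi> [x, us, \<delta>']}"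
    and i: "i < length \<Gamma>"
  shows "(Home (\<Gamma> ! i), Real (us ! i)) \<in> acl_eq L M {(Quot ss F, Class X)}"
proof -
  let ?Q = "\<lambda>bs. \<exists>x\<in>tuples M ss. Class (F `` {x}) = bs ! 2 ! 0 \<and>
       \<Phi> [x, map the_real (bs ! 0), map the_real (bs ! 1)]"
  have [simp]: "map (the_real \<circ> Real) z = z" for z :: "'u list" by (simp add: map_idI)
  have "(map Home \<Gamma> ! i, map Real us ! i) \<in> acl (eq_language L M) (eq_struct M) {(Quot ss F, Class X)}"
  proof (rule acl_closed[OF _ _ _ dfb_class[OF \<Phi> F]])
    show "map Real \<delta> \<in> tuples (eq_struct M) (map Home \<Gamma>\<delta>)" using \<delta>(1) by (auto simp: tuples_lift)
    show "(map Home \<Gamma>\<delta> ! j, map Real \<delta> ! j) \<in> acl (eq_language L M) (eq_struct M) {(Quot ss F, Class X)}"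
      if "j < length (map Home \<Gamma>\<delta>)" for j
      using \<delta>(2)[of j] that tuples_length[OF \<delta>(1)] by (simp add: acl_eq_def)
    show "(Quot ss F, Class X) \<in> elems (eq_language L M) (eq_struct M)"
      using imag_elem by (simp add: eq_elems_def)
    show "set (map Home \<Gamma>) \<subseteq> sorts (eq_language L M)" using \<Gamma> by (auto simp: eq_language_simps)
    show "map Real us \<in> tuples (eq_struct M) (map Home \<Gamma>)" using us(1) by (auto simp: tuples_lift)
    show "?Q [map Real us, map Real \<delta>, [Class X]]"
      using us X_sub Class_eq_iff by auto
    show "i < length (map Home \<Gamma>)" using i by simp
    fix \<delta>' assume "\<delta>' \<in> tuples (eq_struct M) (map Home \<Gamma>\<delta>)"
    then obtain \<delta>0 where \<delta>0: "\<delta>0 \<in> tuples M \<Gamma>\<delta>" "\<delta>' = map Real \<delta>0" by (auto simp: tuples_lift)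
    have "{vs \<in> tuples (eq_struct M) (map Home \<Gamma>). ?Q [vs, \<delta>', [Class X]]} \<subseteq>
        map Real ` {us \<in> tuples M \<Gamma>. \<exists>x\<in>X. \<Phi> [x, us, \<delta>0]}"
      using Class_eq_iff by (auto simp: tuples_lift \<delta>0(2) intro!: imageI)
    then show "finite {vs \<in> tuples (eq_struct M) (map Home \<Gamma>). ?Q [vs, \<delta>', [Class X]]}"
      using fin[OF \<delta>0(1)] by (meson finite_imageI finite_subset)
  qed
  then show ?thesis using i tuples_length[OF us(1)] by (simp add: acl_eq_def)
qed

text \<open>As for real tuples, except that classes are counted: the representatives
  \<open>t\<close> may be infinite in number as long as they lie in finitely many classes.\<close>

lemma acl_code:
  assumes \<Phi>: "dfb L M [ss, \<Gamma>, \<Gamma>\<delta>] \<Phi>" and G: "definable_equiv L M \<Gamma> G"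
    and \<delta>: "\<delta> \<in> tuples M \<Gamma>\<delta>"
      "\<And>j. j < length \<Gamma>\<delta> \<Longrightarrow> (Home (\<Gamma>\<delta> ! j), Real (\<delta> ! j)) \<in> acl_eq L M {(Quot ss F, Class X)}"
    and us: "us \<in> tuples M \<Gamma>" "x0 \<in> X" "\<Phi> [x0, us, \<delta>]"
    and fin: "\<And>\<delta>'. \<delta>' \<in> tuples M \<Gamma>\<delta> \<Longrightarrow>
      finite ((\<lambda>t. G `` {t}) ` {t \<in> tuples M \<Gamma>. \<exists>x\<in>X. \<Phi> [x, t, \<delta>']})"
  shows "(Quot \<Gamma> G, Class (G `` {us})) \<in> acl_eq L M {(Quot ss F, Class X)}"
proof -
  let ?Q = "\<lambda>bs. \<exists>x\<in>tuples M ss. Class (F `` {x}) = bs ! 2 ! 0 \<and>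
       \<Phi> [x, map the_real (bs ! 0), map the_real (bs ! 1)]"
  let ?R = "\<lambda>bs. \<exists>b\<in>tuples M \<Gamma>. Class (G `` {b}) = bs ! 0 ! 0 \<and> ?Q (map Real b # tl bs)"
  have [simp]: "map (the_real \<circ> Real) z = z" for z :: "'u list" by (simp add: map_idI)
  have "([Quot \<Gamma> G] ! 0, [Class (G `` {us})] ! 0) \<in>
    acl (eq_language L M) (eq_struct M) {(Quot ss F, Class X)}"
  proof (rule acl_closed[OF _ _ _ dfb_quot[OF dfb_class[OF \<Phi> F] G]])
    show "map Real \<delta> \<in> tuples (eq_struct M) (map Home \<Gamma>\<delta>)" using \<delta>(1) by (auto simp: tuples_lift)
    show "(map Home \<Gamma>\<delta> ! j, map Real \<delta> ! j) \<in> acl (eq_language L M) (eq_struct M) {(Quot ss F, Class X)}"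
      if "j < length (map Home \<Gamma>\<delta>)" for j
      using \<delta>(2)[of j] that tuples_length[OF \<delta>(1)] by (simp add: acl_eq_def)
    show "(Quot ss F, Class X) \<in> elems (eq_language L M) (eq_struct M)"
      using imag_elem by (simp add: eq_elems_def)
    show "set [Quot \<Gamma> G] \<subseteq> sorts (eq_language L M)" using G by (auto simp: eq_language_simps)
    show "[Class (G `` {us})] \<in> tuples (eq_struct M) [Quot \<Gamma> G]"
      using us(1) by (auto simp: eq_struct_simps intro: quotientI)
    show "?R [[Class (G `` {us})], map Real \<delta>, [Class X]]"
      using us X_sub Class_eq_iff by auto
    show "0 < length [Quot \<Gamma> G]" by simp
    fix \<delta>' assume "\<delta>' \<in> tuples (eq_struct M) (map Home \<Gamma>\<delta>)"
    then obtain \<delta>0 where \<delta>0: "\<delta>0 \<in> tuples M \<Gamma>\<delta>" "\<delta>' = map Real \<delta>0" by (auto simp: tuples_lift)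
    have "{vs \<in> tuples (eq_struct M) [Quot \<Gamma> G]. ?R [vs, \<delta>', [Class X]]} \<subseteq>
        (\<lambda>S. [Class S]) ` (\<lambda>t. G `` {t}) ` {t \<in> tuples M \<Gamma>. \<exists>x\<in>X. \<Phi> [x, t, \<delta>0]}"
      using Class_eq_iff by (auto simp: tuples_Cons_iff \<delta>0(2) image_image intro!: image_eqI)
    then show "finite {vs \<in> tuples (eq_struct M) [Quot \<Gamma> G]. ?R [vs, \<delta>', [Class X]]}"
      using fin[OF \<delta>0(1)] by (meson finite_imageI finite_subset)
  qed
  then show ?thesis by (simp add: acl_eq_def)
qed

text \<open>The defining formula says that some member of the class is related by
  \<open>\<Phi>\<close> to some representatives of the two codes. By \<open>sound\<close> the choice
  of representatives cannot lead out of \<open>X\<close>, and \<open>ex\<close> gives one choice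
  that works.\<close>

lemma dcl_codes:
  assumes \<Phi>: "dfb L M [ss, \<Gamma>1, \<Gamma>2] \<Phi>" and G: "definable_equiv L M \<Gamma>1 G1" "definable_equiv L M \<Gamma>2 G2"
    and \<tau>: "\<tau>1 \<in> tuples M \<Gamma>1" "\<tau>2 \<in> tuples M \<Gamma>2"
    and ex: "x0 \<in> X" "\<Phi> [x0, \<tau>1, \<tau>2]"
    and sound: "\<And>x t1 t2. x \<in> tuples M ss \<Longrightarrow> (\<tau>1, t1) \<in> G1 \<Longrightarrow> (\<tau>2, t2) \<in> G2 \<Longrightarrow> \<Phi> [x, t1, t2] \<Longrightarrow> x \<in> X"
    and P: "(Quot \<Gamma>1 G1, Class (G1 `` {\<tau>1})) \<in> P" "(Quot \<Gamma>2 G2, Class (G2 `` {\<tau>2})) \<in> P"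
  shows "(Quot ss F, Class X) \<in> dcl_eq L M P"
proof -
  let ?L = "eq_language L M" and ?M = "eq_struct M"
  let ?q = "Quot ss F" and ?q1 = "Quot \<Gamma>1 G1" and ?q2 = "Quot \<Gamma>2 G2"
  have [simp]: "map (the_real \<circ> Real) z = z" for z :: "'u list" by (simp add: map_idI)
  \<comment> \<open>\<open>dfb_quot\<close> acts on the first block only, so the three blocks are
    replaced by quotient sorts one at a time, with a permutation in between. \<open>?P5\<close>
    finally joins the two codes into a single block of parameters.\<close>
  let ?P1 = "\<lambda>bs. \<Phi> (map (map the_real) bs)"
  let ?P2 = "\<lambda>bs. \<exists>x\<in>tuples M ss. Class (F `` {x}) = bs ! 0 ! 0 \<and> ?P1 (map Real x # tl bs)"
  let ?P3 = "\<lambda>bs. \<exists>t\<in>tuples M \<Gamma>1. Class (G1 `` {t}) = bs ! 0 ! 0 \<and> ?P2 (map ((!) (map Real t # tl bs)) [1, 0, 2])"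
  let ?P4 = "\<lambda>bs. \<exists>t\<in>tuples M \<Gamma>2. Class (G2 `` {t}) = bs ! 0 ! 0 \<and> ?P3 (map ((!) (map Real t # tl bs)) [2, 1, 0])"
  let ?P5 = "\<lambda>bs. ?P4 [[bs ! 1 ! 1], [bs ! 0 ! 0], [bs ! 1 ! 0]]"
  have "dfb ?L ?M (map Home ss # [map Home \<Gamma>1, map Home \<Gamma>2]) ?P1" using dfb_lift[OF \<Phi>] by simp
  from dfb_quot[OF this F] have "dfb ?L ?M [[?q], map Home \<Gamma>1, map Home \<Gamma>2] ?P2" .
  then have "dfb ?L ?M (map Home \<Gamma>1 # [[?q], map Home \<Gamma>2]) (\<lambda>bs. ?P2 (map ((!) bs) [1, 0, 2]))"
    by (rule dfb_reindex) simp_all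
  from dfb_quot[OF this G(1)] have "dfb ?L ?M [[?q1], [?q], map Home \<Gamma>2] ?P3" .
  then have "dfb ?L ?M (map Home \<Gamma>2 # [[?q], [?q1]]) (\<lambda>bs. ?P3 (map ((!) bs) [2, 1, 0]))"
    by (rule dfb_reindex) simp_all
  from dfb_quot[OF this G(2)] have "dfb ?L ?M [[?q2], [?q], [?q1]] ?P4" .
  then have "dfb ?L ?M [[?q], [?q1], [?q2]] (\<lambda>bs. ?P4 (map ((!) bs) [2, 0, 1]))"
    by (rule dfb_reindex) simp_all
  then have "dfb ?L ?M [[?q], [?q1, ?q2]] ?P5"
  proof (rule dfb_regroup)
    fix bs bs' assume e: "env ?M [[?q], [?q1], [?q2]] bs" "env ?M [[?q], [?q1, ?q2]] bs'" "concat bs = concat bs'"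
    obtain y c1 c2 where bs: "bs = [[y], [c1], [c2]]" using e(1) by (auto simp: env_Cons_iff tuples_Cons_iff)
    obtain y' c1' c2' where "bs' = [[y'], [c1', c2']]" using e(2) by (auto simp: env_Cons_iff tuples_Cons_iff)
    then have "bs' = [[y], [c1, c2]]" using e(3) bs by simp
    then show "?P4 (map ((!) bs) [2, 0, 1]) = ?P5 bs'" using bs by simp
  qed simp
  then have "dfb ?L ?M [[?q], map fst [(?q1, Class (G1 `` {\<tau>1})), (?q2, Class (G2 `` {\<tau>2}))]] ?P5" by simp
  then have "definable_over ?L ?M P [?q] {xs \<in> tuples ?M [?q].
      ?P5 [xs, map snd [(?q1, Class (G1 `` {\<tau>1})), (?q2, Class (G2 `` {\<tau>2}))]]}"
    by (rule definable_overI)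
      (use P \<tau> G F in \<open>auto simp: elems_def eq_language_simps eq_struct_simps intro: quotientI\<close>)
  moreover have "{xs \<in> tuples ?M [?q]. ?P5 [xs, map snd [(?q1, Class (G1 `` {\<tau>1})), (?q2, Class (G2 `` {\<tau>2}))]]} =
      {[Class X]}"
  proof -
    have *: "?P5 [[y], [Class (G1 `` {\<tau>1}), Class (G2 `` {\<tau>2})]] \<longleftrightarrow> y = Class X" for y
    proof
      assume "?P5 [[y], [Class (G1 `` {\<tau>1}), Class (G2 `` {\<tau>2})]]"
      then obtain t1 t2 x where x: "t1 \<in> tuples M \<Gamma>1" "t2 \<in> tuples M \<Gamma>2" "x \<in> tuples M ss"
        "G1 `` {t1} = G1 `` {\<tau>1}" "G2 `` {t2} = G2 `` {\<tau>2}" "Class (F `` {x}) = y" "\<Phi> [x, t1, t2]"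
        by auto
      then have "x \<in> X"
        using sound definable_equivD(1)[OF G(1)] definable_equivD(1)[OF G(2)]
        by (metis equiv_class_eq_iff \<tau>)
      then show "y = Class X" using x(3,6) Class_eq_iff by metis
    next
      assume "y = Class X"
      then show "?P5 [[y], [Class (G1 `` {\<tau>1}), Class (G2 `` {\<tau>2})]]"
        using ex \<tau> X_sub Class_eq_iff by auto
    qed
    have "Class X \<in> univ ?M ?q" using X by (simp add: eq_struct_simps)
    then show ?thesis using * by (auto simp: tuples_Cons_iff)
  qed
  ultimately show ?thesis by (simp add: dcl_eq_def dcl_def)
qed

end

text \<open>The class of an index \<open>t\<close> is a canonical parameter for the set that
  \<theta> defines with \<open>t\<close>.\<close>

definition code_rel ::
  "('s, 'u, 'f, 'p) struct \<Rightarrow> 's list \<Rightarrow> 's list \<Rightarrow> ('u list list \<Rightarrow> bool) \<Rightarrow> ('u list \<times> 'u list) set" where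
  "code_rel M \<Gamma>x \<Gamma>\<tau> \<theta> =
     {(t, t') \<in> tuples M \<Gamma>\<tau> \<times> tuples M \<Gamma>\<tau>. \<forall>x\<in>tuples M \<Gamma>x. \<theta> [x, t] \<longleftrightarrow> \<theta> [x, t']}"

lemma equiv_code_rel: "equiv (tuples M \<Gamma>\<tau>) (code_rel M \<Gamma>x \<Gamma>\<tau> \<theta>)"
  by (rule equivI) (auto simp: code_rel_def refl_on_def sym_def trans_def)

lemma definable_code_rel:
  assumes "dfb L M [\<Gamma>x, \<Gamma>\<tau>] \<theta>" "set \<Gamma>x \<subseteq> sorts L" "set \<Gamma>\<tau> \<subseteq> sorts L"
  shows "definable_equiv L M \<Gamma>\<tau> (code_rel M \<Gamma>x \<Gamma>\<tau> \<theta>)"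
proof (rule definable_equivI[OF equiv_code_rel assms(3)])
  have "dfb L M [\<Gamma>x, \<Gamma>\<tau>, \<Gamma>\<tau>] (\<lambda>bs. \<theta> (map ((!) bs) [0, 1]) \<longleftrightarrow> \<theta> (map ((!) bs) [0, 2]))"
    by (intro dfb_iff dfb_reindex[OF assms(1)]) simp_all
  from dfb_all[OF this assms(2)]
  show "dfb L M [\<Gamma>\<tau>, \<Gamma>\<tau>] (\<lambda>bs. (bs ! 0, bs ! 1) \<in> code_rel M \<Gamma>x \<Gamma>\<tau> \<theta>)"
    by (rule dfb_cong) (auto simp: code_rel_def env_Cons_iff)
qed

lemma concat_zip:
  "env M \<Gamma>s bs \<Longrightarrow> set (zip (concat \<Gamma>s) (concat bs)) = (\<Union>k<length \<Gamma>s. set (zip (\<Gamma>s ! k) (bs ! k)))"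
proof (induction \<Gamma>s arbitrary: bs)
  case (Cons \<Gamma> \<Gamma>s)
  then obtain b cs where b: "bs = b # cs" "b \<in> tuples M \<Gamma>" "env M \<Gamma>s cs" by (auto simp: env_Cons_iff)
  have "(\<Union>k<Suc (length \<Gamma>s). set (zip ((\<Gamma> # \<Gamma>s) ! k) (bs ! k))) =
      set (zip \<Gamma> b) \<union> (\<Union>k<length \<Gamma>s. set (zip (\<Gamma>s ! k) (cs ! k)))"
    unfolding lessThan_Suc_eq_insert_0 b(1) by auto
  then show ?case using Cons.IH[OF b(3)] b(1) tuples_length[OF b(2)] by simp
qed simp

text \<open>A member of a definable family with only finitely many members is recognised by its trace on
  finitely many points, so it is definable over such points instead of over its index.\<close>

lemma finite_family_code:
  assumes R: "dfb L M [\<Gamma>x, \<Gamma>y, \<Gamma>z] R" and \<Gamma>: "set \<Gamma>y \<subseteq> sorts L"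
    and z: "z \<in> tuples M \<Gamma>z" and y0: "y0 \<in> tuples M \<Gamma>y"
    and fin: "finite ((\<lambda>y. {x \<in> tuples M \<Gamma>x. R [x, y, z]}) ` tuples M \<Gamma>y)"
  obtains K \<tau> \<theta> where "\<tau> \<in> tuples M (\<Gamma>z @ concat (replicate K \<Gamma>x))"
    "dfb L M [\<Gamma>x, \<Gamma>z @ concat (replicate K \<Gamma>x)] \<theta>"
    "\<And>x. x \<in> tuples M \<Gamma>x \<Longrightarrow> \<theta> [x, \<tau>] \<longleftrightarrow> R [x, y0, z]"
    "set (zip (\<Gamma>z @ concat (replicate K \<Gamma>x)) \<tau>) \<subseteq> set (zip \<Gamma>z z) \<union>
       \<Union> {set (zip \<Gamma>x x) | x. x \<in> tuples M \<Gamma>x \<and> (\<exists>y\<in>tuples M \<Gamma>y. R [x, y, z])}"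
proof -
  let ?S = "\<lambda>y. {x \<in> tuples M \<Gamma>x. R [x, y, z]}"
  \<comment> \<open>For \<open>S\<close> different from the distinguished member, a point of the
    symmetric difference of the two.\<close>
  define pt where "pt = (\<lambda>S. SOME x. x \<in> S \<longleftrightarrow> x \<notin> ?S y0)"
  have pt: "pt S \<in> S \<longleftrightarrow> pt S \<notin> ?S y0" if "S \<noteq> ?S y0" for S
  proof -
    have "\<exists>x. x \<in> S \<longleftrightarrow> x \<notin> ?S y0" using that by blast
    from someI_ex[OF this] show ?thesis unfolding pt_def .
  qed
  have "finite (pt ` (?S ` tuples M \<Gamma>y - {?S y0}))" using fin by simp
  from finite_list[OF this] obtain ts where ts: "set ts = pt ` (?S ` tuples M \<Gamma>y - {?S y0})" ..
  \<comment> \<open>A separating point lies in one of the two members it separates, so the new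
    parameters stay inside the union of the family. This is what later keeps codes within their own
    side.\<close>
  have in_ts: "\<exists>y\<in>tuples M \<Gamma>y. t \<in> ?S y" if t: "t \<in> set ts" for t
  proof -
    obtain y where y: "y \<in> tuples M \<Gamma>y" "?S y \<noteq> ?S y0" "t = pt (?S y)" using t unfolding ts by blast
    from pt[OF y(2)] y0 y(1,3) show ?thesis by (cases "pt (?S y) \<in> ?S y") blast+
  qed
  have sep: "?S y = ?S y0" if "y \<in> tuples M \<Gamma>y" "\<forall>t\<in>set ts. t \<in> ?S y \<longleftrightarrow> t \<in> ?S y0" for y
  proof (rule ccontr)
    assume ne: "?S y \<noteq> ?S y0"
    then have "pt (?S y) \<in> set ts" unfolding ts using that(1) by blast
    then show False using pt[OF ne] that(2) by blast
  qed
  define K where "K = length ts"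
  let ?\<Gamma>s = "\<Gamma>z # replicate K \<Gamma>x"
  have tsK: "env M (replicate K \<Gamma>x) ts"
    using in_ts by (auto simp: env_def list_all2_conv_all_nth K_def)
  \<comment> \<open>Which of the points \<open>ts\<close> belong to the member for \<open>y0\<close>
    is written into the formula as finitely many truth values, so \<open>y0\<close> is not a
    parameter: any \<open>y\<close> with this trace yields the same member.\<close>
  define \<theta>' where "\<theta>' = (\<lambda>bs. \<exists>y\<in>tuples M \<Gamma>y.
    (\<forall>k\<in>{..<K}. R [bs ! (k + 2), y, bs ! 1] \<longleftrightarrow> ts ! k \<in> ?S y0) \<and> R [bs ! 0, y, bs ! 1])"
  have "dfb L M (\<Gamma>y # \<Gamma>x # ?\<Gamma>s) (\<lambda>bs.
      (\<forall>k\<in>{..<K}. R (map ((!) bs) [k + 3, 0, 2]) \<longleftrightarrow> ts ! k \<in> ?S y0) \<and> R (map ((!) bs) [1, 0, 2]))"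
  proof (intro dfb_conj dfb_ball[OF finite_lessThan])
    show r: "dfb L M (\<Gamma>y # \<Gamma>x # ?\<Gamma>s) (\<lambda>bs. R (map ((!) bs) [1, 0, 2]))"
      by (rule dfb_reindex[OF R]) simp_all
    then show "dfb L M (\<Gamma>y # \<Gamma>x # ?\<Gamma>s) (\<lambda>bs. R (map ((!) bs) [1, 0, 2]))" .
    fix k assume "k \<in> {..<K}"
    then have 1: "dfb L M (\<Gamma>y # \<Gamma>x # ?\<Gamma>s) (\<lambda>bs. R (map ((!) bs) [k + 3, 0, 2]))"
      by (intro dfb_reindex[OF R]) (simp_all add: numeral_3_eq_3)
    have "dfb L M (\<Gamma>y # \<Gamma>x # ?\<Gamma>s) (\<lambda>bs. R (map ((!) bs) [k + 3, 0, 2]) \<longleftrightarrow> b)" for b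
      by (cases b) (use 1 dfb_not[OF 1] in simp_all)
    then show "dfb L M (\<Gamma>y # \<Gamma>x # ?\<Gamma>s) (\<lambda>bs. R (map ((!) bs) [k + 3, 0, 2]) \<longleftrightarrow> ts ! k \<in> ?S y0)" .
  qed
  from dfb_ex[OF this \<Gamma>] have \<theta>': "dfb L M (\<Gamma>x # ?\<Gamma>s) \<theta>'"
    by (rule dfb_cong) (simp add: \<theta>'_def numeral_3_eq_3 numeral_2_eq_2)
  define \<theta> where "\<theta> = (\<lambda>bs. \<exists>cs. env M ?\<Gamma>s cs \<and> concat cs = bs ! 1 \<and> \<theta>' (bs ! 0 # cs))"
  have zts: "env M ?\<Gamma>s (z # ts)" using z tsK by simp
  show ?thesis
  proof (rule that[of "z @ concat ts" K \<theta>])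
    show "z @ concat ts \<in> tuples M (\<Gamma>z @ concat (replicate K \<Gamma>x))"
      using env_concat[OF zts] by simp
    show "dfb L M [\<Gamma>x, \<Gamma>z @ concat (replicate K \<Gamma>x)] \<theta>"
    proof (rule dfb_regroup[OF \<theta>'])
      fix bs bs' assume e: "env M (\<Gamma>x # ?\<Gamma>s) bs" "env M [\<Gamma>x, \<Gamma>z @ concat (replicate K \<Gamma>x)] bs'"
        "concat bs = concat bs'"
      obtain x cs where bs: "bs = x # cs" "x \<in> tuples M \<Gamma>x" "env M ?\<Gamma>s cs" using e(1) by (auto simp: env_Cons_iff)
      obtain x' t where bs': "bs' = [x', t]" "x' \<in> tuples M \<Gamma>x" using e(2) by (auto simp: env_Cons_iff)
      have "length x = length x'" using bs(2) bs'(2) tuples_length by metis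
      then have x: "x = x'" "concat cs = t" using e(3) bs bs' by simp_all
      have "cs' = cs" if "env M ?\<Gamma>s cs'" "concat cs' = t" for cs'
        using env_concat_inj[OF that(1) bs(3)] that(2) x(2) by simp
      then have "(\<exists>cs'. env M ?\<Gamma>s cs' \<and> concat cs' = t \<and> \<theta>' (x' # cs')) = \<theta>' (x # cs)"
        using bs(3) x by blast
      then show "\<theta>' bs = \<theta> bs'" by (simp add: \<theta>_def bs(1) bs'(1))
    qed simp
    show "\<theta> [x, z @ concat ts] \<longleftrightarrow> R [x, y0, z]" if x: "x \<in> tuples M \<Gamma>x" for x
    proof -
      have "cs = z # ts" if "env M ?\<Gamma>s cs" "concat cs = z @ concat ts" for cs
        using env_concat_inj[OF that(1) zts] that(2) by simp
      moreover have "concat (z # ts) = z @ concat ts" by simp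
      ultimately have "(\<exists>cs. env M ?\<Gamma>s cs \<and> concat cs = z @ concat ts \<and> \<theta>' (x # cs)) \<longleftrightarrow> \<theta>' (x # z # ts)"
        using zts by blast
      then have "\<theta> [x, z @ concat ts] \<longleftrightarrow> \<theta>' (x # z # ts)" by (simp add: \<theta>_def)
      also have "\<dots> \<longleftrightarrow> (\<exists>y\<in>tuples M \<Gamma>y. (\<forall>t\<in>set ts. R [t, y, z] \<longleftrightarrow> t \<in> ?S y0) \<and> R [x, y, z])"
        unfolding \<theta>'_def K_def by (auto simp: all_set_conv_all_nth numeral_2_eq_2)
      also have "\<dots> \<longleftrightarrow> R [x, y0, z]"
      proof
        assume "\<exists>y\<in>tuples M \<Gamma>y. (\<forall>t\<in>set ts. R [t, y, z] \<longleftrightarrow> t \<in> ?S y0) \<and> R [x, y, z]"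
        then obtain y where y: "y \<in> tuples M \<Gamma>y" "\<forall>t\<in>set ts. R [t, y, z] \<longleftrightarrow> t \<in> ?S y0" "R [x, y, z]" by blast
        have "?S y = ?S y0" using y(1,2) in_ts by (intro sep) auto
        then show "R [x, y0, z]" using x y(3) by blast
      next
        assume "R [x, y0, z]"
        then show "\<exists>y\<in>tuples M \<Gamma>y. (\<forall>t\<in>set ts. R [t, y, z] \<longleftrightarrow> t \<in> ?S y0) \<and> R [x, y, z]"
          using y0 in_ts by (intro bexI[of _ y0]) auto
      qed
      finally show ?thesis .
    qed
    have "set (zip (\<Gamma>z @ concat (replicate K \<Gamma>x)) (z @ concat ts)) =
        set (zip \<Gamma>z z) \<union> (\<Union>k<K. set (zip \<Gamma>x (ts ! k)))"
      using concat_zip[OF tsK] tuples_length[OF z] by simp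
    moreover have "set (zip \<Gamma>x (ts ! k)) \<subseteq>
        \<Union> {set (zip \<Gamma>x x) | x. x \<in> tuples M \<Gamma>x \<and> (\<exists>y\<in>tuples M \<Gamma>y. R [x, y, z])}" if k: "k < K" for k
    proof -
      have "ts ! k \<in> set ts" using k by (simp add: K_def)
      from in_ts[OF this] have "ts ! k \<in> tuples M \<Gamma>x \<and> (\<exists>y\<in>tuples M \<Gamma>y. R [ts ! k, y, z])" by blast
      then show ?thesis by (intro Union_upper CollectI exI[of _ "ts ! k"]) simp
    qed
    ultimately show "set (zip (\<Gamma>z @ concat (replicate K \<Gamma>x)) (z @ concat ts)) \<subseteq> set (zip \<Gamma>z z) \<union>
       \<Union> {set (zip \<Gamma>x x) | x. x \<in> tuples M \<Gamma>x \<and> (\<exists>y\<in>tuples M \<Gamma>y. R [x, y, z])}"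
      by blast
  qed
qed

section \<open>Terms of the enriched sequence\<close>

lemma add_diff_distrib: "(a + c) - (b + d) = (a - b) + (c - d)" for a b c d :: "'z::ab_group_add"
  by (simp add: algebra_simps)

text \<open>The default 0 outside \<open>SB\<close> makes conditions such as
  \<open>v (bval x) = 0\<close> automatic for the other sorts, so they can be imposed on all entries
  of a mixed tuple.\<close>

definition bval :: "('a, 'u, 'b::zero, 'c, 'w) seq_elem \<Rightarrow> 'b" where
  "bval x = (case x of EB b \<Rightarrow> b | _ \<Rightarrow> 0)"

abbreviation bv :: "('a, 'u, 'b::zero, 'c, 'w) seq_elem list \<Rightarrow> nat \<Rightarrow> 'b" where
  "bv X i \<equiv> bval (X ! i)"

lemma bval_simps [simp]: "bval (EA a) = 0" "bval (EB b) = b" "bval (EC c) = 0"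
  by (simp_all add: bval_def)

text \<open>A linear form on a mixed context: positions of sorts other than \<open>SB\<close> keep
  their index but do not contribute. Passing to \<open>Suc\<close> removes the innermost variable,
  as a quantifier step requires.\<close>

primrec lin ::
  "('r \<Rightarrow> 'm \<Rightarrow> 'm) \<Rightarrow> ('x, 'y) seq_sort list \<Rightarrow> (nat \<Rightarrow> 'r) \<Rightarrow> (nat \<Rightarrow> 'm::ab_group_add) \<Rightarrow> 'm" where
  "lin sc [] r f = 0"
| "lin sc (s # \<Gamma>) r f =
     (if s = SB then sc (r 0) (f 0) else 0) + lin sc \<Gamma> (\<lambda>i. r (Suc i)) (\<lambda>i. f (Suc i))"

context module
begin

lemma lin_add: "lin scale \<Gamma> r (\<lambda>i. f i + g i) = lin scale \<Gamma> r f + lin scale \<Gamma> r g"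
  by (induction \<Gamma> arbitrary: r f g) (auto simp: scale_right_distrib)

lemma lin_diff: "lin scale \<Gamma> r (\<lambda>i. f i - g i) = lin scale \<Gamma> r f - lin scale \<Gamma> r g"
  by (induction \<Gamma> arbitrary: r f g) (auto simp: scale_right_diff_distrib)

lemma lin_scale: "lin scale \<Gamma> r (\<lambda>i. scale c (f i)) = scale c (lin scale \<Gamma> r f)"
  by (induction \<Gamma> arbitrary: r f) (auto simp: scale_right_distrib mult.commute)

lemma lin_zero: "lin scale \<Gamma> r (\<lambda>i. 0) = 0"
  by (induction \<Gamma> arbitrary: r) auto

lemma lin_left_add: "lin scale \<Gamma> (\<lambda>i. r i + r' i) f = lin scale \<Gamma> r f + lin scale \<Gamma> r' f"
  by (induction \<Gamma> arbitrary: r r' f) (auto simp: scale_left_distrib)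

lemma lin_left_diff: "lin scale \<Gamma> (\<lambda>i. r i - r' i) f = lin scale \<Gamma> r f - lin scale \<Gamma> r' f"
  by (induction \<Gamma> arbitrary: r r' f) (auto simp: scale_left_diff_distrib)

lemma lin_left_scale: "lin scale \<Gamma> (\<lambda>i. c * r i) f = scale c (lin scale \<Gamma> r f)"
  by (induction \<Gamma> arbitrary: r f) (auto simp: scale_right_distrib)

lemma lin_left_zero: "lin scale \<Gamma> (\<lambda>i. 0) f = 0"
  by (induction \<Gamma> arbitrary: f) auto

lemma lin_unit:
  "n < length \<Gamma> \<Longrightarrow> \<Gamma> ! n = SB \<Longrightarrow> lin scale \<Gamma> (\<lambda>i. if i = n then 1 else 0) f = f n"
proof (induction \<Gamma> arbitrary: n f)
  case (Cons s \<Gamma>)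
  show ?case
  proof (cases n)
    case 0
    then have "lin scale \<Gamma> (\<lambda>i. if Suc i = n then 1 else 0) h = 0" for h by (simp add: lin_left_zero)
    then show ?thesis using Cons.prems 0 by simp
  next
    case (Suc m) then show ?thesis using Cons by simp
  qed
qed simp

end

lemma lin_cong:
  "(\<And>i. i < length \<Gamma> \<Longrightarrow> \<Gamma> ! i = SB \<Longrightarrow> f i = g i) \<Longrightarrow> lin sc \<Gamma> r f = lin sc \<Gamma> r g"
proof (induction \<Gamma> arbitrary: r f g)
  case (Cons s \<Gamma>)
  have "lin sc \<Gamma> (\<lambda>i. r (Suc i)) (\<lambda>i. f (Suc i)) = lin sc \<Gamma> (\<lambda>i. r (Suc i)) (\<lambda>i. g (Suc i))"
    by (rule Cons.IH) (use Cons.prems[of "Suc _"] in auto)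
  then show ?case using Cons.prems[of 0] by simp
qed simp

lemma lin_append:
  "lin sc (\<Gamma> @ \<Gamma>') r f =
    lin sc \<Gamma> r f + lin sc \<Gamma>' (\<lambda>i. r (length \<Gamma> + i)) (\<lambda>i. f (length \<Gamma> + i))"
  by (induction \<Gamma> arbitrary: r f) (auto simp: add.assoc)

text \<open>In \<open>comb X Y\<close> the first tuple supplies the coordinates on the side of \<open>\<A>\<close>, the second those on the
  side of \<open>\<C>\<close>; a coordinate in \<open>\<B>\<close> is the sum of a part from \<open>X\<close>, usually in \<open>\<A>\<close>, and one from \<open>Y\<close>.\<close>

definition cmb ::
  "('a, 'u, 'b::ab_group_add, 'c, 'w) seq_elem \<Rightarrow> ('a, 'u, 'b, 'c, 'w) seq_elem \<Rightarrow>
   ('a, 'u, 'b, 'c, 'w) seq_elem" where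
  "cmb x y = (case x of EA a \<Rightarrow> EA a | EB b \<Rightarrow> EB (b + bval y) | EC c \<Rightarrow> y)"

abbreviation "comb X Y \<equiv> map2 cmb X Y"

lemma cmb_simps [simp]:
  "cmb (EA a) y = EA a" "cmb (EB b) y = EB (b + bval y)" "cmb (EC c) y = y"
  by (simp_all add: cmb_def)

primrec shift ::
  "('a, 'u, 'b::ab_group_add, 'c, 'w) seq_elem list \<Rightarrow> (nat \<Rightarrow> 'b) \<Rightarrow> ('a, 'u, 'b, 'c, 'w) seq_elem list"
  where
  "shift [] g = []"
| "shift (y # Y) g = (case y of EB b \<Rightarrow> EB (b + g 0) | _ \<Rightarrow> y) # shift Y (\<lambda>i. g (Suc i))"

lemma length_shift [simp]: "length (shift Y g) = length Y"
  by (induction Y arbitrary: g) auto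

lemma shift_nth:
  "i < length Y \<Longrightarrow> shift Y g ! i = (case Y ! i of EB b \<Rightarrow> EB (b + g i) | y \<Rightarrow> y)"
  by (induction Y arbitrary: g i) (auto simp: nth_Cons split: nat.split seq_elem.split)

text \<open>Gaussian elimination of variable 0 without division: the tails serve relations in which
  that variable is absent, the cross products combine two relations so that it cancels.\<close>

definition elim_T :: "(nat \<Rightarrow> 'r::comm_ring_1) set \<Rightarrow> (nat \<Rightarrow> 'r) set" where
  "elim_T T = (\<lambda>t i. t (Suc i)) ` T \<union> (\<lambda>(t, t') i. t 0 * t' (Suc i) - t' 0 * t (Suc i)) ` (T \<times> T)"

text \<open>A common multiple of all leading coefficients that might have to be divided by; which
  relation becomes the pivot depends on the tuple.\<close>

definition elim_m :: "(nat \<Rightarrow> 'r::comm_ring_1) set \<Rightarrow> 'r" where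
  "elim_m T = (\<Prod>t\<in>{t \<in> T. t 0 \<noteq> 0}. t 0)"

lemma is_struct_val:
  assumes "is_struct L M" "wt_trm L \<Gamma> t s" "xs \<in> tuples M \<Gamma>"
  shows "val M xs t \<in> univ M s"
  using assms(2)
proof (induction rule: wt_trm.induct)
  case (1 n) then show ?case using assms(3) by (simp add: tuples_nth)
next
  case (2 f ts)
  then have "map (val M xs) ts \<in> tuples M (fdom L f)"
    by (auto simp: tuples_iff list_all2_map1 elim: list_all2_mono)
  then show ?case using assms(1) 2 by (simp add: is_struct_def)
qed

section \<open>The enriched exact sequence and the shape of its terms\<close>

locale exact_sequence =
  fixes scA :: "'r::idom \<Rightarrow> 'a::ab_group_add \<Rightarrow> 'a"
    and scB :: "'r \<Rightarrow> 'b::ab_group_add \<Rightarrow> 'b"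
    and scC :: "'r \<Rightarrow> 'c::ab_group_add \<Rightarrow> 'c"
    and \<iota> :: "'a \<Rightarrow> 'b" and v :: "'b \<Rightarrow> 'c"
    and LA :: "('x side_sort, 'f, 'p) language"
    and MA :: "('x side_sort, ('a, 'u) side_elem, 'f, 'p) struct"
    and LC :: "('y side_sort, 'g, 'q) language"
    and MC :: "('y side_sort, ('c, 'w) side_elem, 'g, 'q) struct"
    and L :: "(('x, 'y) seq_sort, ('r, 'f, 'g) seq_fun, ('p, 'q) seq_rel) language"
    and M :: "(('x, 'y) seq_sort, ('a, 'u, 'b, 'c, 'w) seq_elem,
               ('r, 'f, 'g) seq_fun, ('p, 'q) seq_rel) struct"
  assumes exact: "short_exact scA scB scC \<iota> v"
    and enrA: "side_enrichment LA MA" and enrC: "side_enrichment LC MC"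
    and L_eq: "L = seq_language LA LC" and M_eq: "M = seq_struct scA scB scC \<iota> v MA MC"
    and torsion: "torsion_free scC"
    and finite_quot: "\<And>l. l \<noteq> 0 \<Longrightarrow> finite (range (mult_coset scC l))"
begin

sublocale B: module scB
  using exact by (simp add: short_exact_def module_hom_def)

sublocale C: module scC
  using exact by (simp add: short_exact_def module_hom_def)

sublocale v: module_hom scB scC v
  using exact by (simp add: short_exact_def)

lemma v_iota [simp]: "v (\<iota> a) = 0"
  using exact by (auto simp: short_exact_def)

lemma iota_inj: "\<iota> a = \<iota> a' \<longleftrightarrow> a = a'"
  using exact by (auto simp: short_exact_def inj_def)

lemma v_surj: "\<exists>b. v b = c"
  using exact by (metis short_exact_def surjD)

lemma scC_cancel: "r \<noteq> 0 \<Longrightarrow> scC r c = scC r c' \<longleftrightarrow> c = c'"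
  using torsion unfolding torsion_free_def
  by (metis C.scale_right_diff_distrib right_minus_eq)

lemma v_lin: "v (lin scB \<Gamma> r f) = lin scC \<Gamma> r (\<lambda>i. v (f i))"
  by (induction \<Gamma> arbitrary: r f) (auto simp: v.add v.scale v.zero)

lemma univ_SA: "univ M (SA s) = EA ` univ MA s" and univ_SB: "univ M SB = range EB"
  and univ_SC: "univ M (SC t) = EC ` univ MC t"
  by (simp_all add: M_eq seq_struct_def)

lemma core_A: "univ MA Core = range CoreEl" and core_C: "univ MC Core = range CoreEl"
  using enrA enrC by (simp_all add: side_enrichment_def)

lemma fdom_L: "fdom L = seq_fdom LA LC" and fcod_L: "fcod L = seq_fcod LA LC"
  and sorts_L: "sorts L = SA ` sorts LA \<union> {SB} \<union> SC ` sorts LC"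
  and funs_L: "funs L = range OpA \<union> range OpB \<union> range OpC \<union> {Iota, Vee} \<union> FunA ` funs LA \<union> FunC ` funs LC"
  by (simp_all add: L_eq seq_language_def)

lemma core_sorts [simp]: "SB \<in> sorts L" "SA Core \<in> sorts L" "SC Core \<in> sorts L"
  using enrA enrC by (auto simp: sorts_L side_enrichment_def)

lemma struct_M: "is_struct L M"
  unfolding is_struct_def
proof (intro ballI)
  fix f us assume f: "f \<in> funs L" and us: "us \<in> tuples M (fdom L f)"
  show "fint M f us \<in> univ M (fcod L f)"
  proof (cases f)
    case (FunA g)
    then have "map the_EA us \<in> tuples MA (fdom LA g)"
      using us by (fastforce simp: fdom_L tuples_iff list_all2_conv_all_nth univ_SA)
    moreover have "g \<in> funs LA" using f FunA by (auto simp: funs_L)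
    ultimately have "fint MA g (map the_EA us) \<in> univ MA (fcod LA g)"
      using enrA by (simp add: side_enrichment_def is_struct_def)
    then show ?thesis by (simp add: FunA fcod_L univ_SA M_eq seq_struct_def)
  next
    case (FunC g)
    then have "map the_EC us \<in> tuples MC (fdom LC g)"
      using us by (fastforce simp: fdom_L tuples_iff list_all2_conv_all_nth univ_SC)
    moreover have "g \<in> funs LC" using f FunC by (auto simp: funs_L)
    ultimately have "fint MC g (map the_EC us) \<in> univ MC (fcod LC g)"
      using enrC by (simp add: side_enrichment_def is_struct_def)
    then show ?thesis by (simp add: FunC fcod_L univ_SC M_eq seq_struct_def)
  qed (auto simp: fcod_L M_eq seq_struct_def core_A core_C)
qed

lemmas val_in = is_struct_val[OF struct_M]

lemma val_SB: "wt_trm L \<Gamma> t SB \<Longrightarrow> X \<in> tuples M \<Gamma> \<Longrightarrow> val M X t = EB (bval (val M X t))"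
  using val_in univ_SB by fastforce

definition agA :: "('x, 'y) seq_sort list \<Rightarrow> ('a, 'u, 'b, 'c, 'w) seq_elem list \<Rightarrow>
    ('a, 'u, 'b, 'c, 'w) seq_elem list \<Rightarrow> bool" where
  "agA \<Gamma> X Y \<longleftrightarrow> (\<forall>i<length \<Gamma>. \<forall>s. \<Gamma> ! i = SA s \<longrightarrow> X ! i = Y ! i)"

definition agC :: "('x, 'y) seq_sort list \<Rightarrow> ('a, 'u, 'b, 'c, 'w) seq_elem list \<Rightarrow>
    ('a, 'u, 'b, 'c, 'w) seq_elem list \<Rightarrow> bool" where
  "agC \<Gamma> X Y \<longleftrightarrow> (\<forall>i<length \<Gamma>. (\<forall>s. \<Gamma> ! i = SC s \<longrightarrow> X ! i = Y ! i) \<and>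
     (\<Gamma> ! i = SB \<longrightarrow> v (bv X i) = v (bv Y i)))"

text \<open>No function symbol leads from another part of the sequence into the sorts of the
  \<open>\<A>\<close> side.\<close>

lemma term_A: "wt_trm L \<Gamma> t s \<Longrightarrow> s = SA s' \<Longrightarrow> agA \<Gamma> X Y \<Longrightarrow> val M X t = val M Y t"
proof (induction arbitrary: s' rule: wt_trm.induct)
  case (1 n) then show ?case by (simp add: agA_def)
next
  case (2 f ts)
  have "\<forall>i<length (fdom L f). \<exists>s'. fdom L f ! i = SA s'"
    using 2(3) by (cases f) (auto simp: fdom_L fcod_L nth_Cons')
  then have "val M X (ts ! i) = val M Y (ts ! i)" if "i < length ts" for i
    using 2 that by (auto simp: list_all2_conv_all_nth)
  then have "map (val M X) ts = map (val M Y) ts" by (intro nth_equalityI) simp_all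
  then show ?case by (simp only: val.simps)
qed

text \<open>A term of sort \<open>SB\<close> is a linear form in the variables of that sort plus the
  image under \<iota> of a term on the \<open>\<A>\<close> side. The second summand need not be
  named: \<open>v\<close> kills it, and it cancels between tuples that agree on the
  \<open>\<A>\<close> side.\<close>

lemma term_B:
  "wt_trm L \<Gamma> t s \<Longrightarrow> s = SB \<Longrightarrow>
    \<exists>r. (\<forall>X\<in>tuples M \<Gamma>. v (bval (val M X t)) = lin scC \<Gamma> r (\<lambda>i. v (bv X i))) \<and>
      (\<forall>X\<in>tuples M \<Gamma>. \<forall>Y\<in>tuples M \<Gamma>. agA \<Gamma> X Y \<longrightarrow>
        bval (val M Y t) - bval (val M X t) = lin scB \<Gamma> r (bv Y) - lin scB \<Gamma> r (bv X))"
  (is "_ \<Longrightarrow> _ \<Longrightarrow> \<exists>r. ?P t r")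
proof (induction rule: wt_trm.induct)
  case (1 n)
  then show ?case
    by (intro exI[of _ "\<lambda>i. if i = n then 1 else 0"]) (simp add: C.lin_unit B.lin_unit)
next
  case (2 f ts)
  consider (opB) k where "f = OpB k" | (iota) "f = Iota"
    using 2(3) by (cases f) (auto simp: fcod_L)
  then show ?case
  proof cases
    case iota
    then obtain t where t: "ts = [t]" "wt_trm L \<Gamma> t (SA Core)"
      using 2(2) by (auto simp: fdom_L list_all2_Cons2)
    have "bval (val M Y (App f ts)) = bval (val M X (App f ts))" if "agA \<Gamma> X Y" for X Y
      using term_A[OF t(2) refl that] iota t(1) by simp
    moreover have "v (bval (val M X (App f ts))) = 0" for X
      by (simp add: iota t(1) M_eq seq_struct_def)
    ultimately show ?thesis
      by (intro exI[of _ "\<lambda>i. 0"]) (simp add: C.lin_left_zero B.lin_left_zero)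
  next
    case opB
    have arg: "\<exists>r. ?P (ts ! i) r" "wt_trm L \<Gamma> (ts ! i) SB" if "i < mod_op_arity k" for i
      using 2(2) that opB by (auto simp: fdom_L list_all2_conv_all_nth)
    have len: "length ts = mod_op_arity k"
      using 2(2) opB by (auto simp: fdom_L list_all2_conv_all_nth)
    have bv: "bval (val M X (App f ts)) = mod_op_int scB k (map (\<lambda>t. bval (val M X t)) ts)"
      if X: "X \<in> tuples M \<Gamma>" for X
    proof -
      have "map (the_EB \<circ> val M X) ts = map (\<lambda>t. bval (val M X t)) ts"
        using val_SB[OF arg(2) X] len by (auto simp: in_set_conv_nth) (metis seq_elem.sel(2))
      then show ?thesis by (simp add: opB M_eq seq_struct_def del: map_eq_conv)
    qed
    show ?thesis
    proof (cases k)
      case Zero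
      then show ?thesis
        by (intro exI[of _ "\<lambda>i. 0"])
          (simp add: bv C.lin_left_zero B.lin_left_zero v.zero del: val.simps)
    next
      case Plus
      then obtain t u where ts: "ts = [t, u]" using len by (auto simp: numeral_2_eq_2 length_Suc_conv)
      obtain r r' where "?P t r" "?P u r'" using arg(1)[of 0] arg(1)[of 1] Plus ts by auto
      then show ?thesis
        by (intro exI[of _ "\<lambda>i. r i + r' i"])
          (simp add: ts bv[unfolded ts] Plus C.lin_left_add B.lin_left_add v.add add_diff_distrib del: val.simps)
    next
      case Minus
      then obtain t where ts: "ts = [t]" using len by (auto simp: length_Suc_conv)
      obtain r where "?P t r" using arg(1)[of 0] Minus ts by auto
      then show ?thesis
        by (intro exI[of _ "\<lambda>i. 0 - r i"], simp only: C.lin_left_diff B.lin_left_diff C.lin_left_zero B.lin_left_zero)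
          (simp add: ts bv[unfolded ts] Minus v.neg del: val.simps, metis minus_diff_eq)
    next
      case (Scale c)
      then obtain t where ts: "ts = [t]" using len by (auto simp: length_Suc_conv)
      obtain r where "?P t r" using arg(1)[of 0] Scale ts by auto
      then show ?thesis
        by (intro exI[of _ "\<lambda>i. c * r i"])
          (simp add: ts bv[unfolded ts] Scale C.lin_left_scale B.lin_left_scale v.scale
             B.scale_right_diff_distrib[symmetric] del: val.simps)
    qed
  qed
qed

text \<open>\<open>Vee\<close> is the only symbol leading into the \<open>\<C>\<close> side from
  outside, and on a term of sort \<open>SB\<close> it depends only on the images of the variables
  under \<open>v\<close>.\<close>

lemma term_C:
  "wt_trm L \<Gamma> t s \<Longrightarrow> s = SC s' \<Longrightarrow> X \<in> tuples M \<Gamma> \<Longrightarrow> Y \<in> tuples M \<Gamma> \<Longrightarrow> agC \<Gamma> X Y \<Longrightarrow>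
    val M X t = val M Y t"
proof (induction arbitrary: s' rule: wt_trm.induct)
  case (1 n) then show ?case by (simp add: agC_def)
next
  case (2 f ts)
  show ?case
  proof (cases "f = Vee")
    case True
    then obtain t where t: "ts = [t]" "wt_trm L \<Gamma> t SB"
      using 2(2) by (auto simp: fdom_L list_all2_Cons2)
    obtain r where r: "\<forall>X\<in>tuples M \<Gamma>. v (bval (val M X t)) = lin scC \<Gamma> r (\<lambda>i. v (bv X i))"
      using term_B[OF t(2) refl] by blast
    have "lin scC \<Gamma> r (\<lambda>i. v (bv X i)) = lin scC \<Gamma> r (\<lambda>i. v (bv Y i))"
      using 2(6) by (intro lin_cong) (simp add: agC_def)
    then have "v (the_EB (val M X t)) = v (the_EB (val M Y t))"
      using r 2(4,5) val_SB[OF t(2)] by (metis seq_elem.sel(2))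
    then show ?thesis by (simp add: True t(1) M_eq seq_struct_def)
  next
    case False
    then have "\<forall>i<length (fdom L f). \<exists>s'. fdom L f ! i = SC s'"
      using 2(3) by (cases f) (auto simp: fdom_L fcod_L nth_Cons')
    then have "val M X (ts ! i) = val M Y (ts ! i)" if "i < length ts" for i
      using 2 that by (auto simp: list_all2_conv_all_nth)
    then have "map (val M X) ts = map (val M Y) ts" by (intro nth_equalityI) simp_all
    then show ?thesis by (simp only: val.simps)
  qed
qed

lemma rel_cases:
  assumes "wf_fm L \<Gamma> (Rel P ts)"
  shows "(\<forall>t\<in>set ts. \<exists>s. wt_trm L \<Gamma> t (SA s)) \<or> (\<forall>t\<in>set ts. \<exists>s. wt_trm L \<Gamma> t (SC s))"
  using assms
proof (cases P)
  case (RelA p)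
  then have "list_all2 (\<lambda>t s. wt_trm L \<Gamma> t (SA s)) ts (rdom LA p)"
    using assms by (simp add: L_eq seq_language_def list_all2_map2)
  then show ?thesis by (intro disjI1) (fastforce simp: list_all2_conv_all_nth in_set_conv_nth)
next
  case (RelC p)
  then have "list_all2 (\<lambda>t s. wt_trm L \<Gamma> t (SC s)) ts (rdom LC p)"
    using assms by (simp add: L_eq seq_language_def list_all2_map2)
  then show ?thesis by (intro disjI2) (fastforce simp: list_all2_conv_all_nth in_set_conv_nth)
qed

end

section \<open>Invariance under small translations\<close>

lemma diff_eq_diff_imp: "a - b = c - d \<Longrightarrow> a = b + c - d" for a b c d :: "'z::ab_group_add"
  by (metis add_diff_eq diff_add_cancel add.commute)

context exact_sequence
begin

text \<open>A relation constrains \<open>g\<close> only if it holds for \<open>c\<close>. An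
  equation between terms of sort \<open>SB\<close> has under \<open>v\<close> the image r\<cdot>c;
  if this is nonzero, the equation fails both before and after any translation by elements of
  \<open>\<A>\<close>.\<close>

definition kill :: "(nat \<Rightarrow> 'r) set \<Rightarrow> ('x, 'y) seq_sort list \<Rightarrow> (nat \<Rightarrow> 'c) \<Rightarrow> (nat \<Rightarrow> 'b) \<Rightarrow> bool" where
  "kill T \<Gamma> c g \<longleftrightarrow> (\<forall>r\<in>T. lin scC \<Gamma> r c = 0 \<longrightarrow> lin scB \<Gamma> r g = 0)"

lemma kill_mono: "kill T \<Gamma> c g \<Longrightarrow> T' \<subseteq> T \<Longrightarrow> kill T' \<Gamma> c g"
  by (auto simp: kill_def)

lemma kill_scale: "kill T \<Gamma> c g \<Longrightarrow> kill T \<Gamma> c (\<lambda>i. scB l (g i))"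
  by (simp add: kill_def B.lin_scale)

lemma elim_m_nonzero: "finite T \<Longrightarrow> elim_m (T :: (nat \<Rightarrow> 'r) set) \<noteq> 0"
  by (simp add: elim_m_def)

lemma finite_elim_T: "finite T \<Longrightarrow> finite (elim_T (T :: (nat \<Rightarrow> 'r) set))"
  by (simp add: elim_T_def)

text \<open>A relation of \<open>T\<close> involving the first variable determines its value up to the factor \<open>elim_m T\<close>;
  the remaining relations then follow from the elimination of that variable.\<close>

lemma elim_pivot:
  assumes "finite T" "t \<in> T" "t 0 \<noteq> 0" "lin scC (SB # \<Gamma>) t c = 0"
    and kill: "kill (elim_T T) \<Gamma> (\<lambda>i. c (Suc i)) g"
  obtains m' where "kill T (SB # \<Gamma>) c
    (case_nat (- scB m' (lin scB \<Gamma> (\<lambda>i. t (Suc i)) g)) (\<lambda>i. scB (elim_m T) (g i)))"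
proof -
  have "t 0 dvd elim_m T"
    unfolding elim_m_def using assms(1-3) by (intro dvd_prodI) auto
  \<comment> \<open>With m = t 0 \<cdot> m', the head -m'(t\<cdot>g), where t\<cdot>g is formed with
    the tail of t, solves the pivot relation for the tail m g without a division in the
    module.\<close>
  then obtain m' where m': "elim_m T = t 0 * m'" by (elim dvdE)
  let ?h = "\<lambda>t i. t (Suc i)"
  have "kill T (SB # \<Gamma>) c (case_nat (- scB m' (lin scB \<Gamma> (?h t) g)) (\<lambda>i. scB (elim_m T) (g i)))"
    unfolding kill_def
  proof (intro ballI impI)
    fix t' assume t': "t' \<in> T" "lin scC (SB # \<Gamma>) t' c = 0"
    let ?s = "\<lambda>i. t 0 * t' (Suc i) - t' 0 * t (Suc i)"
    have e: "lin scC \<Gamma> (?h t) (?h c) = - scC (t 0) (c 0)" "lin scC \<Gamma> (?h t') (?h c) = - scC (t' 0) (c 0)"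
      using assms(4) t'(2) by (simp_all add: eq_neg_iff_add_eq_0 add.commute)
    have "?s \<in> elim_T T" using assms(2) t'(1) by (force simp: elim_T_def)
    moreover have "lin scC \<Gamma> ?s (?h c) = 0"
      by (simp add: C.lin_left_diff C.lin_left_scale e C.scale_minus_right C.scale_scale mult.commute)
    ultimately have "lin scB \<Gamma> ?s g = 0" using kill by (simp add: kill_def)
    then have "scB m' (scB (t 0) (lin scB \<Gamma> (?h t') g)) = scB m' (scB (t' 0) (lin scB \<Gamma> (?h t) g))"
      by (simp add: B.lin_left_diff B.lin_left_scale)
    then show "lin scB (SB # \<Gamma>) t' (case_nat (- scB m' (lin scB \<Gamma> (?h t) g)) (\<lambda>i. scB (elim_m T) (g i))) = 0"
      by (simp add: B.lin_scale m' mult.commute)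
  qed
  then show ?thesis using that by blast
qed

text \<open>If no relation that holds involves variable 0, its translation \<open>g0\<close> is
  free, and the relations that hold are covered by the tails in \<open>elim_T\<close>.\<close>

lemma elim_no_pivot:
  assumes "\<And>t. t \<in> T \<Longrightarrow> lin scC (SB # \<Gamma>) t c = 0 \<Longrightarrow> t 0 = 0"
    and kill: "kill (elim_T T) \<Gamma> (\<lambda>i. c (Suc i)) g"
  shows "kill T (SB # \<Gamma>) c (case_nat g0 (\<lambda>i. scB m (g i)))"
  unfolding kill_def
proof (intro ballI impI)
  fix t assume t: "t \<in> T" "lin scC (SB # \<Gamma>) t c = 0"
  then have "t 0 = 0" using assms(1) by blast
  moreover have "(\<lambda>i. t (Suc i)) \<in> elim_T T" using t(1) by (simp add: elim_T_def)
  ultimately show "lin scB (SB # \<Gamma>) t (case_nat g0 (\<lambda>i. scB m (g i))) = 0"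
    using t(2) kill by (simp add: kill_def B.lin_scale)
qed

lemma kill_tail:
  assumes "s \<noteq> SB" "kill ((\<lambda>t i. t (Suc i)) ` T) \<Gamma> (\<lambda>i. c (Suc i)) g"
  shows "kill T (s # \<Gamma>) c (case_nat g0 g)"
  using assms by (simp add: kill_def)

definition invariant :: "('x, 'y) seq_sort list \<Rightarrow> (('x, 'y) seq_sort, ('r, 'f, 'g) seq_fun, ('p, 'q) seq_rel) fm
    \<Rightarrow> (nat \<Rightarrow> 'r) set \<Rightarrow> 'r \<Rightarrow> bool" where
  "invariant \<Gamma> \<phi> T l \<longleftrightarrow> (\<forall>Y\<in>tuples M \<Gamma>. \<forall>g. (\<forall>i. v (g i) = 0) \<and> kill T \<Gamma> (\<lambda>i. v (bv Y i)) g \<longrightarrow>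
     sat M (shift Y (\<lambda>i. scB l (g i))) \<phi> = sat M Y \<phi>)"

lemma shift_in: "Y \<in> tuples M \<Gamma> \<Longrightarrow> shift Y g \<in> tuples M \<Gamma>"
  by (auto simp: tuples_iff list_all2_conv_all_nth shift_nth univ_SB split: seq_elem.split)
    (metis (no_types, lifting) UNIV_I image_iff seq_elem.distinct seq_sort.exhaust univ_SA univ_SB univ_SC)

lemma shift_bv:
  "Y \<in> tuples M \<Gamma> \<Longrightarrow> i < length \<Gamma> \<Longrightarrow> \<Gamma> ! i = SB \<Longrightarrow> bv (shift Y g) i = bv Y i + g i"
  using tuples_nth[of Y M \<Gamma> i] by (auto simp: shift_nth univ_SB tuples_length)

lemma shift_agA: "Y \<in> tuples M \<Gamma> \<Longrightarrow> agA \<Gamma> Y (shift Y g)"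
  using tuples_nth[of Y M \<Gamma>] by (fastforce simp: agA_def shift_nth univ_SA tuples_length)

lemma shift_agC:
  assumes "Y \<in> tuples M \<Gamma>" "\<And>i. v (g i) = 0" shows "agC \<Gamma> Y (shift Y g)"
  using tuples_nth[OF assms(1)] assms(2) shift_bv[OF assms(1)]
  by (fastforce simp: agC_def shift_nth univ_SC v.add tuples_length[OF assms(1)])

text \<open>Bringing both terms to one side, the equation becomes the vanishing of a linear form up
  to a summand from \<open>\<A>\<close>; its coefficients \<open>r\<close> are the relation that the
  equation contributes to T.\<close>

lemma eq_SB:
  assumes "wf_fm L \<Gamma> (Eq t u)" "wt_trm L \<Gamma> t SB" "wt_trm L \<Gamma> u SB"
  obtains r where
    "\<And>X Y. X \<in> tuples M \<Gamma> \<Longrightarrow> Y \<in> tuples M \<Gamma> \<Longrightarrow> agA \<Gamma> X Y \<Longrightarrow>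
       bval (val M Y t) - bval (val M Y u) =
       bval (val M X t) - bval (val M X u) + lin scB \<Gamma> r (bv Y) - lin scB \<Gamma> r (bv X)"
    "\<And>X. X \<in> tuples M \<Gamma> \<Longrightarrow> v (bval (val M X t) - bval (val M X u)) = lin scC \<Gamma> r (\<lambda>i. v (bv X i))"
    "\<And>X. X \<in> tuples M \<Gamma> \<Longrightarrow> sat M X (Eq t u) \<longleftrightarrow> bval (val M X t) - bval (val M X u) = 0"
proof -
  obtain r1 r2 where
    1: "\<forall>X\<in>tuples M \<Gamma>. v (bval (val M X t)) = lin scC \<Gamma> r1 (\<lambda>i. v (bv X i))"
    "\<forall>X\<in>tuples M \<Gamma>. \<forall>Y\<in>tuples M \<Gamma>. agA \<Gamma> X Y \<longrightarrow>
        bval (val M Y t) - bval (val M X t) = lin scB \<Gamma> r1 (bv Y) - lin scB \<Gamma> r1 (bv X)" and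
    2: "\<forall>X\<in>tuples M \<Gamma>. v (bval (val M X u)) = lin scC \<Gamma> r2 (\<lambda>i. v (bv X i))"
    "\<forall>X\<in>tuples M \<Gamma>. \<forall>Y\<in>tuples M \<Gamma>. agA \<Gamma> X Y \<longrightarrow>
        bval (val M Y u) - bval (val M X u) = lin scB \<Gamma> r2 (bv Y) - lin scB \<Gamma> r2 (bv X)"
    using term_B[OF assms(2) refl] term_B[OF assms(3) refl] by blast
  show ?thesis
  proof (rule that[of "\<lambda>i. r1 i - r2 i"])
    fix X Y assume a: "X \<in> tuples M \<Gamma>" "Y \<in> tuples M \<Gamma>" "agA \<Gamma> X Y"
    have "bval (val M Y t) = bval (val M X t) + lin scB \<Gamma> r1 (bv Y) - lin scB \<Gamma> r1 (bv X)"
      "bval (val M Y u) = bval (val M X u) + lin scB \<Gamma> r2 (bv Y) - lin scB \<Gamma> r2 (bv X)"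
      using diff_eq_diff_imp[OF 1(2)[rule_format, OF a]] diff_eq_diff_imp[OF 2(2)[rule_format, OF a]] .
    then show "bval (val M Y t) - bval (val M Y u) =
       bval (val M X t) - bval (val M X u) + lin scB \<Gamma> (\<lambda>i. r1 i - r2 i) (bv Y) - lin scB \<Gamma> (\<lambda>i. r1 i - r2 i) (bv X)"
      by (simp add: B.lin_left_diff)
  next
    fix X assume "X \<in> tuples M \<Gamma>"
    then show "v (bval (val M X t) - bval (val M X u)) = lin scC \<Gamma> (\<lambda>i. r1 i - r2 i) (\<lambda>i. v (bv X i))"
      using 1(1) 2(1) by (simp add: C.lin_left_diff v.diff)
  next
    fix X assume "X \<in> tuples M \<Gamma>"
    then obtain b b' where "val M X t = EB b" "val M X u = EB b'"
      using val_SB assms(2,3) by blast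
    then show "sat M X (Eq t u) \<longleftrightarrow> bval (val M X t) - bval (val M X u) = 0" by simp
  qed
qed

text \<open>l l' g is l times l' g, and l' g is still annihilated by the relations that annihilate
  g. Two formulas therefore have a common pair: the union of the sets and the product of the
  scalars.\<close>

lemma invariant_mono:
  assumes "invariant \<Gamma> \<phi> T l" "T \<subseteq> T'"
  shows "invariant \<Gamma> \<phi> T' (l * l')"
  unfolding invariant_def
proof (intro ballI allI impI)
  fix Y g assume Y: "Y \<in> tuples M \<Gamma>" and g: "(\<forall>i. v (g i) = 0) \<and> kill T' \<Gamma> (\<lambda>i. v (bv Y i)) g"
  have "(\<forall>i. v (scB l' (g i)) = 0) \<and> kill T \<Gamma> (\<lambda>i. v (bv Y i)) (\<lambda>i. scB l' (g i))"
    using g assms(2) by (auto simp: v.scale intro: kill_scale kill_mono)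
  then have "sat M (shift Y (\<lambda>i. scB l (scB l' (g i)))) \<phi> = sat M Y \<phi>"
    by (rule assms(1)[unfolded invariant_def, rule_format, OF Y])
  then show "sat M (shift Y (\<lambda>i. scB (l * l') (g i))) \<phi> = sat M Y \<phi>" by simp
qed

text \<open>A witness outside \<open>\<B>\<close> can be kept. A witness in \<open>\<B>\<close> has
  to be translated as well, by an amount that is forced if a relation involving it holds and is free
  otherwise.\<close>

lemma invariant_Ex:
  assumes "invariant (s # \<Gamma>) \<phi> T l" "finite T"
  shows "\<exists>T' l'. finite T' \<and> (l \<noteq> 0 \<longrightarrow> l' \<noteq> 0) \<and> invariant \<Gamma> (Ex s \<phi>) T' l'"
proof (cases "s = SB")
  case False
  have "invariant \<Gamma> (Ex s \<phi>) ((\<lambda>t i. t (Suc i)) ` T) l"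
    unfolding invariant_def
  proof (intro ballI allI impI)
    fix Y g assume Y: "Y \<in> tuples M \<Gamma>"
      and g: "(\<forall>i. v (g i) = 0) \<and> kill ((\<lambda>t i. t (Suc i)) ` T) \<Gamma> (\<lambda>i. v (bv Y i)) g"
    have "sat M (y # shift Y (\<lambda>i. scB l (g i))) \<phi> = sat M (y # Y) \<phi>" if y: "y \<in> univ M s" for y
    proof -
      let ?g = "case_nat 0 g"
      have "kill T (s # \<Gamma>) (\<lambda>i. v (bv (y # Y) i)) ?g" using False g by (intro kill_tail) auto
      moreover have "\<forall>i. v (?g i) = 0" using g by (simp add: v.zero split: nat.split)
      moreover have "y # Y \<in> tuples M (s # \<Gamma>)" using Y y by simp
      ultimately have "sat M (shift (y # Y) (\<lambda>i. scB l (?g i))) \<phi> = sat M (y # Y) \<phi>"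
        using assms(1) unfolding invariant_def by blast
      then show ?thesis by (cases y) auto
    qed
    then show "sat M (shift Y (\<lambda>i. scB l (g i))) (Ex s \<phi>) = sat M Y (Ex s \<phi>)" by simp
  qed
  then show ?thesis using assms(2) by blast
next
  case True
  let ?m = "elim_m T"
  have "invariant \<Gamma> (Ex SB \<phi>) (elim_T T) (l * ?m)"
    unfolding invariant_def
  proof (intro ballI allI impI)
    fix Y g assume Y: "Y \<in> tuples M \<Gamma>"
      and g: "(\<forall>i. v (g i) = 0) \<and> kill (elim_T T) \<Gamma> (\<lambda>i. v (bv Y i)) g"
    \<comment> \<open>The translation \<open>a\<close> depends only on the fibre of
      \<open>b\<close>, so the same \<open>a\<close> serves at \<open>b - a\<close> when a witness
      for the translated tuple is carried back.\<close>
    have step: "\<exists>a. v a = 0 \<and> (\<forall>b'. v b' = v b \<longrightarrow>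
        sat M (EB (b' + a) # shift Y (\<lambda>i. scB (l * ?m) (g i))) \<phi> = sat M (EB b' # Y) \<phi>)" for b
    proof -
      let ?c = "case_nat (v b) (\<lambda>i. v (bv Y i))"
      have k: "kill (elim_T T) \<Gamma> (\<lambda>i. ?c (Suc i)) g" using g by simp
      have "\<exists>g0. v g0 = 0 \<and> kill T (SB # \<Gamma>) ?c (case_nat g0 (\<lambda>i. scB ?m (g i)))"
      proof (cases "\<exists>t\<in>T. t 0 \<noteq> 0 \<and> lin scC (SB # \<Gamma>) t ?c = 0")
        case True
        then obtain t where "t \<in> T" "t 0 \<noteq> 0" "lin scC (SB # \<Gamma>) t ?c = 0" by blast
        from elim_pivot[OF assms(2) this k] obtain m' where "kill T (SB # \<Gamma>) ?c
          (case_nat (- scB m' (lin scB \<Gamma> (\<lambda>i. t (Suc i)) g)) (\<lambda>i. scB (elim_m T) (g i)))" .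
        moreover have "v (- scB m' (lin scB \<Gamma> (\<lambda>i. t (Suc i)) g)) = 0"
          using g by (simp add: v.neg v.scale v_lin C.lin_zero)
        ultimately show ?thesis by blast
      next
        case False
        then have "kill T (SB # \<Gamma>) ?c (case_nat 0 (\<lambda>i. scB ?m (g i)))"
          by (intro elim_no_pivot[OF _ k]) blast
        then show ?thesis using v.zero by blast
      qed
      then obtain g0 where g0: "v g0 = 0" "kill T (SB # \<Gamma>) ?c (case_nat g0 (\<lambda>i. scB ?m (g i)))" by blast
      let ?g = "case_nat g0 (\<lambda>i. scB ?m (g i))"
      have "sat M (EB (b' + scB l g0) # shift Y (\<lambda>i. scB (l * ?m) (g i))) \<phi> = sat M (EB b' # Y) \<phi>"
        if b': "v b' = v b" for b'
      proof -
        have "(\<lambda>i. v (bv (EB b' # Y) i)) = ?c" using b' by (auto simp: fun_eq_iff nth_Cons split: nat.split)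
        then have "kill T (SB # \<Gamma>) (\<lambda>i. v (bv (EB b' # Y) i)) ?g" using g0(2) by simp
        moreover have "\<forall>i. v (?g i) = 0" using g g0(1) by (simp add: v.scale split: nat.split)
        moreover have "EB b' # Y \<in> tuples M (SB # \<Gamma>)" using Y by (simp add: univ_SB)
        ultimately have "sat M (shift (EB b' # Y) (\<lambda>i. scB l (?g i))) \<phi> = sat M (EB b' # Y) \<phi>"
          using assms(1) unfolding invariant_def True by blast
        then show ?thesis by simp
      qed
      moreover have "v (scB l g0) = 0" using g0(1) by (simp add: v.scale)
      ultimately show ?thesis by blast
    qed
    have "(\<exists>b. sat M (EB b # shift Y (\<lambda>i. scB (l * ?m) (g i))) \<phi>) = (\<exists>b. sat M (EB b # Y) \<phi>)"
    proof
      assume "\<exists>b. sat M (EB b # shift Y (\<lambda>i. scB (l * ?m) (g i))) \<phi>"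
      then obtain b where b: "sat M (EB b # shift Y (\<lambda>i. scB (l * ?m) (g i))) \<phi>" by blast
      obtain a where a: "v a = 0" "\<forall>b'. v b' = v b \<longrightarrow>
        sat M (EB (b' + a) # shift Y (\<lambda>i. scB (l * ?m) (g i))) \<phi> = sat M (EB b' # Y) \<phi>"
        using step by blast
      have "v (b - a) = v b" using a(1) by (simp add: v.diff)
      then have "sat M (EB (b - a) # Y) \<phi>" using a(2) b by fastforce
      then show "\<exists>b. sat M (EB b # Y) \<phi>" by blast
    next
      assume "\<exists>b. sat M (EB b # Y) \<phi>"
      then show "\<exists>b. sat M (EB b # shift Y (\<lambda>i. scB (l * ?m) (g i))) \<phi>" using step by blast
    qed
    then show "sat M (shift Y (\<lambda>i. scB (l * ?m) (g i))) (Ex SB \<phi>) = sat M Y (Ex SB \<phi>)"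
      by (simp add: univ_SB)
  qed
  then show ?thesis using assms(2) finite_elim_T elim_m_nonzero True by (metis mult_eq_0_iff)
qed

lemma invariant_exists:
  "wf_fm L \<Gamma> \<phi> \<Longrightarrow> \<exists>T l. finite T \<and> l \<noteq> 0 \<and> invariant \<Gamma> \<phi> T l"
proof (induction \<phi> arbitrary: \<Gamma>)
  case (Eq t u)
  then obtain s where t: "wt_trm L \<Gamma> t s" "wt_trm L \<Gamma> u s" by auto
  show ?case
  proof (cases s)
    case (SA s')
    then have "invariant \<Gamma> (Eq t u) {} 1"
      using term_A[OF t(1) SA shift_agA] term_A[OF t(2) SA shift_agA]
      unfolding invariant_def by (metis sat.simps(1))
    then show ?thesis by (metis finite.emptyI zero_neq_one)
  next
    case (SC s')
    have "val M Y w = val M (shift Y (\<lambda>i. scB 1 (g i))) w"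
      if "wt_trm L \<Gamma> w s" "Y \<in> tuples M \<Gamma>" "\<forall>i. v (g i) = 0" for Y g w
      using that by (intro term_C[OF that(1) SC]) (auto intro: shift_in shift_agC)
    then have "invariant \<Gamma> (Eq t u) {} 1"
      using t unfolding invariant_def by (metis sat.simps(1))
    then show ?thesis by (metis finite.emptyI zero_neq_one)
  next
    case SB
    obtain r where r: 
      "\<And>X Y. X \<in> tuples M \<Gamma> \<Longrightarrow> Y \<in> tuples M \<Gamma> \<Longrightarrow> agA \<Gamma> X Y \<Longrightarrow>
         bval (val M Y t) - bval (val M Y u) =
         bval (val M X t) - bval (val M X u) + lin scB \<Gamma> r (bv Y) - lin scB \<Gamma> r (bv X)"
      "\<And>X. X \<in> tuples M \<Gamma> \<Longrightarrow> v (bval (val M X t) - bval (val M X u)) = lin scC \<Gamma> r (\<lambda>i. v (bv X i))"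
      "\<And>X. X \<in> tuples M \<Gamma> \<Longrightarrow> sat M X (Eq t u) \<longleftrightarrow> bval (val M X t) - bval (val M X u) = 0"
      by (rule eq_SB[OF Eq]) (use t SB in auto)
    have "invariant \<Gamma> (Eq t u) {r} 1"
      unfolding invariant_def
    proof (intro ballI allI impI)
      fix Y g assume Y: "Y \<in> tuples M \<Gamma>" and g: "(\<forall>i. v (g i) = 0) \<and> kill {r} \<Gamma> (\<lambda>i. v (bv Y i)) g"
      let ?Y = "shift Y (\<lambda>i. scB 1 (g i))" and ?d = "\<lambda>X. bval (val M X t) - bval (val M X u)"
      have Y': "?Y \<in> tuples M \<Gamma>" using shift_in Y by blast
      have l: "lin scB \<Gamma> r (bv ?Y) = lin scB \<Gamma> r (bv Y) + lin scB \<Gamma> r g"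
        unfolding B.lin_add[symmetric] by (rule lin_cong) (simp add: shift_bv[OF Y])
      have d: "?d ?Y = ?d Y + lin scB \<Gamma> r g"
        using r(1)[OF Y Y' shift_agA[OF Y]] l by (simp add: algebra_simps)
      have "?d ?Y = 0 \<longleftrightarrow> ?d Y = 0"
      proof (cases "lin scC \<Gamma> r (\<lambda>i. v (bv Y i)) = 0")
        case True then show ?thesis using d g by (simp add: kill_def)
      next
        case False
        moreover have "v (?d ?Y) = v (?d Y)" using g by (simp only: d v.add v_lin) (simp add: C.lin_zero)
        ultimately show ?thesis using r(2)[OF Y] v.zero by metis
      qed
      then show "sat M ?Y (Eq t u) = sat M Y (Eq t u)" using r(3) Y Y' by blast
    qed
    then show ?thesis by (metis finite.emptyI finite.insertI zero_neq_one)
  qed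
next
  case (Rel P ts)
  have "map (val M Y) ts = map (val M (shift Y (\<lambda>i. scB 1 (g i)))) ts"
    if "Y \<in> tuples M \<Gamma>" "\<forall>i. v (g i) = 0" for Y g
    using rel_cases[OF Rel]
  proof
    assume "\<forall>t\<in>set ts. \<exists>s. wt_trm L \<Gamma> t (SA s)"
    then show ?thesis using term_A[OF _ refl shift_agA[OF that(1)]] by (metis (no_types, lifting) map_cong)
  next
    assume "\<forall>t\<in>set ts. \<exists>s. wt_trm L \<Gamma> t (SC s)"
    moreover have "agC \<Gamma> Y (shift Y (\<lambda>i. scB 1 (g i)))" using that by (intro shift_agC) auto
    ultimately show ?thesis
      using term_C[OF _ refl that(1) shift_in[OF that(1)]] by (metis (no_types, lifting) map_cong)
  qed
  then have "invariant \<Gamma> (Rel P ts) {} 1"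
    unfolding invariant_def by (metis sat.simps(2))
  then show ?case by (metis finite.emptyI zero_neq_one)
next
  case (Neg \<phi>)
  then show ?case by (auto simp: invariant_def)
next
  case (Conj \<phi> \<psi>)
  then obtain T1 l1 T2 l2 where
    1: "finite T1" "l1 \<noteq> 0" "invariant \<Gamma> \<phi> T1 l1" and 2: "finite T2" "l2 \<noteq> 0" "invariant \<Gamma> \<psi> T2 l2"
    by (metis wf_fm.simps(4))
  have "invariant \<Gamma> \<phi> (T1 \<union> T2) (l1 * l2)" "invariant \<Gamma> \<psi> (T1 \<union> T2) (l2 * l1)"
    using invariant_mono 1(3) 2(3) by (meson Un_upper1 Un_upper2)+
  then have "invariant \<Gamma> (Conj \<phi> \<psi>) (T1 \<union> T2) (l1 * l2)"
    unfolding invariant_def by (simp add: mult.commute)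
  then show ?case using 1 2 by (metis finite_Un mult_eq_0_iff)
next
  case (Ex s \<phi>)
  then show ?case using invariant_Ex by (metis wf_fm.simps(5))
qed

end

section \<open>Orthogonality of the quotient and the fibres\<close>

context exact_sequence
begin

definition A_tuples :: "('x, 'y) seq_sort list \<Rightarrow> ('a, 'u, 'b, 'c, 'w) seq_elem list set" where
  "A_tuples \<Gamma> = {X \<in> tuples M \<Gamma>. \<forall>x\<in>set X. v (bval x) = 0}"

text \<open>The section of \<phi> at \<open>Y\<close>, as seen by the
  \<open>\<A>\<close>-coordinates. That a definable set is a finite union of rectangles is expressed
  by the finiteness of the set of its sections.\<close>

definition A_part :: "('x, 'y) seq_sort list \<Rightarrow> (('x, 'y) seq_sort, ('r, 'f, 'g) seq_fun, ('p, 'q) seq_rel) fm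
    \<Rightarrow> ('a, 'u, 'b, 'c, 'w) seq_elem list \<Rightarrow> ('a, 'u, 'b, 'c, 'w) seq_elem list set" where
  "A_part \<Gamma> \<phi> Y = {X \<in> A_tuples \<Gamma>. sat M (comb X Y) \<phi>}"

text \<open>The tuples congruent to \<beta> modulo l whose quotients are annihilated by the
  relations of T that hold for \<open>Y\<close>. On such a set a relation that holds for the image
  of \<open>Y\<close> in \<open>\<C>\<close> takes the same value at \<open>Y\<close> as at
  \<beta>.\<close>

definition lattice_nbhd :: "('x, 'y) seq_sort list \<Rightarrow> (nat \<Rightarrow> 'r) set \<Rightarrow> 'r \<Rightarrow> (nat \<Rightarrow> 'b) \<Rightarrow>
    ('a, 'u, 'b, 'c, 'w) seq_elem list set" where
  "lattice_nbhd \<Gamma> T l \<beta> = {Y \<in> tuples M \<Gamma>. \<exists>b.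
     (\<forall>i<length \<Gamma>. \<Gamma> ! i = SB \<longrightarrow> bv Y i = \<beta> i + scB l (b i)) \<and> kill T \<Gamma> (\<lambda>i. v (bv Y i)) b}"

definition fin_split :: "('x, 'y) seq_sort list \<Rightarrow> (('x, 'y) seq_sort, ('r, 'f, 'g) seq_fun, ('p, 'q) seq_rel) fm
    \<Rightarrow> (nat \<Rightarrow> 'r) set \<Rightarrow> 'r \<Rightarrow> bool" where
  "fin_split \<Gamma> \<phi> T l \<longleftrightarrow> (\<forall>\<beta>. finite (A_part \<Gamma> \<phi> ` lattice_nbhd \<Gamma> T l \<beta>))"

lemma cmb_in: "x \<in> univ M s \<Longrightarrow> y \<in> univ M s \<Longrightarrow> cmb x y \<in> univ M s"
  by (cases s) (auto simp: univ_SA univ_SB univ_SC)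

lemma comb_in: "X \<in> tuples M \<Gamma> \<Longrightarrow> Y \<in> tuples M \<Gamma> \<Longrightarrow> comb X Y \<in> tuples M \<Gamma>"
  by (auto simp: tuples_iff list_all2_conv_all_nth cmb_in)

lemma A_tuples_in: "X \<in> A_tuples \<Gamma> \<Longrightarrow> X \<in> tuples M \<Gamma>"
  by (simp add: A_tuples_def)

lemma A_tuples_v: "X \<in> A_tuples \<Gamma> \<Longrightarrow> i < length \<Gamma> \<Longrightarrow> v (bv X i) = 0"
  by (auto simp: A_tuples_def tuples_length)

lemma comb_agA: "X \<in> tuples M \<Gamma> \<Longrightarrow> Y \<in> tuples M \<Gamma> \<Longrightarrow> agA \<Gamma> X (comb X Y)"
  using tuples_nth[of X M \<Gamma>] by (fastforce simp: agA_def univ_SA tuples_length)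

lemma comb_bv:
  assumes "X \<in> tuples M \<Gamma>" "Y \<in> tuples M \<Gamma>" "i < length \<Gamma>" "\<Gamma> ! i = SB"
  shows "bv (comb X Y) i = bv X i + bv Y i"
  using tuples_nth[OF assms(1,3)] assms by (auto simp: tuples_length univ_SB)

lemma comb_agC:
  assumes X: "X \<in> A_tuples \<Gamma>" and Y: "Y \<in> tuples M \<Gamma>" shows "agC \<Gamma> Y (comb X Y)"
  unfolding agC_def
proof (intro allI impI conjI)
  fix i s assume i: "i < length \<Gamma>" "\<Gamma> ! i = SC s"
  then obtain c where "X ! i = EC c" using tuples_nth[OF A_tuples_in[OF X] i(1)] by (auto simp: univ_SC)
  then show "Y ! i = comb X Y ! i" using i tuples_length[OF A_tuples_in[OF X]] tuples_length[OF Y] by simp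
next
  fix i assume i: "i < length \<Gamma>" "\<Gamma> ! i = SB"
  show "v (bv Y i) = v (bv (comb X Y) i)"
    using comb_bv[OF A_tuples_in[OF X] Y i] A_tuples_v[OF X i(1)] by (simp add: v.add)
qed

lemma lattice_nbhd_in: "Y \<in> lattice_nbhd \<Gamma> T l \<beta> \<Longrightarrow> Y \<in> tuples M \<Gamma>"
  by (simp add: lattice_nbhd_def)

lemma lattice_nbhd_mono:
  assumes "T \<subseteq> T'" shows "lattice_nbhd \<Gamma> T' (l * l') \<beta> \<subseteq> lattice_nbhd \<Gamma> T l \<beta>"
proof
  fix Y assume "Y \<in> lattice_nbhd \<Gamma> T' (l * l') \<beta>"
  then obtain b where b: "Y \<in> tuples M \<Gamma>"
    "\<forall>i<length \<Gamma>. \<Gamma> ! i = SB \<longrightarrow> bv Y i = \<beta> i + scB l (scB l' (b i))"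
    "kill T' \<Gamma> (\<lambda>i. v (bv Y i)) b"
    by (auto simp: lattice_nbhd_def)
  have "kill T \<Gamma> (\<lambda>i. v (bv Y i)) (\<lambda>i. scB l' (b i))"
    using kill_scale[OF kill_mono[OF b(3) assms]] .
  then show "Y \<in> lattice_nbhd \<Gamma> T l \<beta>"
    unfolding lattice_nbhd_def using b by (intro CollectI conjI exI[of _ "\<lambda>i. scB l' (b i)"])
qed

lemma fin_split_mono: "fin_split \<Gamma> \<phi> T l \<Longrightarrow> T \<subseteq> T' \<Longrightarrow> fin_split \<Gamma> \<phi> T' (l * l')"
  unfolding fin_split_def by (meson finite_subset image_mono lattice_nbhd_mono)

lemma finite_image_two:
  "(\<And>y. y \<in> S \<Longrightarrow> f y = a \<or> f y = b) \<Longrightarrow> finite (f ` S)"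
  by (rule finite_subset[of _ "{a, b}"]) auto

lemma fin_split_two:
  assumes "\<And>Y. Y \<in> tuples M \<Gamma> \<Longrightarrow> A_part \<Gamma> \<phi> Y = S \<or> A_part \<Gamma> \<phi> Y = S'"
  shows "fin_split \<Gamma> \<phi> {} 1"
  unfolding fin_split_def
  by (intro allI finite_image_two[of _ _ S S']) (rule assms[OF lattice_nbhd_in])

text \<open>If each witness splits into a part \<open>x\<close> on the \<open>\<A>\<close> side and
  a part \<open>y\<close> that extends \<open>Y\<close> inside one of finitely many neighbourhoods,
  the section of \<open>Ex s \<phi>\<close> is the projection of a union of sections of \<phi>,
  taken from a fixed finite collection.\<close>

lemma fin_split_Ex:
  assumes split: "fin_split (s # \<Gamma>) \<phi> T l" and fin: "finite B0"
    and cover: "\<And>Y z. Y \<in> lattice_nbhd \<Gamma> T' l' \<beta> \<Longrightarrow> z \<in> univ M s \<Longrightarrow>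
      \<exists>x\<in>univ M s. \<exists>y\<in>univ M s. v (bval x) = 0 \<and> z = cmb x y \<and> (\<exists>\<beta>'\<in>B0. y # Y \<in> lattice_nbhd (s # \<Gamma>) T l \<beta>')"
  shows "finite (A_part \<Gamma> (Ex s \<phi>) ` lattice_nbhd \<Gamma> T' l' \<beta>)"
proof -
  let ?F = "\<Union>\<beta>'\<in>B0. A_part (s # \<Gamma>) \<phi> ` lattice_nbhd (s # \<Gamma>) T l \<beta>'"
  let ?G = "\<lambda>Y. {A_part (s # \<Gamma>) \<phi> (y # Y) | y. y \<in> univ M s \<and> (\<exists>\<beta>'\<in>B0. y # Y \<in> lattice_nbhd (s # \<Gamma>) T l \<beta>')}"
  let ?h = "\<lambda>G. {X \<in> A_tuples \<Gamma>. \<exists>x. x # X \<in> \<Union> G}"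
  have "A_part \<Gamma> (Ex s \<phi>) Y = ?h (?G Y)" if Y: "Y \<in> lattice_nbhd \<Gamma> T' l' \<beta>" for Y
  proof (intro set_eqI iffI)
    fix X assume "X \<in> A_part \<Gamma> (Ex s \<phi>) Y"
    then obtain z where X: "X \<in> A_tuples \<Gamma>" and z: "z \<in> univ M s" "sat M (z # comb X Y) \<phi>"
      by (auto simp: A_part_def)
    obtain x y where xy: "x \<in> univ M s" "y \<in> univ M s" "v (bval x) = 0" "z = cmb x y"
      "\<exists>\<beta>'\<in>B0. y # Y \<in> lattice_nbhd (s # \<Gamma>) T l \<beta>'"
      using cover[OF Y z(1)] by blast
    have "x # X \<in> A_part (s # \<Gamma>) \<phi> (y # Y)"
      using X xy z(2) by (simp add: A_part_def A_tuples_def)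
    then show "X \<in> ?h (?G Y)" using X xy by blast
  next
    fix X assume "X \<in> ?h (?G Y)"
    then obtain x y where xy: "X \<in> A_tuples \<Gamma>" "y \<in> univ M s" "x # X \<in> A_part (s # \<Gamma>) \<phi> (y # Y)"
      by blast
    then have "cmb x y \<in> univ M s" by (auto simp: A_part_def A_tuples_def intro: cmb_in)
    then show "X \<in> A_part \<Gamma> (Ex s \<phi>) Y" using xy by (auto simp: A_part_def)
  qed
  moreover have "?h (?G Y) \<in> ?h ` Pow ?F" for Y by (rule imageI) blast
  ultimately have "A_part \<Gamma> (Ex s \<phi>) ` lattice_nbhd \<Gamma> T' l' \<beta> \<subseteq> ?h ` Pow ?F"
    by (intro image_subsetI) simp
  moreover have "finite ?F" using split fin by (auto simp: fin_split_def)
  ultimately show ?thesis by (meson finite_Pow_iff finite_imageI finite_subset)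
qed

lemma finite_lifts:
  assumes "finite C0" obtains B0 where "finite B0" "v ` B0 = C0"
proof -
  have "C0 \<subseteq> range v" by (metis v_surj rangeI subsetI)
  then show ?thesis using that assms by (metis finite_subset_image)
qed

lemma quot_lifts:
  assumes "l \<noteq> 0"
  obtains B0 where "finite B0" "\<forall>z. \<exists>b\<in>B0. \<exists>y. v z = v b + scC l (v y)"
proof -
  obtain C0 where C0: "finite C0" "range (mult_coset scC l) = mult_coset scC l ` C0"
    using finite_quot[OF assms] by (metis finite_subset_image order_refl)
  obtain B0 where B0: "finite B0" "v ` B0 = C0" using finite_lifts[OF C0(1)] .
  have "\<exists>b\<in>B0. \<exists>y. v z = v b + scC l (v y)" for z
  proof -
    obtain c where c: "c \<in> C0" "mult_coset scC l (v z) = mult_coset scC l c" using C0(2) by blast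
    have "v z \<in> mult_coset scC l (v z)"
      unfolding mult_coset_def by (intro CollectI exI[of _ 0]) simp
    then obtain d where "v z = c + scC l d" unfolding c(2) by (auto simp: mult_coset_def)
    then show ?thesis using v_surj c(1) B0(2) by (metis imageE)
  qed
  then show ?thesis using that B0(1) by blast
qed

text \<open>The centre for the bound variable must come from a finite set independent of
  \<open>Y\<close>. A pivot relation forces its image in \<open>\<C>\<close>, with one root per
  relation by torsion-freeness; without a pivot, representatives of \<open>\<C>/l\<C>\<close>
  suffice. What then remains of the witness has image 0 under \<open>v\<close> and goes to the
  \<open>\<A>\<close> side.\<close>

lemma fin_split_SB:
  assumes split: "fin_split (SB # \<Gamma>) \<phi> T l" and T: "finite T" and l: "l \<noteq> 0"
  shows "fin_split \<Gamma> (Ex SB \<phi>) (elim_T T) (l * elim_m T)"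
  unfolding fin_split_def
proof
  fix \<beta>
  let ?m = "elim_m T" and ?h = "\<lambda>t i. t (Suc i)"
  let ?root = "\<lambda>t c. scC (t 0) c + lin scC \<Gamma> (?h t) (\<lambda>i. v (\<beta> i)) = 0"
  \<comment> \<open>One root for each relation. If a relation has none, or its leading coefficient
    is 0, the chosen value is just an additional centre.\<close>
  define C1 where "C1 = (\<lambda>t. SOME c. ?root t c) ` T"
  have "finite C1" using T by (simp add: C1_def)
  from finite_lifts[OF this] obtain B1 where B1: "finite B1" "v ` B1 = C1" .
  from quot_lifts[OF l]
  obtain B2 where B2: "finite B2" "\<forall>z. \<exists>b\<in>B2. \<exists>y. v z = v b + scC l (v y)" .
  have root: "\<exists>b\<in>B1. v b = c" if "t \<in> T" "t 0 \<noteq> 0" "?root t c" for t c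
  proof -
    have "?root t (SOME c. ?root t c)" using that(3) by (rule someI)
    then have "scC (t 0) (SOME c. ?root t c) = scC (t 0) c" using that(3) by (metis add_right_cancel)
    then have "(SOME c. ?root t c) = c" using scC_cancel[OF that(2)] by blast
    then have "c \<in> v ` B1" unfolding B1(2) C1_def by (intro image_eqI[OF _ that(1)]) simp
    then show ?thesis by auto
  qed
  show "finite (A_part \<Gamma> (Ex SB \<phi>) ` lattice_nbhd \<Gamma> (elim_T T) (l * ?m) \<beta>)"
  proof (rule fin_split_Ex[OF split, of "(\<lambda>b. case_nat b \<beta>) ` (B1 \<union> B2)"])
    show "finite ((\<lambda>b. case_nat b \<beta>) ` (B1 \<union> B2))" using B1 B2 by blast
  next
    fix Y z assume Y: "Y \<in> lattice_nbhd \<Gamma> (elim_T T) (l * ?m) \<beta>" and "z \<in> univ M SB"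
    then obtain z0 where z: "z = EB z0" by (auto simp: univ_SB)
    obtain b where b: "Y \<in> tuples M \<Gamma>"
      "\<forall>i<length \<Gamma>. \<Gamma> ! i = SB \<longrightarrow> bv Y i = \<beta> i + scB l (scB ?m (b i))"
      "kill (elim_T T) \<Gamma> (\<lambda>i. v (bv Y i)) b"
      using Y by (auto simp: lattice_nbhd_def)
    let ?c = "case_nat (v z0) (\<lambda>i. v (bv Y i))"
    have k: "kill (elim_T T) \<Gamma> (\<lambda>i. ?c (Suc i)) b" using b(3) by simp
    have "\<exists>b0 \<beta>0. \<beta>0 \<in> B1 \<union> B2 \<and> kill T (SB # \<Gamma>) ?c (case_nat b0 (\<lambda>i. scB ?m (b i))) \<and>
        v z0 = v (\<beta>0 + scB l b0)"
    proof (cases "\<exists>t\<in>T. t 0 \<noteq> 0 \<and> lin scC (SB # \<Gamma>) t ?c = 0")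
      case True
      then obtain t where t: "t \<in> T" "t 0 \<noteq> 0" "lin scC (SB # \<Gamma>) t ?c = 0" by blast
      from elim_pivot[OF T this k] obtain m' where m': "kill T (SB # \<Gamma>) ?c
        (case_nat (- scB m' (lin scB \<Gamma> (?h t) b)) (\<lambda>i. scB ?m (b i)))" .
      let ?b0 = "- scB m' (lin scB \<Gamma> (?h t) b)"
      have "lin scC \<Gamma> (?h t) (\<lambda>i. v (bv Y i)) =
          lin scC \<Gamma> (?h t) (\<lambda>i. v (\<beta> i) + scC l (v (scB ?m (b i))))"
        using b(2) by (intro lin_cong) (simp add: v.add v.scale)
      also have "\<dots> = lin scC \<Gamma> (?h t) (\<lambda>i. v (\<beta> i)) + scC l (lin scC \<Gamma> (?h t) (\<lambda>i. v (scB ?m (b i))))"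
        by (simp only: C.lin_add C.lin_scale)
      finally have e1: "scC (t 0) (v z0) + (lin scC \<Gamma> (?h t) (\<lambda>i. v (\<beta> i)) +
          scC l (lin scC \<Gamma> (?h t) (\<lambda>i. v (scB ?m (b i))))) = 0"
        using t(3) by simp
      have "lin scB (SB # \<Gamma>) t (case_nat ?b0 (\<lambda>i. scB ?m (b i))) = 0"
        using m' t(1,3) unfolding kill_def by blast
      then have "v (scB (t 0) ?b0 + lin scB \<Gamma> (?h t) (\<lambda>i. scB ?m (b i))) = 0" by (simp add: v.zero)
      then have e2: "scC (t 0) (v ?b0) + lin scC \<Gamma> (?h t) (\<lambda>i. v (scB ?m (b i))) = 0"
        by (simp only: v.add v.scale v_lin)
      have "?root t (v z0 - scC l (v ?b0))"
      proof -
        have "scC l (scC (t 0) (v ?b0) + lin scC \<Gamma> (?h t) (\<lambda>i. v (scB ?m (b i)))) = 0"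
          unfolding e2 by simp
        then have "scC l (lin scC \<Gamma> (?h t) (\<lambda>i. v (scB ?m (b i)))) = - scC (t 0) (scC l (v ?b0))"
          by (simp add: C.scale_right_distrib eq_neg_iff_add_eq_0 add.commute mult.commute del: v.neg)
        then show ?thesis using e1 unfolding C.scale_right_diff_distrib by (simp add: algebra_simps del: v.neg)
      qed
      from root[OF t(1,2) this] obtain \<beta>0 where "\<beta>0 \<in> B1" "v \<beta>0 = v z0 - scC l (v ?b0)" by blast
      then have "\<beta>0 \<in> B1 \<union> B2 \<and> v z0 = v (\<beta>0 + scB l ?b0)" unfolding v.add v.scale by simp
      then show ?thesis using m' by blast
    next
      case False
      obtain \<beta>0 y where y: "\<beta>0 \<in> B2" "v z0 = v \<beta>0 + scC l (v y)" using B2(2) by blast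
      have "kill T (SB # \<Gamma>) ?c (case_nat y (\<lambda>i. scB ?m (b i)))"
        by (rule elim_no_pivot[OF _ k]) (use False in blast)
      moreover have "\<beta>0 \<in> B1 \<union> B2 \<and> v z0 = v (\<beta>0 + scB l y)" using y by (simp add: v.add v.scale)
      ultimately show ?thesis by blast
    qed
    then obtain b0 \<beta>0 where \<beta>0: "\<beta>0 \<in> B1 \<union> B2"
      and kb0: "kill T (SB # \<Gamma>) ?c (case_nat b0 (\<lambda>i. scB ?m (b i)))" and vz: "v z0 = v (\<beta>0 + scB l b0)"
      by blast
    let ?y = "EB (\<beta>0 + scB l b0) :: ('a, 'u, 'b, 'c, 'w) seq_elem"
    have "(\<lambda>i. v (bv (?y # Y) i)) = ?c" using vz by (auto simp: fun_eq_iff nth_Cons split: nat.split)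
    then have "?y # Y \<in> lattice_nbhd (SB # \<Gamma>) T l (case_nat \<beta>0 \<beta>)"
      using b kb0 unfolding lattice_nbhd_def
      by (intro CollectI conjI exI[of _ "case_nat b0 (\<lambda>i. scB ?m (b i))"])
        (auto simp: univ_SB nth_Cons split: nat.split)
    moreover have "v (bval (EB (z0 - (\<beta>0 + scB l b0)))) = 0" using vz by (simp add: v.diff)
    moreover have "z = cmb (EB (z0 - (\<beta>0 + scB l b0))) ?y" by (simp add: z)
    ultimately show "\<exists>x\<in>univ M SB. \<exists>y\<in>univ M SB. v (bval x) = 0 \<and> z = cmb x y \<and>
        (\<exists>\<beta>'\<in>(\<lambda>b. case_nat b \<beta>) ` (B1 \<union> B2). y # Y \<in> lattice_nbhd (SB # \<Gamma>) T l \<beta>')"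
      using \<beta>0 unfolding univ_SB by blast
  qed
qed

text \<open>Outside \<open>\<B>\<close> a witness serves as its own part on both sides, since
  \<open>cmb z z = z\<close>, and a single centre is enough.\<close>

lemma fin_split_side:
  assumes split: "fin_split (s # \<Gamma>) \<phi> T l" and s: "s \<noteq> SB"
  shows "fin_split \<Gamma> (Ex s \<phi>) ((\<lambda>t i. t (Suc i)) ` T) l"
  unfolding fin_split_def
proof
  fix \<beta>
  show "finite (A_part \<Gamma> (Ex s \<phi>) ` lattice_nbhd \<Gamma> ((\<lambda>t i. t (Suc i)) ` T) l \<beta>)"
  proof (rule fin_split_Ex[OF split, of "{case_nat 0 \<beta>}"])
    fix Y z assume Y: "Y \<in> lattice_nbhd \<Gamma> ((\<lambda>t i. t (Suc i)) ` T) l \<beta>" and z: "z \<in> univ M s"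
    obtain b where b: "Y \<in> tuples M \<Gamma>"
      "\<forall>i<length \<Gamma>. \<Gamma> ! i = SB \<longrightarrow> bv Y i = \<beta> i + scB l (b i)"
      "kill ((\<lambda>t i. t (Suc i)) ` T) \<Gamma> (\<lambda>i. v (bv Y i)) b"
      using Y by (auto simp: lattice_nbhd_def)
    have "kill T (s # \<Gamma>) (\<lambda>i. v (bv (z # Y) i)) (case_nat 0 b)"
      using b(3) by (intro kill_tail[OF s]) simp
    then have "z # Y \<in> lattice_nbhd (s # \<Gamma>) T l (case_nat 0 \<beta>)"
      using b z s unfolding lattice_nbhd_def
      by (intro CollectI conjI exI[of _ "case_nat 0 b"]) (auto simp: nth_Cons split: nat.split)
    moreover have "v (bval z) = 0" "z = cmb z z"
      using z s by (cases s; auto simp: univ_SA univ_SC v.zero)+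
    ultimately show "\<exists>x\<in>univ M s. \<exists>y\<in>univ M s. v (bval x) = 0 \<and> z = cmb x y \<and>
        (\<exists>\<beta>'\<in>{case_nat 0 \<beta>}. y # Y \<in> lattice_nbhd (s # \<Gamma>) T l \<beta>')"
      using z by blast
  qed simp
qed

lemma fin_split_exists:
  "wf_fm L \<Gamma> \<phi> \<Longrightarrow> \<exists>T l. finite T \<and> l \<noteq> 0 \<and> fin_split \<Gamma> \<phi> T l"
proof (induction \<phi> arbitrary: \<Gamma>)
  case (Eq t u)
  then obtain s where t: "wt_trm L \<Gamma> t s" "wt_trm L \<Gamma> u s" by auto
  show ?case
  proof (cases s)
    case (SA s')
    have "sat M (comb X Y) (Eq t u) = sat M X (Eq t u)" if "X \<in> A_tuples \<Gamma>" "Y \<in> tuples M \<Gamma>" for X Y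
      using term_A[OF t(1) SA comb_agA[OF A_tuples_in[OF that(1)] that(2)]]
        term_A[OF t(2) SA comb_agA[OF A_tuples_in[OF that(1)] that(2)]] by simp
    then have "A_part \<Gamma> (Eq t u) Y = {X \<in> A_tuples \<Gamma>. sat M X (Eq t u)}" if "Y \<in> tuples M \<Gamma>" for Y
      using that unfolding A_part_def by blast
    then have "fin_split \<Gamma> (Eq t u) {} 1" by (intro fin_split_two disjI1)
    then show ?thesis by (metis finite.emptyI zero_neq_one)
  next
    case (SC s')
    have "sat M (comb X Y) (Eq t u) = sat M Y (Eq t u)" if "X \<in> A_tuples \<Gamma>" "Y \<in> tuples M \<Gamma>" for X Y
      using term_C[OF t(1) SC that(2) comb_in[OF A_tuples_in[OF that(1)] that(2)] comb_agC[OF that]]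
        term_C[OF t(2) SC that(2) comb_in[OF A_tuples_in[OF that(1)] that(2)] comb_agC[OF that]] by simp
    then have "A_part \<Gamma> (Eq t u) Y = {X \<in> A_tuples \<Gamma>. sat M Y (Eq t u)}" if "Y \<in> tuples M \<Gamma>" for Y
      using that unfolding A_part_def by blast
    then have "fin_split \<Gamma> (Eq t u) {} 1" by (intro fin_split_two[of _ _ "A_tuples \<Gamma>" "{}"]) auto
    then show ?thesis by (metis finite.emptyI zero_neq_one)
  next
    case SB
    let ?d = "\<lambda>X. bval (val M X t) - bval (val M X u)"
    obtain r where r: 
      "\<And>X Y. X \<in> tuples M \<Gamma> \<Longrightarrow> Y \<in> tuples M \<Gamma> \<Longrightarrow> agA \<Gamma> X Y \<Longrightarrow>
         ?d Y = ?d X + lin scB \<Gamma> r (bv Y) - lin scB \<Gamma> r (bv X)"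
      "\<And>X. X \<in> tuples M \<Gamma> \<Longrightarrow> v (?d X) = lin scC \<Gamma> r (\<lambda>i. v (bv X i))"
      "\<And>X. X \<in> tuples M \<Gamma> \<Longrightarrow> sat M X (Eq t u) \<longleftrightarrow> ?d X = 0"
      by (rule eq_SB[OF Eq]) (use t SB in auto)
    have "finite (A_part \<Gamma> (Eq t u) ` lattice_nbhd \<Gamma> {r} 1 \<beta>)" for \<beta>
    proof (rule finite_image_two)
      fix Y assume "Y \<in> lattice_nbhd \<Gamma> {r} 1 \<beta>"
      then obtain b where Y: "Y \<in> tuples M \<Gamma>"
        "\<forall>i<length \<Gamma>. \<Gamma> ! i = SB \<longrightarrow> bv Y i = \<beta> i + b i" "kill {r} \<Gamma> (\<lambda>i. v (bv Y i)) b"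
        by (auto simp: lattice_nbhd_def)
      have "lin scB \<Gamma> r (bv Y) = lin scB \<Gamma> r \<beta> + lin scB \<Gamma> r b"
        unfolding B.lin_add[symmetric] using Y(2) by (intro lin_cong) simp
      moreover have d: "?d (comb X Y) = ?d X + lin scB \<Gamma> r (bv Y)" if X: "X \<in> A_tuples \<Gamma>" for X
      proof -
        have "lin scB \<Gamma> r (bv (comb X Y)) = lin scB \<Gamma> r (bv X) + lin scB \<Gamma> r (bv Y)"
          unfolding B.lin_add[symmetric]
          using comb_bv[OF A_tuples_in[OF X] Y(1)] by (intro lin_cong) simp
        then show ?thesis
          using r(1)[OF A_tuples_in[OF X] comb_in[OF A_tuples_in[OF X] Y(1)] comb_agA[OF A_tuples_in[OF X] Y(1)]]
          by (simp add: algebra_simps)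
      qed
      moreover have "lin scC \<Gamma> r (\<lambda>i. v (bv Y i)) = 0" if X: "X \<in> A_tuples \<Gamma>" "?d (comb X Y) = 0" for X
      proof -
        have "lin scC \<Gamma> r (\<lambda>i. v (bv X i)) = lin scC \<Gamma> r (\<lambda>i. 0)"
          by (rule lin_cong) (simp add: A_tuples_v[OF X(1)])
        then have "v (?d X) = 0" using r(2)[OF A_tuples_in[OF X(1)]] by (simp add: C.lin_zero)
        moreover have "v (?d X + lin scB \<Gamma> r (bv Y)) = 0" using d[OF X(1)] X(2) v.zero by metis
        ultimately show ?thesis by (simp only: v.add v_lin) simp
      qed
      \<comment> \<open>If the relation fails for the image of \<open>Y\<close> in
        \<open>\<C>\<close>, no \<open>X\<close> satisfies the equation. Otherwise r\<cdot>b = 0,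
        and \<open>Y\<close> enters the equation only through r\<cdot>\<beta>.\<close>
      ultimately show "A_part \<Gamma> (Eq t u) Y = {} \<or>
          A_part \<Gamma> (Eq t u) Y = {X \<in> A_tuples \<Gamma>. ?d X + lin scB \<Gamma> r \<beta> = 0}"
        using r(3)[OF comb_in[OF A_tuples_in Y(1)]] Y(3) unfolding A_part_def kill_def
        by (cases "lin scC \<Gamma> r (\<lambda>i. v (bv Y i)) = 0") auto
    qed
    then show ?thesis unfolding fin_split_def by (metis finite.emptyI finite.insertI zero_neq_one)
  qed
next
  case (Rel P ts)
  have "A_part \<Gamma> (Rel P ts) Y = A_tuples \<Gamma> \<or> A_part \<Gamma> (Rel P ts) Y = {} \<or>
      A_part \<Gamma> (Rel P ts) Y = {X \<in> A_tuples \<Gamma>. sat M X (Rel P ts)}" if Y: "Y \<in> tuples M \<Gamma>" for Y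
    using rel_cases[OF Rel]
  proof
    assume a: "\<forall>t\<in>set ts. \<exists>s. wt_trm L \<Gamma> t (SA s)"
    have "map (val M X) ts = map (val M (comb X Y)) ts" if "X \<in> A_tuples \<Gamma>" for X
      using a term_A[OF _ refl comb_agA[OF A_tuples_in[OF that] Y]] by (metis (no_types, lifting) map_cong)
    then have "A_part \<Gamma> (Rel P ts) Y = {X \<in> A_tuples \<Gamma>. sat M X (Rel P ts)}"
      by (auto simp: A_part_def simp del: map_eq_conv)
    then show ?thesis by blast
  next
    assume a: "\<forall>t\<in>set ts. \<exists>s. wt_trm L \<Gamma> t (SC s)"
    have "map (val M Y) ts = map (val M (comb X Y)) ts" if "X \<in> A_tuples \<Gamma>" for X
      using a term_C[OF _ refl Y comb_in[OF A_tuples_in[OF that] Y] comb_agC[OF that Y]]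
      by (metis (no_types, lifting) map_cong)
    then have "A_part \<Gamma> (Rel P ts) Y = {X \<in> A_tuples \<Gamma>. sat M Y (Rel P ts)}"
      by (auto simp: A_part_def simp del: map_eq_conv)
    then show ?thesis by auto
  qed
  then have "A_part \<Gamma> (Rel P ts) ` lattice_nbhd \<Gamma> {} 1 \<beta> \<subseteq>
      {A_tuples \<Gamma>, {}, {X \<in> A_tuples \<Gamma>. sat M X (Rel P ts)}}" for \<beta>
    using lattice_nbhd_in by blast
  then have "fin_split \<Gamma> (Rel P ts) {} 1"
    unfolding fin_split_def by (meson finite.emptyI finite.insertI finite_subset)
  then show ?case by (metis finite.emptyI zero_neq_one)
next
  case (Neg \<phi>)
  then obtain T l where T: "finite T" "l \<noteq> 0" "fin_split \<Gamma> \<phi> T l" by (metis wf_fm.simps(3))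
  have "A_part \<Gamma> (Neg \<phi>) = (\<lambda>Y. A_tuples \<Gamma> - A_part \<Gamma> \<phi> Y)" by (auto simp: A_part_def fun_eq_iff)
  then have "A_part \<Gamma> (Neg \<phi>) ` S = (\<lambda>Z. A_tuples \<Gamma> - Z) ` A_part \<Gamma> \<phi> ` S" for S
    by (simp add: image_image)
  then have "fin_split \<Gamma> (Neg \<phi>) T l" using T(3) by (simp add: fin_split_def)
  then show ?case using T by blast
next
  case (Conj \<phi> \<psi>)
  then obtain T1 l1 T2 l2 where
    1: "finite T1" "l1 \<noteq> 0" "fin_split \<Gamma> \<phi> T1 l1" and 2: "finite T2" "l2 \<noteq> 0" "fin_split \<Gamma> \<psi> T2 l2"
    by (metis wf_fm.simps(4))
  have *: "fin_split \<Gamma> \<phi> (T1 \<union> T2) (l1 * l2)" "fin_split \<Gamma> \<psi> (T1 \<union> T2) (l1 * l2)"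
    using fin_split_mono 1(3) 2(3) by (metis mult.commute Un_upper1 Un_upper2)+
  have "A_part \<Gamma> (Conj \<phi> \<psi>) ` S \<subseteq> (\<lambda>(Y, Z). Y \<inter> Z) ` (A_part \<Gamma> \<phi> ` S \<times> A_part \<Gamma> \<psi> ` S)" for S
  proof (rule image_subsetI)
    fix Y assume "Y \<in> S"
    then show "A_part \<Gamma> (Conj \<phi> \<psi>) Y \<in> (\<lambda>(Y, Z). Y \<inter> Z) ` (A_part \<Gamma> \<phi> ` S \<times> A_part \<Gamma> \<psi> ` S)"
      by (intro image_eqI[of _ _ "(A_part \<Gamma> \<phi> Y, A_part \<Gamma> \<psi> Y)"]) (auto simp: A_part_def)
  qed
  then have "fin_split \<Gamma> (Conj \<phi> \<psi>) (T1 \<union> T2) (l1 * l2)"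
    using * unfolding fin_split_def by (meson finite_SigmaI finite_imageI finite_subset)
  then show ?case using 1 2 by (metis finite_Un mult_eq_0_iff)
next
  case (Ex s \<phi>)
  then obtain T l where T: "finite T" "l \<noteq> 0" "fin_split (s # \<Gamma>) \<phi> T l"
    by (metis wf_fm.simps(5))
  show ?case
  proof (cases "s = SB")
    case True
    then have "fin_split \<Gamma> (Ex s \<phi>) (elim_T T) (l * elim_m T)"
      using fin_split_SB[OF _ T(1,2)] T(3) by simp
    moreover have "l * elim_m T \<noteq> 0" using T(2) elim_m_nonzero[OF T(1)] by simp
    ultimately show ?thesis using finite_elim_T[OF T(1)] by blast
  next
    case False
    then show ?thesis using fin_split_side[OF T(3)] T(1,2) by blast
  qed
qed

section \<open>Finiteness of sections over a single fibre\<close>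

definition fibre :: "('x, 'y) seq_sort list \<Rightarrow> ('a, 'u, 'b, 'c, 'w) seq_elem list \<Rightarrow>
    ('a, 'u, 'b, 'c, 'w) seq_elem list set" where
  "fibre \<Gamma> p0 = {p \<in> tuples M \<Gamma>. \<forall>i<length \<Gamma>. v (bv p i) = v (bv p0 i)}"

definition side_AB :: "('x, 'y) seq_sort list \<Rightarrow> bool" where
  "side_AB \<Gamma> \<longleftrightarrow> (\<forall>i<length \<Gamma>. \<forall>s. \<Gamma> ! i \<noteq> SC s)"

definition side_C :: "('x, 'y) seq_sort list \<Rightarrow> bool" where
  "side_C \<Gamma> \<longleftrightarrow> (\<forall>i<length \<Gamma>. \<exists>s. \<Gamma> ! i = SC s)"

lemma comb_side_C:
  assumes "side_C \<Gamma>" "X \<in> tuples M \<Gamma>" "Y \<in> tuples M \<Gamma>" shows "comb X Y = Y"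
proof (rule nth_equalityI)
  fix i assume "i < length (comb X Y)"
  then have i: "i < length \<Gamma>" using assms by (simp add: tuples_length)
  then obtain s where "\<Gamma> ! i = SC s" using assms(1) by (auto simp: side_C_def)
  then show "comb X Y ! i = Y ! i"
    using tuples_nth[OF assms(2) i] i assms(2,3) by (auto simp: univ_SC tuples_length)
qed (use assms in \<open>simp add: tuples_length\<close>)

text \<open>The position of \<open>x\<close> relative to \<open>y\<close>: the first argument from
  which \<open>cmb\<close> recovers \<open>x\<close> when \<open>y\<close> is the second.\<close>

definition rel_part :: "('a, 'u, 'b, 'c, 'w) seq_elem \<Rightarrow> ('a, 'u, 'b, 'c, 'w) seq_elem \<Rightarrow>
    ('a, 'u, 'b, 'c, 'w) seq_elem" where
  "rel_part x y = (case x of EB b \<Rightarrow> EB (b - bval y) | _ \<Rightarrow> x)"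

lemma rel_part_in: "x \<in> univ M s \<Longrightarrow> rel_part x y \<in> univ M s"
  by (cases s) (auto simp: rel_part_def univ_SA univ_SB univ_SC)

text \<open>\<open>comb\<close> takes the \<open>\<C>\<close> coordinates from its second argument,
  so \<open>p\<close> and \<open>p0\<close> must agree there; both alternatives of the last premise
  ensure this.\<close>

lemma fibre_rel:
  assumes p: "p \<in> fibre \<Gamma> p0" and p0: "p0 \<in> tuples M \<Gamma>" and "side_AB \<Gamma> \<or> p = p0"
  shows "map2 rel_part p p0 \<in> A_tuples \<Gamma>" "comb (map2 rel_part p p0) p0 = p"
proof -
  have pt: "p \<in> tuples M \<Gamma>" using p by (simp add: fibre_def)
  have "map2 rel_part p p0 \<in> tuples M \<Gamma>"
    using pt p0 by (auto simp: tuples_iff list_all2_conv_all_nth rel_part_in)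
  moreover have "v (bval (rel_part (p ! i) (p0 ! i))) = 0" if "i < length \<Gamma>" for i
    using p that by (cases "p ! i") (auto simp: fibre_def rel_part_def v.diff v.zero)
  ultimately show "map2 rel_part p p0 \<in> A_tuples \<Gamma>"
    using pt p0 by (auto simp: A_tuples_def in_set_conv_nth tuples_length)
  show "comb (map2 rel_part p p0) p0 = p"
  proof (rule nth_equalityI)
    fix i assume "i < length (comb (map2 rel_part p p0) p0)"
    then have i: "i < length \<Gamma>" using pt p0 by (simp add: tuples_length)
    then show "comb (map2 rel_part p p0) p0 ! i = p ! i"
      using tuples_nth[OF pt i] assms(3) pt p0
      by (cases "p ! i"; cases "\<Gamma> ! i")
        (auto simp: rel_part_def tuples_length univ_SA univ_SB univ_SC side_AB_def)
  qed (use pt p0 in \<open>simp add: tuples_length\<close>)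
qed

lemma fibre_in: "p \<in> fibre \<Gamma> p0 \<Longrightarrow> p \<in> tuples M \<Gamma>"
  by (simp add: fibre_def)

lemma fibre_self: "p \<in> tuples M \<Gamma> \<Longrightarrow> p \<in> fibre \<Gamma> p"
  by (simp add: fibre_def)

lemma A_tuples_append: "X \<in> A_tuples \<Gamma> \<Longrightarrow> X' \<in> A_tuples \<Gamma>' \<Longrightarrow> X @ X' \<in> A_tuples (\<Gamma> @ \<Gamma>')"
  by (auto simp: A_tuples_def tuples_appendI)

text \<open>Since \<open>q\<close> has no coordinate in \<open>\<B>\<close>, the tuples
  \<open>p0 @ q @ x\<close> for all \<open>q\<close> lie in one lattice neighbourhood, where
  \<open>fin_split\<close> leaves finitely many sections. A point of the fibre is recorded by its
  difference from \<open>p0\<close>, which lies in \<open>\<A>\<close>.\<close>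

lemma orthogonal:
  assumes P: "dfb L M [\<Gamma>p, \<Gamma>q, \<Gamma>x] P" and \<Gamma>: "side_AB \<Gamma>p" "side_C \<Gamma>q"
    and p0: "p0 \<in> tuples M \<Gamma>p" and x: "x \<in> tuples M \<Gamma>x"
  shows "finite ((\<lambda>q. {p \<in> fibre \<Gamma>p p0. P [p, q, x]}) ` tuples M \<Gamma>q)"
proof (cases "tuples M \<Gamma>q = {}")
  case False
  then obtain q1 where q1: "q1 \<in> tuples M \<Gamma>q" by blast
  obtain \<phi> where \<phi>: "wf_fm L (\<Gamma>p @ \<Gamma>q @ \<Gamma>x) \<phi>"
    "\<And>p q. p \<in> tuples M \<Gamma>p \<Longrightarrow> q \<in> tuples M \<Gamma>q \<Longrightarrow> sat M (p @ q @ x) \<phi> = P [p, q, x]"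
  proof -
    obtain \<phi> where \<phi>: "wf_fm L (concat [\<Gamma>p, \<Gamma>q, \<Gamma>x]) \<phi>"
      "\<forall>bs. env M [\<Gamma>p, \<Gamma>q, \<Gamma>x] bs \<longrightarrow> sat M (concat bs) \<phi> = P bs"
      using P unfolding dfb_def by blast
    have "sat M (p @ q @ x) \<phi> = P [p, q, x]" if "p \<in> tuples M \<Gamma>p" "q \<in> tuples M \<Gamma>q" for p q
      using \<phi>(2)[rule_format, of "[p, q, x]"] that x by simp
    then show ?thesis using that \<phi>(1) by simp
  qed
  let ?\<Gamma> = "\<Gamma>p @ \<Gamma>q @ \<Gamma>x"
  obtain T l where split: "fin_split ?\<Gamma> \<phi> T l" using fin_split_exists[OF \<phi>(1)] by blast
  \<comment> \<open>\<open>q1\<close> only fills the positions of \<open>q\<close>, at which the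
    centre is never consulted.\<close>
  let ?\<beta> = "bv (p0 @ q1 @ x)"
  have lat: "p0 @ q @ x \<in> lattice_nbhd ?\<Gamma> T l ?\<beta>" if q: "q \<in> tuples M \<Gamma>q" for q
  proof -
    have "bv (p0 @ q @ x) i = ?\<beta> i" if i: "i < length ?\<Gamma>" "?\<Gamma> ! i = SB" for i
    proof -
      have "\<not> (length \<Gamma>p \<le> i \<and> i < length \<Gamma>p + length \<Gamma>q)"
      proof
        assume a: "length \<Gamma>p \<le> i \<and> i < length \<Gamma>p + length \<Gamma>q"
        then have lt: "i - length \<Gamma>p < length \<Gamma>q" by auto
        then have "\<Gamma>q ! (i - length \<Gamma>p) = SB" using i(2) a by (simp add: nth_append)
        with lt show False using \<Gamma>(2) by (auto simp: side_C_def)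
      qed
      then show ?thesis
        using tuples_length[OF p0] tuples_length[OF q] tuples_length[OF q1] by (auto simp: nth_append)
    qed
    moreover have "p0 @ q @ x \<in> tuples M ?\<Gamma>" using p0 q x by (simp add: tuples_appendI)
    moreover have "kill T ?\<Gamma> c (\<lambda>i. 0)" for c by (simp add: kill_def B.lin_zero)
    ultimately show ?thesis unfolding lattice_nbhd_def by (intro CollectI conjI exI[of _ "\<lambda>i. 0"]) auto
  qed
  \<comment> \<open>The middle entries are placeholders of the right sorts; \<open>comb\<close>
    overwrites them by \<open>q\<close>.\<close>
  let ?X = "\<lambda>p. map2 rel_part p p0 @ map2 rel_part q1 q1 @ map2 rel_part x x"
  have "{p \<in> fibre \<Gamma>p p0. P [p, q, x]} = {p \<in> fibre \<Gamma>p p0. ?X p \<in> A_part ?\<Gamma> \<phi> (p0 @ q @ x)}"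
    if q: "q \<in> tuples M \<Gamma>q" for q
  proof -
    have "?X p \<in> A_part ?\<Gamma> \<phi> (p0 @ q @ x) \<longleftrightarrow> P [p, q, x]" if p: "p \<in> fibre \<Gamma>p p0" for p
    proof -
      have "?X p \<in> A_tuples ?\<Gamma>"
        using fibre_rel(1)[OF p p0] fibre_rel(1)[OF fibre_self[OF q1] q1] fibre_rel(1)[OF fibre_self[OF x] x] \<Gamma>(1)
        by (intro A_tuples_append) auto
      moreover have "comb (map2 rel_part q1 q1) q = q"
        using fibre_rel(1)[OF fibre_self[OF q1] q1] A_tuples_in q by (intro comb_side_C[OF \<Gamma>(2)]) auto
      then have "comb (?X p) (p0 @ q @ x) = p @ q @ x"
        using fibre_rel(2)[OF p p0] fibre_rel(2)[OF fibre_self[OF x] x] \<Gamma>(1)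
          tuples_length[OF fibre_in[OF p]] tuples_length[OF p0] tuples_length[OF q] tuples_length[OF q1]
        by simp
      ultimately show ?thesis using \<phi>(2)[OF fibre_in[OF p] q] by (simp add: A_part_def)
    qed
    then show ?thesis by blast
  qed
  then have "(\<lambda>q. {p \<in> fibre \<Gamma>p p0. P [p, q, x]}) ` tuples M \<Gamma>q \<subseteq>
      (\<lambda>S. {p \<in> fibre \<Gamma>p p0. ?X p \<in> S}) ` (A_part ?\<Gamma> \<phi> ` lattice_nbhd ?\<Gamma> T l ?\<beta>)"
    using lat by (intro image_subsetI) (simp add: image_image)
  then show ?thesis using split unfolding fin_split_def by (meson finite_imageI finite_subset)
qed simp

text \<open>The section at \<open>p\<close> is determined by which of the finitely many opposite
  sections contain \<open>p\<close>.\<close>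

lemma finite_dual_sections:
  assumes "finite ((\<lambda>q. {p \<in> S. P p q}) ` B)" shows "finite ((\<lambda>p. {q \<in> B. P p q}) ` S)"
proof -
  let ?F = "(\<lambda>q. {p \<in> S. P p q}) ` B"
  have "{q \<in> B. P p q} = {q \<in> B. {p \<in> S. P p q} \<in> {Z \<in> ?F. p \<in> Z}}" if "p \<in> S" for p
    using that by blast
  then have "(\<lambda>p. {q \<in> B. P p q}) ` S \<subseteq> (\<lambda>Z. {q \<in> B. {p \<in> S. P p q} \<in> Z}) ` Pow ?F"
    by blast
  then show ?thesis using assms by (meson finite_Pow_iff finite_imageI finite_subset)
qed

lemma orthogonal_dual:
  assumes "dfb L M [\<Gamma>p, \<Gamma>q, \<Gamma>x] P" "side_AB \<Gamma>p" "side_C \<Gamma>q" "p0 \<in> tuples M \<Gamma>p" "x \<in> tuples M \<Gamma>x"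
  shows "finite ((\<lambda>p. {q \<in> tuples M \<Gamma>q. P [p, q, x]}) ` fibre \<Gamma>p p0)"
  using finite_dual_sections[OF orthogonal[OF assms]] .

end

section \<open>The imaginary as a function of its coordinates\<close>

definition min_cover :: "('i \<Rightarrow> 'x \<Rightarrow> 'z) \<Rightarrow> 'x set \<Rightarrow> 'i set \<Rightarrow> ('i \<Rightarrow> 'z) \<Rightarrow> bool" where
  "min_cover f X J u \<longleftrightarrow>
     (\<forall>x\<in>X. \<exists>j\<in>J. f j x = u j) \<and> (\<forall>i\<in>J. \<exists>x\<in>X. \<forall>j\<in>J - {i}. f j x \<noteq> u j)"

text \<open>A point \<open>x0\<close> must be covered by some \<open>j\<close>, which fixes the
  value there as \<open>f j x0\<close>. Without that fibre the remaining indices cover the rest of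
  \<open>X\<close>, again irredundantly, so induction leaves finitely many possibilities for each of
  finitely many \<open>j\<close>.\<close>

lemma finite_min_covers:
  assumes "finite J" shows "finite ((\<lambda>u. (\<lambda>j. (j, u j)) ` J) ` {u. min_cover f X J u})"
  using assms
proof (induction J arbitrary: X rule: finite_psubset_induct)
  case (psubset J)
  \<comment> \<open>Only the values of \<open>u\<close> on \<open>J\<close> matter; the graph over
    \<open>J\<close> identifies functions that agree there.\<close>
  let ?gr = "\<lambda>J u. (\<lambda>j. (j, u j)) ` J"
  consider "J = {}" | "J \<noteq> {}" "X = {}" | x0 where "x0 \<in> X" by blast
  then show ?case
  proof cases
    case 1 then show ?thesis by (auto intro: finite_subset[of _ "{{}}"])
  next
    case 2
    then have "\<not> min_cover f X J u" for u by (auto simp: min_cover_def)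
    then show ?thesis by simp
  next
    case 3
    let ?X = "\<lambda>j. {x \<in> X. f j x \<noteq> f j x0}"
    have "?gr J u \<in> (\<Union>j\<in>J. insert (j, f j x0) ` (?gr (J - {j}) ` {u. min_cover f (?X j) (J - {j}) u}))"
      if u: "min_cover f X J u" for u
    proof -
      obtain j where j: "j \<in> J" "f j x0 = u j" using u 3 by (auto simp: min_cover_def)
      have "min_cover f (?X j) (J - {j}) u"
        unfolding min_cover_def
      proof (intro conjI ballI)
        fix x assume "x \<in> ?X j"
        then show "\<exists>i\<in>J - {j}. f i x = u i" using u j(2) unfolding min_cover_def by fastforce
      next
        fix i assume i: "i \<in> J - {j}"
        then obtain x where x: "x \<in> X" "\<forall>k\<in>J - {i}. f k x \<noteq> u k" using u unfolding min_cover_def by blast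
        moreover have "f j x \<noteq> f j x0" using x(2) i j by auto
        ultimately show "\<exists>x\<in>?X j. \<forall>k\<in>J - {j} - {i}. f k x \<noteq> u k" by (intro bexI[of _ x]) auto
      qed
      moreover have "?gr J u = insert (j, f j x0) (?gr (J - {j}) u)" using j by auto
      ultimately show ?thesis using j(1) by blast
    qed
    then have "?gr J ` {u. min_cover f X J u} \<subseteq>
        (\<Union>j\<in>J. insert (j, f j x0) ` (?gr (J - {j}) ` {u. min_cover f (?X j) (J - {j}) u}))"
      by blast
    moreover have "finite (?gr (J - {j}) ` {u. min_cover f (?X j) (J - {j}) u})" if "j \<in> J" for j
      using psubset.IH[of "J - {j}"] that by blast
    ultimately show ?thesis using psubset.hyps by (meson finite_UN_I finite_imageI finite_subset)
  qed
qed

lemma exists_min_cover: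
  assumes "finite J" "\<forall>x\<in>X. \<exists>j\<in>J. f j x = u j"
  shows "\<exists>J0\<subseteq>J. min_cover f X J0 u"
  using assms
proof (induction J rule: finite_psubset_induct)
  case (psubset J)
  show ?case
  proof (cases "min_cover f X J u")
    case False
    then obtain i where i: "i \<in> J" "\<forall>x\<in>X. \<exists>j\<in>J - {i}. f j x = u j"
      using psubset.prems by (auto simp: min_cover_def)
    then show ?thesis using psubset.IH[of "J - {i}"] by blast
  qed blast
qed

lemma finite_list_min_covers:
  assumes "distinct js"
  shows "finite {us. length us = length js \<and> min_cover (\<lambda>k. f (js ! k)) X {..<length js} ((!) us)}"
proof -
  let ?S = "{us. length us = length js \<and> min_cover (\<lambda>k. f (js ! k)) X {..<length js} ((!) us)}"
  let ?g = "\<lambda>us. (\<lambda>k. (k, us ! k)) ` {..<length js}"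
  have "?g ` ?S \<subseteq> (\<lambda>u. (\<lambda>j. (j, u j)) ` {..<length js}) ` {u. min_cover (\<lambda>k. f (js ! k)) X {..<length js} u}"
    by (rule image_subsetI) simp
  then have "finite (?g ` ?S)" using finite_min_covers by (rule finite_subset) simp
  moreover have "inj_on ?g ?S"
  proof (rule inj_onI)
    fix us vs assume a: "us \<in> ?S" "vs \<in> ?S" "?g us = ?g vs"
    then have "us ! k = vs ! k" if "k < length js" for k
    proof -
      have "(k, us ! k) \<in> ?g vs" using that a(3)[symmetric] by simp
      then show ?thesis by auto
    qed
    then show "us = vs" using a(1,2) by (intro nth_equalityI) auto
  qed
  ultimately show ?thesis by (rule finite_imageD)
qed

section \<open>Definable functions into \<open>\<B>\<close> and \<open>\<C>\<close>\<close>

context exact_sequence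
begin

definition dtb :: "('x, 'y) seq_sort list list \<Rightarrow> (('a, 'u, 'b, 'c, 'w) seq_elem list list \<Rightarrow> 'b) \<Rightarrow> bool" where
  "dtb \<Gamma>s g \<longleftrightarrow> dft L M \<Gamma>s (\<lambda>bs. EB (g bs)) SB"

definition dtc :: "('x, 'y) seq_sort list list \<Rightarrow> (('a, 'u, 'b, 'c, 'w) seq_elem list list \<Rightarrow> 'c) \<Rightarrow> bool" where
  "dtc \<Gamma>s g \<longleftrightarrow> dft L M \<Gamma>s (\<lambda>bs. EC (CoreEl (g bs))) (SC Core)"

lemma dtb_var:
  assumes "k < length \<Gamma>s" "i < length (\<Gamma>s ! k)" "\<Gamma>s ! k ! i = SB"
  shows "dtb \<Gamma>s (\<lambda>bs. bval (bs ! k ! i))"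
proof -
  have "dft L M \<Gamma>s (\<lambda>bs. bs ! k ! i) SB" using dft_var[OF assms(1,2)] assms(3) by simp
  then show ?thesis unfolding dtb_def
  proof (rule dft_cong)
    fix bs assume "env M \<Gamma>s bs"
    then have "bs ! k ! i \<in> univ M SB" using tuples_nth[OF env_nth[OF _ assms(1)] assms(2)] assms(3) by simp
    then show "bs ! k ! i = EB (bval (bs ! k ! i))" by (auto simp: univ_SB)
  qed
qed

lemma dtb_zero: "dtb \<Gamma>s (\<lambda>bs. 0)"
  unfolding dtb_def using dft_app[of "OpB Zero" L M \<Gamma>s "[]"]
  by (simp add: funs_L fdom_L fcod_L M_eq seq_struct_def)

lemma dtb_add: "dtb \<Gamma>s f \<Longrightarrow> dtb \<Gamma>s g \<Longrightarrow> dtb \<Gamma>s (\<lambda>bs. f bs + g bs)"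
  unfolding dtb_def using dft_app[of "OpB Plus" L M \<Gamma>s "[\<lambda>bs. EB (f bs), \<lambda>bs. EB (g bs)]"]
  by (simp add: funs_L fdom_L fcod_L M_eq seq_struct_def numeral_2_eq_2)

lemma dtb_neg: "dtb \<Gamma>s f \<Longrightarrow> dtb \<Gamma>s (\<lambda>bs. - f bs)"
  unfolding dtb_def using dft_app[of "OpB Minus" L M \<Gamma>s "[\<lambda>bs. EB (f bs)]"]
  by (simp add: funs_L fdom_L fcod_L M_eq seq_struct_def)

lemma dtb_scale: "dtb \<Gamma>s f \<Longrightarrow> dtb \<Gamma>s (\<lambda>bs. scB r (f bs))"
  unfolding dtb_def using dft_app[of "OpB (Scale r)" L M \<Gamma>s "[\<lambda>bs. EB (f bs)]"]
  by (simp add: funs_L fdom_L fcod_L M_eq seq_struct_def)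

lemma dtb_iota:
  "dft L M \<Gamma>s h (SA Core) \<Longrightarrow> dtb \<Gamma>s (\<lambda>bs. \<iota> (the_core (the_EA (h bs))))"
  unfolding dtb_def using dft_app[of Iota L M \<Gamma>s "[h]"]
  by (simp add: funs_L fdom_L fcod_L M_eq seq_struct_def)

text \<open>The offset is for the induction: when the context shrinks to its tail, the window into
  the fixed block \<open>k\<close> moves by one.\<close>

lemma dtb_lin:
  assumes "k < length \<Gamma>s"
    "\<And>i. i < length \<Gamma> \<Longrightarrow> \<Gamma> ! i = SB \<Longrightarrow> off + i < length (\<Gamma>s ! k) \<and> \<Gamma>s ! k ! (off + i) = SB"
  shows "dtb \<Gamma>s (\<lambda>bs. lin scB \<Gamma> r (\<lambda>i. bval (bs ! k ! (off + i))))"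
  using assms(2)
proof (induction \<Gamma> arbitrary: off r)
  case Nil then show ?case by (simp add: dtb_zero)
next
  case (Cons s \<Gamma>)
  have "dtb \<Gamma>s (\<lambda>bs. lin scB \<Gamma> (\<lambda>i. r (Suc i)) (\<lambda>i. bval (bs ! k ! (Suc off + i))))"
    by (rule Cons.IH) (use Cons.prems[of "Suc _"] in simp)
  then have 1: "dtb \<Gamma>s (\<lambda>bs. lin scB \<Gamma> (\<lambda>i. r (Suc i)) (\<lambda>i. bval (bs ! k ! (off + Suc i))))" by simp
  show ?case
  proof (cases "s = SB")
    case True
    then have "dtb \<Gamma>s (\<lambda>bs. bval (bs ! k ! off))" using Cons.prems[of 0] assms(1) by (intro dtb_var) auto
    then have "dtb \<Gamma>s (\<lambda>bs. scB (r 0) (bval (bs ! k ! off)) +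
        lin scB \<Gamma> (\<lambda>i. r (Suc i)) (\<lambda>i. bval (bs ! k ! (off + Suc i))))"
      by (intro dtb_add dtb_scale 1)
    then show ?thesis using True by simp
  next
    case False then show ?thesis using 1 by simp
  qed
qed

lemma dtc_v: "dtb \<Gamma>s f \<Longrightarrow> dtc \<Gamma>s (\<lambda>bs. v (f bs))"
  unfolding dtb_def dtc_def using dft_app[of Vee L M \<Gamma>s "[\<lambda>bs. EB (f bs)]"]
  by (simp add: funs_L fdom_L fcod_L M_eq seq_struct_def)

lemma dtc_add: "dtc \<Gamma>s f \<Longrightarrow> dtc \<Gamma>s g \<Longrightarrow> dtc \<Gamma>s (\<lambda>bs. f bs + g bs)"
  unfolding dtc_def using dft_app[of "OpC Plus" L M \<Gamma>s "[\<lambda>bs. EC (CoreEl (f bs)), \<lambda>bs. EC (CoreEl (g bs))]"]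
  by (simp add: funs_L fdom_L fcod_L M_eq seq_struct_def numeral_2_eq_2)

lemma dtc_zero: "dtc \<Gamma>s (\<lambda>bs. 0)"
  unfolding dtc_def using dft_app[of "OpC Zero" L M \<Gamma>s "[]"]
  by (simp add: funs_L fdom_L fcod_L M_eq seq_struct_def)

lemma dtc_scale: "dtc \<Gamma>s f \<Longrightarrow> dtc \<Gamma>s (\<lambda>bs. scC r (f bs))"
  unfolding dtc_def using dft_app[of "OpC (Scale r)" L M \<Gamma>s "[\<lambda>bs. EC (CoreEl (f bs))]"]
  by (simp add: funs_L fdom_L fcod_L M_eq seq_struct_def)

abbreviation cval :: "('a, 'u, 'b, 'c, 'w) seq_elem \<Rightarrow> 'c" where
  "cval x \<equiv> the_core (the_EC x)"

lemma dtc_var: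
  assumes "k < length \<Gamma>s" "i < length (\<Gamma>s ! k)" "\<Gamma>s ! k ! i = SC Core"
  shows "dtc \<Gamma>s (\<lambda>bs. cval (bs ! k ! i))"
proof -
  have "dft L M \<Gamma>s (\<lambda>bs. bs ! k ! i) (SC Core)" using dft_var[OF assms(1,2)] assms(3) by simp
  then show ?thesis unfolding dtc_def
  proof (rule dft_cong)
    fix bs assume "env M \<Gamma>s bs"
    then have "bs ! k ! i \<in> univ M (SC Core)" using tuples_nth[OF env_nth[OF _ assms(1)] assms(2)] assms(3) by simp
    then show "bs ! k ! i = EC (CoreEl (cval (bs ! k ! i)))" by (auto simp: univ_SC core_C)
  qed
qed

lemma dfb_eqB: "dtb \<Gamma>s f \<Longrightarrow> dtb \<Gamma>s g \<Longrightarrow> dfb L M \<Gamma>s (\<lambda>bs. f bs = g bs)"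
  unfolding dtb_def using dfb_eq[of L M \<Gamma>s "\<lambda>bs. EB (f bs)" SB "\<lambda>bs. EB (g bs)"] by simp

lemma dfb_eqC: "dtc \<Gamma>s f \<Longrightarrow> dtc \<Gamma>s g \<Longrightarrow> dfb L M \<Gamma>s (\<lambda>bs. f bs = g bs)"
  unfolding dtc_def
  using dfb_eq[of L M \<Gamma>s "\<lambda>bs. EC (CoreEl (f bs))" "SC Core" "\<lambda>bs. EC (CoreEl (g bs))"] by simp

lemma in_SC_Core [simp]: "EC (CoreEl c) \<in> univ M (SC Core)" and in_SB [simp]: "EB b \<in> univ M SB"
  by (auto simp: univ_SC core_C univ_SB)

lemma univ_SC_Core: "x \<in> univ M (SC Core) \<longleftrightarrow> (\<exists>c. x = EC (CoreEl c))"
  by (auto simp: univ_SC core_C)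

lemma shift_append: "length Y = n \<Longrightarrow> shift (Y @ Z) g = shift Y g @ shift Z (\<lambda>i. g (n + i))"
  by (induction Y arbitrary: g n) (auto split: seq_elem.split)

lemma shift_zero: "shift Y (\<lambda>i. 0) = Y"
  by (induction Y) (auto split: seq_elem.split)

lemma shift_cong: "(\<And>i. i < length Y \<Longrightarrow> g i = h i) \<Longrightarrow> shift Y g = shift Y h"
  by (rule nth_equalityI) (auto simp: shift_nth split: seq_elem.split)

section \<open>The points of \<open>\<C>\<close> algebraic over the imaginary, and the invariance of
  its class\<close>

context
  fixes ss F X
  assumes F: "definable_equiv L M ss F" and X: "X \<in> tuples M ss // F"
begin

abbreviation "acl_e \<equiv> acl_eq L M {(Quot ss F, Class X)}"

abbreviation "D \<equiv> C_points acl_e"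

lemma D_iff: "c \<in> D \<longleftrightarrow> (Home (SC Core), Real (EC (CoreEl c))) \<in> acl_e"
  by (simp add: C_points_def)

lemma class_F: "x \<in> X \<Longrightarrow> (x, y) \<in> F \<longleftrightarrow> y \<in> X"
  using class_eq_iff[OF definable_equivD(1)[OF F] X X_sub[OF F X]] by blast

lemma X_nonempty: "\<exists>x. x \<in> X"
  using X definable_equivD(1)[OF F] in_quotient_imp_non_empty by fastforce

lemma acl_of_empty: "(s, x) \<in> acl L M {} \<Longrightarrow> (Home s, Real x) \<in> acl_e"
proof -
  assume "(s, x) \<in> acl L M {}"
  then obtain Y where Y: "definable_over L M {} [s] Y" "finite Y" "[x] \<in> Y" by (auto simp: acl_def)
  then obtain \<phi> where \<phi>: "wf_fm L [s] \<phi>" "Y = {xs \<in> tuples M [s]. sat M xs \<phi>}" and s: "s \<in> sorts L"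
    by (auto simp: definable_over_def)
  have "dfb L M [[s]] (\<lambda>bs. sat M (concat bs) \<phi>)" using \<phi>(1) by (auto simp: dfb_def)
  then have 1: "dfb L M [ss, [s], []] (\<lambda>bs. sat M (concat (map ((!) bs) [1])) \<phi>)"
    by (rule dfb_reindex) simp_all
  obtain x0 where x0: "x0 \<in> X" using X_nonempty by blast
  have "(Home ([s] ! 0), Real ([x] ! 0)) \<in> acl_e"
    by (rule acl_home[OF F X 1, of "[]" "[x]" x0])
      (use s \<phi> Y x0 in \<open>auto intro: rev_finite_subset\<close>)
  then show ?thesis by simp
qed

text \<open>By torsion-freeness \<open>y\<close> is the only solution of its equation. Thus
  \<open>D\<close> is closed under division by nonzero scalars, and with \<open>l = 1\<close> under
  linear combinations.\<close>

lemma D_closed: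
  assumes "c1 \<in> D" "c2 \<in> D" "l \<noteq> 0" "scC l y = c1 + scC r c2" shows "y \<in> D"
proof -
  let ?\<Gamma>s = "[ss, [SC Core], [SC Core, SC Core]]"
  have 1: "dfb L M ?\<Gamma>s (\<lambda>bs. scC l (cval (bs ! 1 ! 0)) = cval (bs ! 2 ! 0) + scC r (cval (bs ! 2 ! 1)))"
    by (intro dfb_eqC dtc_add dtc_scale dtc_var) simp_all
  let ?ec = "\<lambda>c. EC (CoreEl c) :: ('a, 'u, 'b, 'c, 'w) seq_elem"
  obtain x0 where x0: "x0 \<in> X" using X_nonempty by blast
  have "(Home ([SC Core] ! 0), Real ([?ec y] ! 0)) \<in> acl_e"
  proof (rule acl_home[OF F X 1, of "[?ec c1, ?ec c2]" "[?ec y]" x0])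
    show "(Home ([SC Core, SC Core] ! j), Real ([?ec c1, ?ec c2] ! j)) \<in> acl_e"
      if "j < length [SC Core, SC Core]" for j
      using assms(1,2) that by (cases j) (auto simp: D_iff)
    fix \<delta>' assume "\<delta>' \<in> tuples M [SC Core, SC Core]"
    let ?S = "{us \<in> tuples M [SC Core]. \<exists>x\<in>X. scC l (cval ([x, us, \<delta>'] ! 1 ! 0)) =
      cval ([x, us, \<delta>'] ! 2 ! 0) + scC r (cval ([x, us, \<delta>'] ! 2 ! 1))}"
    have uniq: "us = us'" if us: "us \<in> ?S" "us' \<in> ?S" for us us'
    proof -
      obtain c c' where c: "us = [?ec c]" "us' = [?ec c']"
        using us by (auto simp: tuples_Cons_iff univ_SC_Core)
      then have "scC l c = scC l c'" using us by simp
      then show ?thesis using c scC_cancel[OF assms(3)] by simp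
    qed
    show "finite ?S"
    proof (cases "?S = {}")
      case False
      then obtain us where "us \<in> ?S" by blast
      then have "?S \<subseteq> {us}" using uniq by blast
      then show ?thesis by (rule finite_subset) simp
    qed (simp only: finite.emptyI)
  qed (use assms x0 in auto)
  then show ?thesis by (simp add: D_iff)
qed

lemma D_zero: "0 \<in> D"
proof -
  have 1: "dfb L M [ss, [SC Core], []] (\<lambda>bs. cval (bs ! 1 ! 0) = 0)"
    by (intro dfb_eqC dtc_zero dtc_var) simp_all
  let ?ec = "\<lambda>c. EC (CoreEl c) :: ('a, 'u, 'b, 'c, 'w) seq_elem"
  obtain x0 where x0: "x0 \<in> X" using X_nonempty by blast
  have "(Home ([SC Core] ! 0), Real ([?ec 0] ! 0)) \<in> acl_e"
  proof (rule acl_home[OF F X 1, of "[]" "[?ec 0]" x0])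
    fix \<delta>' assume "\<delta>' \<in> tuples M []"
    have "{us \<in> tuples M [SC Core]. \<exists>x\<in>X. cval ([x, us, \<delta>'] ! 1 ! 0) = 0} \<subseteq> {[?ec 0]}"
      by (auto simp: tuples_Cons_iff univ_SC_Core)
    then show "finite {us \<in> tuples M [SC Core]. \<exists>x\<in>X. cval ([x, us, \<delta>'] ! 1 ! 0) = 0}"
      by (rule finite_subset) simp
  qed (use x0 in auto)
  then show ?thesis by (simp add: D_iff)
qed

lemma D_v:
  assumes "(Home SB, Real (EB b)) \<in> acl_e" shows "v b \<in> D"
proof -
  have 1: "dfb L M [ss, [SC Core], [SB]] (\<lambda>bs. cval (bs ! 1 ! 0) = v (bval (bs ! 2 ! 0)))"
    by (intro dfb_eqC dtc_v dtb_var dtc_var) simp_all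
  let ?ec = "\<lambda>c. EC (CoreEl c) :: ('a, 'u, 'b, 'c, 'w) seq_elem"
  obtain x0 where x0: "x0 \<in> X" using X_nonempty by blast
  have "(Home ([SC Core] ! 0), Real ([?ec (v b)] ! 0)) \<in> acl_e"
  proof (rule acl_home[OF F X 1, of "[EB b]" "[?ec (v b)]" x0])
    fix \<delta>' assume "\<delta>' \<in> tuples M [SB]"
    have "{us \<in> tuples M [SC Core]. \<exists>x\<in>X. cval ([x, us, \<delta>'] ! 1 ! 0) = v (bval ([x, us, \<delta>'] ! 2 ! 0))} \<subseteq>
        {[?ec (v (bval (\<delta>' ! 0)))]}"
      by (auto simp: tuples_Cons_iff univ_SC_Core)
    then show "finite {us \<in> tuples M [SC Core]. \<exists>x\<in>X. cval ([x, us, \<delta>'] ! 1 ! 0) = v (bval ([x, us, \<delta>'] ! 2 ! 0))}"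
      by (rule finite_subset) simp
  qed (use assms x0 in auto)
  then show ?thesis by (simp add: D_iff)
qed

lemma D_lin: "(\<And>i. c i \<in> D) \<Longrightarrow> lin scC \<Gamma> r c \<in> D"
proof (induction \<Gamma> arbitrary: r c)
  case Nil then show ?case by (simp add: D_zero)
next
  case (Cons s \<Gamma>)
  have "lin scC \<Gamma> (\<lambda>i. r (Suc i)) (\<lambda>i. c (Suc i)) \<in> D" by (rule Cons.IH[OF Cons.prems])
  then show ?case
    using D_closed[of "lin scC \<Gamma> (\<lambda>i. r (Suc i)) (\<lambda>i. c (Suc i))" "c 0" 1 _ "r 0"] Cons.prems
    by (auto simp: add.commute)
qed

text \<open>B. H. Neumann's covering argument: the minimal covers of \<open>X\<close> by fibres of \<open>f\<^sub>j\<close>, one for each \<open>j\<close>, are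
  finite in number, hence algebraic over the class.\<close>

lemma avoid_points:
  assumes J: "finite J" and f: "\<And>j. j \<in> J \<Longrightarrow> dtc [ss] (\<lambda>bs. f j (bs ! 0))" and u: "\<And>j. j \<in> J \<Longrightarrow> u j \<notin> D"
  shows "\<exists>x\<in>X. \<forall>j\<in>J. f j x \<noteq> u j"
proof (rule ccontr)
  assume "\<not> (\<exists>x\<in>X. \<forall>j\<in>J. f j x \<noteq> u j)"
  then have "\<forall>x\<in>X. \<exists>j\<in>J. f j x = u j" by blast
  from exists_min_cover[OF J this] obtain J0 where J0: "J0 \<subseteq> J" "min_cover f X J0 u" by blast
  from finite_distinct_list[OF finite_subset[OF J0(1) J]]
  obtain js where js: "set js = J0" "distinct js" by blast
  let ?m = "length js"
  obtain x0 where x0: "x0 \<in> X" using X_nonempty by blast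
  have "J0 \<noteq> {}" using J0(2) x0 by (auto simp: min_cover_def)
  then have m: "0 < ?m" using js(1) by auto
  let ?ec = "\<lambda>c. EC (CoreEl c) :: ('a, 'u, 'b, 'c, 'w) seq_elem"
  let ?fe = "\<lambda>k x us. f (js ! k) x = cval (us ! k)"
  let ?\<Gamma> = "replicate ?m (SC Core)"
  \<comment> \<open>A first-order rendering of minimal covers. The class is represented by its
    member \<open>bs ! 0\<close>, and \<open>us\<close> carries the values.\<close>
  define \<Phi> where "\<Phi> = (\<lambda>bs. (\<forall>x\<in>tuples M ss. (bs ! 0, x) \<in> F \<longrightarrow> (\<exists>k\<in>{..<?m}. ?fe k x (bs ! 1))) \<and>
    (\<forall>i\<in>{..<?m}. \<exists>x\<in>tuples M ss. (bs ! 0, x) \<in> F \<and> (\<forall>k\<in>{..<?m} - {i}. \<not> ?fe k x (bs ! 1))))"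
  have \<Phi>_iff: "\<Phi> [x, us, []] \<longleftrightarrow> min_cover (\<lambda>k. f (js ! k)) X {..<?m} ((!) (map cval us))"
    if "x \<in> X" "length us = ?m" for x us
  proof -
    have "\<Phi> [x, us, []] \<longleftrightarrow> (\<forall>y\<in>X. \<exists>k\<in>{..<?m}. ?fe k y us) \<and>
        (\<forall>i\<in>{..<?m}. \<exists>y\<in>X. \<forall>k\<in>{..<?m} - {i}. \<not> ?fe k y us)"
      unfolding \<Phi>_def using class_F[OF that(1)] X_sub[OF F X] by (simp, blast)
    then show ?thesis using that(2) by (simp add: min_cover_def)
  qed
  let ?\<Gamma>s = "[ss, ss, ?\<Gamma>, []]"
  have fdef: "dfb L M ?\<Gamma>s (\<lambda>bs. ?fe k (bs ! 0) (bs ! 2))" if k: "k < ?m" for k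
  proof -
    \<comment> \<open>\<open>f\<close> is given by a term over the single block \<open>ss\<close>.
      As this block comes first in the longer context, the term is reused under the identity
      renaming.\<close>
    have "dtc ?\<Gamma>s (\<lambda>bs. f (js ! k) (bs ! 0))"
    proof -
      have "js ! k \<in> J" using k js(1) J0(1) by auto
      from f[OF this] have "dft L M [ss] (\<lambda>bs. ?ec (f (js ! k) (bs ! 0))) (SC Core)" by (simp add: dtc_def)
      then obtain t where t: "wt_trm L ss t (SC Core)"
        "\<forall>bs. env M [ss] bs \<longrightarrow> val M (concat bs) t = ?ec (f (js ! k) (bs ! 0))"
        unfolding dft_def by auto
      have "val M (x @ ys) t = ?ec (f (js ! k) x)" if x: "x \<in> tuples M ss" for x ys
      proof -
        have "val M (x @ ys) (ren_trm id t) = val M x t"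
          by (rule val_ren[OF t(1)]) (use tuples_length[OF x] in \<open>simp add: ren_env_def nth_append\<close>)
        moreover have "ren_trm id t = t" for t :: "('r, 'f, 'g) seq_fun trm"
          by (induction t) (auto intro: map_idI)
        ultimately show ?thesis using t(2)[rule_format, of "[x]"] x by simp
      qed
      moreover have "wt_trm L (ss @ \<Gamma>') t (SC Core)" for \<Gamma>'
      proof -
        have "wt_trm L (ss @ \<Gamma>') (ren_trm id t) (SC Core)"
          by (rule wt_ren[OF t(1)]) (simp add: ren_ok_def nth_append)
        moreover have "ren_trm id t = t" for t :: "('r, 'f, 'g) seq_fun trm"
          by (induction t) (auto intro: map_idI)
        ultimately show ?thesis by simp
      qed
      ultimately show ?thesis unfolding dtc_def dft_def by (intro exI[of _ t]) (auto simp: env_Cons_iff)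
    qed
    moreover have "dtc ?\<Gamma>s (\<lambda>bs. cval (bs ! 2 ! k))" using k by (intro dtc_var) simp_all
    ultimately show ?thesis by (rule dfb_eqC)
  qed
  have Fdef: "dfb L M ?\<Gamma>s (\<lambda>bs. (bs ! 1, bs ! 0) \<in> F)"
    using dfb_reindex[OF definable_equivD(3)[OF F], of ?\<Gamma>s "[1, 0]"] by simp
  have "dfb L M ?\<Gamma>s (\<lambda>bs. (bs ! 1, bs ! 0) \<in> F \<longrightarrow> (\<exists>k\<in>{..<?m}. ?fe k (bs ! 0) (bs ! 2)))"
    by (intro dfb_imp Fdef dfb_bex[OF finite_lessThan _ Fdef] fdef) simp
  from dfb_all[OF this definable_equivD(2)[OF F]]
  have 1: "dfb L M [ss, ?\<Gamma>, []] (\<lambda>bs. \<forall>x\<in>tuples M ss. (bs ! 0, x) \<in> F \<longrightarrow> (\<exists>k\<in>{..<?m}. ?fe k x (bs ! 1)))"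
    by simp
  have 2: "dfb L M [ss, ?\<Gamma>, []] (\<lambda>bs. \<exists>x\<in>tuples M ss. (bs ! 0, x) \<in> F \<and> (\<forall>k\<in>{..<?m} - {i}. \<not> ?fe k x (bs ! 1)))" for i
  proof -
    have "dfb L M ?\<Gamma>s (\<lambda>bs. (bs ! 1, bs ! 0) \<in> F \<and> (\<forall>k\<in>{..<?m} - {i}. \<not> ?fe k (bs ! 0) (bs ! 2)))"
      by (intro dfb_conj Fdef dfb_ball[OF _ _ Fdef] dfb_not fdef) simp_all
    from dfb_ex[OF this definable_equivD(2)[OF F]] show ?thesis by simp
  qed
  have \<Phi>: "dfb L M [ss, ?\<Gamma>, []] \<Phi>"
    unfolding \<Phi>_def by (intro dfb_conj 1 dfb_ball[OF finite_lessThan 2 1])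
  let ?us = "map (\<lambda>j. ?ec (u j)) js"
  have mc: "min_cover (\<lambda>k. f (js ! k)) X {..<?m} ((!) (map cval ?us))"
    unfolding min_cover_def
  proof (intro conjI ballI)
    fix x assume "x \<in> X"
    then obtain j where "j \<in> set js" "f j x = u j" using J0(2) js(1) by (auto simp: min_cover_def)
    then show "\<exists>k\<in>{..<?m}. f (js ! k) x = map cval ?us ! k" by (auto simp: in_set_conv_nth)
  next
    fix i assume i: "i \<in> {..<?m}"
    then have "js ! i \<in> J0" using js(1) by auto
    then obtain x where x: "x \<in> X" "\<forall>j\<in>J0 - {js ! i}. f j x \<noteq> u j"
      using J0(2) unfolding min_cover_def by blast
    have "f (js ! k) x \<noteq> map cval ?us ! k" if "k \<in> {..<?m} - {i}" for k
      using x(2) that i js by (auto simp: nth_eq_iff_index_eq)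
    then show "\<exists>x\<in>X. \<forall>k\<in>{..<?m} - {i}. f (js ! k) x \<noteq> map cval ?us ! k" using x(1) by blast
  qed
  have us: "?us \<in> tuples M ?\<Gamma>" by (auto simp: tuples_iff list_all2_conv_all_nth)
  have "(Home (?\<Gamma> ! 0), Real (?us ! 0)) \<in> acl_e"
  proof (rule acl_home[OF F X \<Phi>, of "[]" ?us x0])
    show "\<Phi> [x0, ?us, []]" using \<Phi>_iff[OF x0, of ?us] mc by simp
    fix \<delta>' assume "\<delta>' \<in> tuples M ([] :: ('x, 'y) seq_sort list)"
    then have \<delta>': "\<delta>' = []" by simp
    have "{us \<in> tuples M ?\<Gamma>. \<exists>x\<in>X. \<Phi> [x, us, \<delta>']} \<subseteq> map ?ec ` {cs. length cs = ?m \<and>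
        min_cover (\<lambda>k. f (js ! k)) X {..<?m} ((!) cs)}"
    proof
      fix us assume a: "us \<in> {us \<in> tuples M ?\<Gamma>. \<exists>x\<in>X. \<Phi> [x, us, \<delta>']}"
      then have l: "length us = ?m" using tuples_length by fastforce
      have "us ! k = ?ec (cval (us ! k))" if "k < ?m" for k
        using a that tuples_nth[of us M ?\<Gamma> k] by (auto simp: univ_SC_Core)
      then have "us = map ?ec (map cval us)" using l by (auto intro: nth_equalityI)
      moreover have "map cval us \<in> {cs. length cs = ?m \<and> min_cover (\<lambda>k. f (js ! k)) X {..<?m} ((!) cs)}"
        using a \<Phi>_iff l \<delta>' by auto
      ultimately show "us \<in> map ?ec ` {cs. length cs = ?m \<and> min_cover (\<lambda>k. f (js ! k)) X {..<?m} ((!) cs)}"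
        by (rule image_eqI)
    qed
    then show "finite {us \<in> tuples M ?\<Gamma>. \<exists>x\<in>X. \<Phi> [x, us, \<delta>']}"
      by (rule finite_subset) (intro finite_imageI finite_list_min_covers js(2))
  qed (use us x0 m in auto)
  then have "u (js ! 0) \<in> D" using m by (simp add: D_iff)
  moreover have "js ! 0 \<in> J" using nth_mem[OF m] js(1) J0(1) by blast
  ultimately show False using u by blast
qed

lemma shift_in_class:
  assumes inv: "invariant (ss @ ss) \<phi> T l" and fin: "finite T"
    and \<phi>: "\<And>x y. x \<in> tuples M ss \<Longrightarrow> y \<in> tuples M ss \<Longrightarrow> sat M (x @ y) \<phi> \<longleftrightarrow> (x, y) \<in> F"
    and d: "d \<in> X" and g: "\<And>i. v (g i) = 0"
    and kill: "\<And>t. t \<in> T \<Longrightarrow> lin scC ss t (\<lambda>i. v (bv d i)) \<in> D \<Longrightarrow> lin scB ss t g = 0"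
  shows "shift d (\<lambda>i. scB l (g i)) \<in> X"
proof -
  let ?n = "length ss"
  have dt: "d \<in> tuples M ss" using X_sub[OF F X d] .
  let ?u = "\<lambda>t. lin scC ss t (\<lambda>i. v (bv d i))"
  \<comment> \<open>The relation \<open>t\<close> on the pair \<open>d @ x\<close> splits into two
    halves; it holds in \<open>\<C>\<close> exactly if the half of \<open>x\<close>, with its sign
    changed, equals \<open>?u t\<close>. Avoiding these values leaves only relations with
    \<open>?u t \<in> D\<close>, which annihilate \<open>g\<close> by assumption.\<close>
  let ?f = "\<lambda>t x. v (- lin scB ss (\<lambda>i. t (?n + i)) (\<lambda>i. bval (x ! (0 + i))))"
  have "\<exists>x\<in>X. \<forall>t\<in>{t \<in> T. ?u t \<notin> D}. ?f t x \<noteq> ?u t"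
  proof (rule avoid_points)
    show "dtc [ss] (\<lambda>bs. ?f t (bs ! 0))" for t
      by (intro dtc_v dtb_neg dtb_lin) auto
  qed (use fin in auto)
  then obtain x where x: "x \<in> X" "\<forall>t\<in>{t \<in> T. ?u t \<notin> D}. ?f t x \<noteq> ?u t" by blast
  have xt: "x \<in> tuples M ss" using X_sub[OF F X x(1)] .
  \<comment> \<open>Extension by 0: only the first member of the pair is translated, and
    \<open>x\<close> stays in place.\<close>
  let ?g = "\<lambda>i. if i < ?n then g i else 0"
  have k: "kill T (ss @ ss) (\<lambda>i. v (bv (d @ x) i)) ?g"
    unfolding kill_def
  proof (intro ballI impI)
    fix t assume t: "t \<in> T" "lin scC (ss @ ss) t (\<lambda>i. v (bv (d @ x) i)) = 0"
    have "lin scC ss t (\<lambda>i. v (bv (d @ x) i)) = ?u t"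
      by (rule lin_cong) (simp add: nth_append tuples_length[OF dt])
    moreover have "(\<lambda>i. v (bv (d @ x) (?n + i))) = (\<lambda>i. v (bv x i))"
      using nth_append_length_plus[of d x] tuples_length[OF dt] by simp
    ultimately have "?u t + lin scC ss (\<lambda>i. t (?n + i)) (\<lambda>i. v (bv x i)) = 0"
      using t(2) by (simp add: lin_append)
    then have "?f t x = ?u t" by (simp add: v.neg v_lin eq_neg_iff_add_eq_0[symmetric])
    then have "?u t \<in> D" using x(2) t(1) by blast
    then have "lin scB ss t g = 0" by (rule kill[OF t(1)])
    moreover have "lin scB ss t ?g = lin scB ss t g" by (rule lin_cong) simp
    ultimately show "lin scB (ss @ ss) t ?g = 0" by (simp add: lin_append B.lin_zero)
  qed
  have "d @ x \<in> tuples M (ss @ ss)" using dt xt by (rule tuples_appendI)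
  moreover have "\<forall>i. v (?g i) = 0" using g by (simp add: v.zero)
  ultimately have "sat M (shift (d @ x) (\<lambda>i. scB l (?g i))) \<phi> = sat M (d @ x) \<phi>"
    by (intro inv[unfolded invariant_def, rule_format, of _ ?g] conjI k)
  moreover have "shift (d @ x) (\<lambda>i. scB l (?g i)) = shift d (\<lambda>i. scB l (g i)) @ x"
  proof -
    have "shift d (\<lambda>i. scB l (?g i)) = shift d (\<lambda>i. scB l (g i))"
      by (rule shift_cong) (simp add: tuples_length[OF dt])
    then show ?thesis by (simp add: shift_append[OF tuples_length[OF dt]] shift_zero)
  qed
  ultimately have "(shift d (\<lambda>i. scB l (g i)), x) \<in> F \<longleftrightarrow> (d, x) \<in> F"
    using \<phi>[OF shift_in[OF dt] xt] \<phi>[OF dt xt] by simp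
  then have "(shift d (\<lambda>i. scB l (g i)), x) \<in> F" using class_F[OF d] x(1) by simp
  then have "(x, shift d (\<lambda>i. scB l (g i))) \<in> F"
    using definable_equivD(1)[OF F] by (meson equiv_def symD)
  then show ?thesis using class_F[OF x(1)] by simp
qed

text \<open>Here \<open>\<rho> [p, q, x]\<close> is meant to say that \<open>p\<close> and \<open>q\<close> are the coordinates of \<open>x\<close> on the side of the
  fibres of \<open>v\<close> and on that of \<open>\<C>\<close>. The two codes are those of the sides of the rectangle around \<open>(p0, q0)\<close>
  consisting of the coordinates of elements of \<open>X\<close>.\<close>

lemma dcl_from_coordinates:
  assumes \<rho>: "dfb L M [\<Gamma>p, \<Gamma>q, ss] \<rho>"
    and side: "side_AB \<Gamma>p" "side_C \<Gamma>q" and sorts: "set \<Gamma>p \<subseteq> sorts L" "set \<Gamma>q \<subseteq> sorts L"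
    and news: "\<And>y. SA y \<in> set \<Gamma>p \<Longrightarrow> y \<noteq> Core \<and> SA y \<in> S" "\<And>y. SC (New y) \<in> set \<Gamma>q \<Longrightarrow> SC (New y) \<in> S"
    and p0: "p0 \<in> tuples M \<Gamma>p" and q0: "q0 \<in> tuples M \<Gamma>q"
    and ex: "x0 \<in> X" "\<rho> [p0, q0, x0]"
    and sound: "\<And>x. x \<in> tuples M ss \<Longrightarrow> \<rho> [p0, q0, x] \<Longrightarrow> x \<in> X"
    and \<Delta>: "\<And>i. i < length \<Gamma>p \<Longrightarrow> v (bv p0 i) \<in> D"
  shows "(Quot ss F, Class X) \<in> dcl_eq L M
    (eq_part L M (C_set M S) acl_e \<union> eq_part L M (B_fibres M v D S) acl_e)"
proof -
  let ?N = "length \<Gamma>p" and ?nq = "length \<Gamma>q"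
  let ?ec = "\<lambda>c. EC (CoreEl c) :: ('a, 'u, 'b, 'c, 'w) seq_elem"
  define \<Gamma>\<delta> where "\<Gamma>\<delta> = replicate ?N (SC Core :: ('x, 'y) seq_sort)"
  define \<delta>0 where "\<delta>0 = map (\<lambda>i. ?ec (v (bv p0 i))) [0..<?N]"
  \<comment> \<open>Membership in a fibre expressed with parameters from \<open>\<C>\<close>. The
    fibre itself is not definable over \<open>e\<close>, but its base points
    \<open>\<delta>0\<close> are algebraic over \<open>e\<close>.\<close>
  define over where "over = (\<lambda>(p :: ('a, 'u, 'b, 'c, 'w) seq_elem list) (\<delta> :: ('a, 'u, 'b, 'c, 'w) seq_elem list). \<forall>i\<in>{i. i < ?N \<and> \<Gamma>p ! i = SB}. v (bv p i) = cval (\<delta> ! i))"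
  \<comment> \<open>The relation whose sections give the rectangle: the pair is realised by some
    element, and all its realisations are equivalent to the third argument. It depends on that
    argument only through its class.\<close>
  define G where "G = (\<lambda>bs. (\<exists>x\<in>tuples M ss. \<rho> [bs ! 0, bs ! 1, x]) \<and>
    (\<forall>x\<in>tuples M ss. \<rho> [bs ! 0, bs ! 1, x] \<longrightarrow> (bs ! 2, x) \<in> F))"
  \<comment> \<open>\<open>G\<close> with its element named by coordinates. An element mixes both
    sides and may not occur in a code, whereas by soundness \<open>p0\<close> and \<open>q0\<close>
    determine its class.\<close>
  define H where "H = (\<lambda>bs. \<exists>x\<in>tuples M ss. \<rho> [bs ! 2, bs ! 3, x] \<and> G [bs ! 0, bs ! 1, x])"
  have sF: "set ss \<subseteq> sorts L" using definable_equivD(2)[OF F] .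
  have x0t: "x0 \<in> tuples M ss" using X_sub[OF F X ex(1)] .
  have \<delta>0t: "\<delta>0 \<in> tuples M \<Gamma>\<delta>" by (auto simp: \<delta>0_def \<Gamma>\<delta>_def tuples_iff list_all2_conv_all_nth)
  have \<delta>0acl: "(Home (\<Gamma>\<delta> ! j), Real (\<delta>0 ! j)) \<in> acl_e" if "j < length \<Gamma>\<delta>" for j
    using \<Delta>[of j] that by (simp add: \<delta>0_def \<Gamma>\<delta>_def D_iff)
  have non_SB: "v (bv p i) = 0" if "p \<in> tuples M \<Gamma>p" "i < ?N" "\<Gamma>p ! i \<noteq> SB" for p i
    using tuples_nth[OF that(1,2)] that(2,3) side(1)
    by (cases "\<Gamma>p ! i") (auto simp: univ_SA side_AB_def v.zero)
  have over_fibre: "p \<in> fibre \<Gamma>p p1" if "p \<in> tuples M \<Gamma>p" "p1 \<in> tuples M \<Gamma>p" "over p \<delta>" "over p1 \<delta>" for p p1 \<delta>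
    using that non_SB unfolding fibre_def over_def by (simp, metis)
  have fibre_over: "over p \<delta>" if "p \<in> fibre \<Gamma>p p1" "over p1 \<delta>" for p p1 \<delta>
    using that unfolding fibre_def over_def by simp
  have over0: "over p0 \<delta>0" unfolding over_def \<delta>0_def by simp
  have over_iff: "p \<in> fibre \<Gamma>p p0 \<longleftrightarrow> over p \<delta>0" if "p \<in> tuples M \<Gamma>p" for p
    using over_fibre[OF that p0 _ over0] fibre_over[OF _ over0] by blast
  have G_class: "G [p, q, x] \<longleftrightarrow> G [p, q, x0]" if "x \<in> X" for p q x
    using class_F[OF that] class_F[OF ex(1)] unfolding G_def by simp
  have H0: "H [p, q, p0, q0] \<longleftrightarrow> G [p, q, x0]" for p q
  proof -
    have "H [p, q, p0, q0] \<longleftrightarrow> (\<exists>x\<in>tuples M ss. \<rho> [p0, q0, x] \<and> G [p, q, x])" by (simp add: H_def)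
    also have "\<dots> \<longleftrightarrow> G [p, q, x0]"
    proof
      assume "\<exists>x\<in>tuples M ss. \<rho> [p0, q0, x] \<and> G [p, q, x]"
      then obtain x where "x \<in> X" "G [p, q, x]" using sound by blast
      then show "G [p, q, x0]" using G_class by simp
    qed (use x0t ex(2) in blast)
    finally show ?thesis .
  qed
  have G0: "G [p0, q0, x0]" using ex x0t sound class_F[OF ex(1)] unfolding G_def by auto
  have G_sound: "x \<in> X" if "G [p, q, x0]" "\<rho> [p, q, x]" "x \<in> tuples M ss" for p q x
    using that class_F[OF ex(1)] unfolding G_def by auto

  have dG: "dfb L M [\<Gamma>p, \<Gamma>q, ss] G"
  proof -
    have 1: "dfb L M [ss, \<Gamma>p, \<Gamma>q, ss] (\<lambda>bs. \<rho> [bs ! 1, bs ! 2, bs ! 0])"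
      using dfb_reindex[OF \<rho>, of "[ss, \<Gamma>p, \<Gamma>q, ss]" "[1, 2, 0]"] by simp
    have 2: "dfb L M [ss, \<Gamma>p, \<Gamma>q, ss] (\<lambda>bs. (bs ! 3, bs ! 0) \<in> F)"
      using dfb_reindex[OF definable_equivD(3)[OF F], of "[ss, \<Gamma>p, \<Gamma>q, ss]" "[3, 0]"] by simp
    show ?thesis
      using dfb_conj[OF dfb_ex[OF 1 sF] dfb_all[OF dfb_imp[OF 1 2] sF]] by (simp add: G_def)
  qed
  have dH: "dfb L M [\<Gamma>p, \<Gamma>q, \<Gamma>p, \<Gamma>q] H"
  proof -
    have 1: "dfb L M [ss, \<Gamma>p, \<Gamma>q, \<Gamma>p, \<Gamma>q] (\<lambda>bs. \<rho> [bs ! 3, bs ! 4, bs ! 0])"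
      using dfb_reindex[OF \<rho>, of "[ss, \<Gamma>p, \<Gamma>q, \<Gamma>p, \<Gamma>q]" "[3, 4, 0]"] by simp
    have 2: "dfb L M [ss, \<Gamma>p, \<Gamma>q, \<Gamma>p, \<Gamma>q] (\<lambda>bs. G [bs ! 1, bs ! 2, bs ! 0])"
      using dfb_reindex[OF dG, of "[ss, \<Gamma>p, \<Gamma>q, \<Gamma>p, \<Gamma>q]" "[1, 2, 0]"] by simp
    show ?thesis using dfb_ex[OF dfb_conj[OF 1 2] sF] by (simp add: H_def)
  qed
  have dover: "dfb L M \<Gamma>s (\<lambda>bs. over (bs ! k) (bs ! m))"
    if "k < length \<Gamma>s" "m < length \<Gamma>s" "\<Gamma>s ! k = \<Gamma>p" "\<Gamma>s ! m = \<Gamma>\<delta>" "dfb L M \<Gamma>s Q" for \<Gamma>s k m Q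
    unfolding over_def
    by (intro dfb_ball[OF _ _ that(5)] dfb_eqC dtc_v dtb_var dtc_var) (use that in \<open>auto simp: \<Gamma>\<delta>_def\<close>)

  \<comment> \<open>The left side of the rectangle: the points of the fibre with the same section as
    \<open>p0\<close>. Its product with that section lies in the relation \<open>G\<close>. As
    \<open>p0\<close> is on the proper side, only the index \<open>q0\<close> has to be removed from
    the definition.\<close>
  define RU where "RU = (\<lambda>bs. bs ! 0 \<in> fibre \<Gamma>p (bs ! 2) \<and>
    (\<forall>q\<in>tuples M \<Gamma>q. H [bs ! 0, q, bs ! 2, bs ! 1] \<longleftrightarrow> H [bs ! 2, q, bs ! 2, bs ! 1]))"
  have dRU: "dfb L M [\<Gamma>p, \<Gamma>q, \<Gamma>p] RU"
  proof -
    let ?\<Gamma>s = "[\<Gamma>q, \<Gamma>p, \<Gamma>q, \<Gamma>p]"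
    have 1: "dfb L M ?\<Gamma>s (\<lambda>bs. H [bs ! 1, bs ! 0, bs ! 3, bs ! 2])"
      using dfb_reindex[OF dH, of ?\<Gamma>s "[1, 0, 3, 2]"] by simp
    have 2: "dfb L M ?\<Gamma>s (\<lambda>bs. H [bs ! 3, bs ! 0, bs ! 3, bs ! 2])"
      using dfb_reindex[OF dH, of ?\<Gamma>s "[3, 0, 3, 2]"] by simp
    have 3: "dfb L M [\<Gamma>p, \<Gamma>q, \<Gamma>p] (\<lambda>bs. \<forall>q\<in>tuples M \<Gamma>q. H [bs ! 0, q, bs ! 2, bs ! 1] \<longleftrightarrow> H [bs ! 2, q, bs ! 2, bs ! 1])"
      using dfb_all[OF dfb_iff[OF 1 2] sorts(2)] by simp
    have "dfb L M [\<Gamma>p, \<Gamma>q, \<Gamma>p] (\<lambda>bs. \<forall>i\<in>{i. i < ?N \<and> \<Gamma>p ! i = SB}. v (bv (bs ! 0) i) = v (bv (bs ! 2) i))"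
      by (intro dfb_ball[OF _ _ 3] dfb_eqC dtc_v dtb_var) auto
    from dfb_conj[OF this 3] show ?thesis
    proof (rule dfb_cong)
      fix bs assume "env M [\<Gamma>p, \<Gamma>q, \<Gamma>p] bs"
      then obtain p q p' where bs: "bs = [p, q, p']" "p \<in> tuples M \<Gamma>p" "p' \<in> tuples M \<Gamma>p"
        by (auto simp: env_Cons_iff)
      have "p \<in> fibre \<Gamma>p p' \<longleftrightarrow> (\<forall>i\<in>{i. i < ?N \<and> \<Gamma>p ! i = SB}. v (bv p i) = v (bv p' i))"
        using bs(2) non_SB[OF bs(2)] non_SB[OF bs(3)] unfolding fibre_def by (simp, metis)
      then show "((\<forall>i\<in>{i. i < ?N \<and> \<Gamma>p ! i = SB}. v (bv (bs ! 0) i) = v (bv (bs ! 2) i)) \<and>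
          (\<forall>q\<in>tuples M \<Gamma>q. H [bs ! 0, q, bs ! 2, bs ! 1] \<longleftrightarrow> H [bs ! 2, q, bs ! 2, bs ! 1])) = RU bs"
        by (simp add: RU_def bs(1))
    qed
  qed
  have finU: "finite ((\<lambda>q. {p \<in> tuples M \<Gamma>p. RU [p, q, p0]}) ` tuples M \<Gamma>q)"
  proof -
    have "{p \<in> tuples M \<Gamma>p. RU [p, q, p0]} = {p \<in> fibre \<Gamma>p p0. RU [p, q, p0]}" for q
      unfolding RU_def using fibre_in by auto
    then show ?thesis using orthogonal[OF dRU side p0 p0] by simp
  qed
  obtain K1 \<tau>1 \<theta>1 where \<tau>1: "\<tau>1 \<in> tuples M (\<Gamma>p @ concat (replicate K1 \<Gamma>p))"
    "dfb L M [\<Gamma>p, \<Gamma>p @ concat (replicate K1 \<Gamma>p)] \<theta>1"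
    "\<And>x. x \<in> tuples M \<Gamma>p \<Longrightarrow> \<theta>1 [x, \<tau>1] \<longleftrightarrow> RU [x, q0, p0]"
    "set (zip (\<Gamma>p @ concat (replicate K1 \<Gamma>p)) \<tau>1) \<subseteq> set (zip \<Gamma>p p0) \<union>
       \<Union> {set (zip \<Gamma>p x) | x. x \<in> tuples M \<Gamma>p \<and> (\<exists>y\<in>tuples M \<Gamma>q. RU [x, y, p0])}"
    by (rule finite_family_code[OF dRU sorts(2) p0 q0 finU]) blast
  let ?\<Gamma>1 = "\<Gamma>p @ concat (replicate K1 \<Gamma>p)"
  have \<theta>1_iff: "\<theta>1 [p, \<tau>1] \<longleftrightarrow> over p \<delta>0 \<and> (\<forall>q\<in>tuples M \<Gamma>q. G [p, q, x0] \<longleftrightarrow> G [p0, q, x0])"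
    if "p \<in> tuples M \<Gamma>p" for p
    using \<tau>1(3)[OF that] over_iff[OF that] H0 by (simp add: RU_def)

  \<comment> \<open>The right side: the section at \<open>p\<close>. Using \<open>p\<close> also as
    the coordinate that names the element leaves \<open>p\<close> as the only parameter from the
    left side, hence the index to be removed; the rest comes from \<open>\<C>\<close>. The condition
    \<open>over\<close> confines \<open>p\<close> to one fibre, as finiteness requires.\<close>
  define RW where "RW = (\<lambda>bs. over (bs ! 1) (bs ! 3) \<and> H [bs ! 1, bs ! 0, bs ! 1, bs ! 2])"
  \<comment> \<open>The remaining parameters form one block, as \<open>finite_family_code\<close>
    expects.\<close>
  define RW' where "RW' = (\<lambda>bs. RW [bs ! 0, bs ! 1, take ?nq (bs ! 2), drop ?nq (bs ! 2)])"
  have dRW: "dfb L M [\<Gamma>q, \<Gamma>p, \<Gamma>q, \<Gamma>\<delta>] RW"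
  proof -
    have 1: "dfb L M [\<Gamma>q, \<Gamma>p, \<Gamma>q, \<Gamma>\<delta>] (\<lambda>bs. H [bs ! 1, bs ! 0, bs ! 1, bs ! 2])"
      using dfb_reindex[OF dH, of "[\<Gamma>q, \<Gamma>p, \<Gamma>q, \<Gamma>\<delta>]" "[1, 0, 1, 2]"] by simp
    show ?thesis unfolding RW_def by (intro dfb_conj dover[OF _ _ _ _ 1] 1) simp_all
  qed
  have dRW': "dfb L M [\<Gamma>q, \<Gamma>p, \<Gamma>q @ \<Gamma>\<delta>] RW'"
  proof (rule dfb_regroup[OF dRW])
    fix bs bs' assume e: "env M [\<Gamma>q, \<Gamma>p, \<Gamma>q, \<Gamma>\<delta>] bs" "env M [\<Gamma>q, \<Gamma>p, \<Gamma>q @ \<Gamma>\<delta>] bs'" "concat bs = concat bs'"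
    obtain q p q' \<delta> where bs: "bs = [q, p, q', \<delta>]" "q \<in> tuples M \<Gamma>q" "p \<in> tuples M \<Gamma>p" "q' \<in> tuples M \<Gamma>q"
      using e(1) by (auto simp: env_Cons_iff)
    obtain q1 p1 z where bs': "bs' = [q1, p1, z]" "q1 \<in> tuples M \<Gamma>q" "p1 \<in> tuples M \<Gamma>p"
      using e(2) by (auto simp: env_Cons_iff)
    have "q = q1 \<and> p = p1 \<and> q' @ \<delta> = z"
      using e(3) tuples_length[OF bs(2)] tuples_length[OF bs(3)] tuples_length[OF bs'(2)] tuples_length[OF bs'(3)]
      by (simp add: bs(1) bs'(1))
    then show "RW bs = RW' bs'" using tuples_length[OF bs(4)] by (auto simp: bs(1) bs'(1) RW'_def)
  qed simp
  have RW'0: "RW' [q, p, q0 @ \<delta>0] \<longleftrightarrow> over p \<delta>0 \<and> H [p, q, p, q0]" for q p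
    by (simp add: RW'_def RW_def tuples_length[OF q0])
  have z0: "q0 @ \<delta>0 \<in> tuples M (\<Gamma>q @ \<Gamma>\<delta>)" using q0 \<delta>0t by (rule tuples_appendI)
  have finW: "finite ((\<lambda>p. {q \<in> tuples M \<Gamma>q. RW' [q, p, q0 @ \<delta>0]}) ` tuples M \<Gamma>p)"
  proof -
    have 1: "dfb L M [\<Gamma>p, \<Gamma>q, \<Gamma>q] (\<lambda>bs. H [bs ! 0, bs ! 1, bs ! 0, bs ! 2])"
      using dfb_reindex[OF dH, of "[\<Gamma>p, \<Gamma>q, \<Gamma>q]" "[0, 1, 0, 2]"] by simp
    let ?Z = "(\<lambda>p. {q \<in> tuples M \<Gamma>q. H [p, q, p, q0]}) ` fibre \<Gamma>p p0"
    have "finite ?Z" using orthogonal_dual[OF 1 side p0 q0] by simp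
    moreover have "{q \<in> tuples M \<Gamma>q. RW' [q, p, q0 @ \<delta>0]} \<in> insert {} ?Z" if "p \<in> tuples M \<Gamma>p" for p
    proof (cases "over p \<delta>0")
      case True
      then have "p \<in> fibre \<Gamma>p p0" using over_iff[OF that] by simp
      then show ?thesis using True by (simp add: RW'0)
    next
      case False then show ?thesis by (simp add: RW'0)
    qed
    ultimately show ?thesis by (meson finite_insert finite_subset image_subsetI)
  qed
  obtain K2 \<tau>2 \<theta>2 where \<tau>2: "\<tau>2 \<in> tuples M ((\<Gamma>q @ \<Gamma>\<delta>) @ concat (replicate K2 \<Gamma>q))"
    "dfb L M [\<Gamma>q, (\<Gamma>q @ \<Gamma>\<delta>) @ concat (replicate K2 \<Gamma>q)] \<theta>2"
    "\<And>x. x \<in> tuples M \<Gamma>q \<Longrightarrow> \<theta>2 [x, \<tau>2] \<longleftrightarrow> RW' [x, p0, q0 @ \<delta>0]"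
    "set (zip ((\<Gamma>q @ \<Gamma>\<delta>) @ concat (replicate K2 \<Gamma>q)) \<tau>2) \<subseteq> set (zip (\<Gamma>q @ \<Gamma>\<delta>) (q0 @ \<delta>0)) \<union>
       \<Union> {set (zip \<Gamma>q x) | x. x \<in> tuples M \<Gamma>q \<and> (\<exists>y\<in>tuples M \<Gamma>p. RW' [x, y, q0 @ \<delta>0])}"
    by (rule finite_family_code[OF dRW' sorts(1) z0 p0 finW]) blast
  let ?\<Gamma>2 = "(\<Gamma>q @ \<Gamma>\<delta>) @ concat (replicate K2 \<Gamma>q)"
  have \<theta>2_iff: "\<theta>2 [q, \<tau>2] \<longleftrightarrow> G [p0, q, x0]" if "q \<in> tuples M \<Gamma>q" for q
    using \<tau>2(3)[OF that] over0 H0 by (simp add: RW'0)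

  have s1: "set ?\<Gamma>1 \<subseteq> sorts L" using sorts(1) by auto
  have s2: "set ?\<Gamma>2 \<subseteq> sorts L" using sorts(2) by (auto simp: \<Gamma>\<delta>_def)
  let ?G1 = "code_rel M \<Gamma>p ?\<Gamma>1 \<theta>1" and ?G2 = "code_rel M \<Gamma>q ?\<Gamma>2 \<theta>2"
  have G1: "definable_equiv L M ?\<Gamma>1 ?G1" using definable_code_rel[OF \<tau>1(2) sorts(1) s1] .
  have G2: "definable_equiv L M ?\<Gamma>2 ?G2" using definable_code_rel[OF \<tau>2(2) sorts(2) s2] .

  \<comment> \<open>Indices defining the same set are equivalent, so counting codes is counting
    sets.\<close>
  have class_by_section: "finite ((\<lambda>t. code_rel M \<Gamma>' \<Gamma>t \<theta> `` {t}) ` Y)"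
    if fin: "finite Z" and sub: "\<And>t. t \<in> Y \<Longrightarrow> t \<in> tuples M \<Gamma>t \<and> {x \<in> tuples M \<Gamma>'. \<theta> [x, t]} \<in> Z"
    for \<Gamma>' \<Gamma>t \<theta> Y and Z :: "('a, 'u, 'b, 'c, 'w) seq_elem list set set"
  proof -
    have "code_rel M \<Gamma>' \<Gamma>t \<theta> `` {t} = {t' \<in> tuples M \<Gamma>t. {x \<in> tuples M \<Gamma>'. \<theta> [x, t']} = {x \<in> tuples M \<Gamma>'. \<theta> [x, t]}}"
      if "t \<in> Y" for t
      using sub[OF that] unfolding code_rel_def by auto
    then have "(\<lambda>t. code_rel M \<Gamma>' \<Gamma>t \<theta> `` {t}) ` Y \<subseteq> (\<lambda>A. {t' \<in> tuples M \<Gamma>t. {x \<in> tuples M \<Gamma>'. \<theta> [x, t']} = A}) ` Z"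
      using sub by (intro image_subsetI) simp
    then show ?thesis using fin by (meson finite_imageI finite_subset)
  qed
  \<comment> \<open>Here \<delta> is arbitrary because \<open>acl_code\<close> asks for uniform
    finiteness; orthogonality is applied at any point over it, if there is one.\<close>
  have finG: "finite ((\<lambda>p. {q \<in> tuples M \<Gamma>q. G [p, q, x0]}) ` {p \<in> tuples M \<Gamma>p. over p \<delta>})" for \<delta>
  proof (cases "{p \<in> tuples M \<Gamma>p. over p \<delta>} = {}")
    case False
    then obtain p1 where p1: "p1 \<in> tuples M \<Gamma>p" "over p1 \<delta>" by blast
    then have "{p \<in> tuples M \<Gamma>p. over p \<delta>} \<subseteq> fibre \<Gamma>p p1" using over_fibre by blast
    then show ?thesis using orthogonal_dual[OF dG side p1(1) x0t] by (meson finite_subset image_mono)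
  qed (simp only: image_empty finite.emptyI)

  \<comment> \<open>Over the class and \<delta> alone: \<open>t\<close> codes the left side
    belonging to some point \<open>p'\<close> over \<delta>. Leaving \<open>p'\<close> unspecified
    gives at most one code for each section that occurs, hence finitely many.\<close>
  define \<Phi>1 where "\<Phi>1 = (\<lambda>bs. \<exists>p'\<in>tuples M \<Gamma>p. over p' (bs ! 2) \<and> (\<forall>p\<in>tuples M \<Gamma>p. \<theta>1 [p, bs ! 1] \<longleftrightarrow>
    over p (bs ! 2) \<and> (\<forall>q\<in>tuples M \<Gamma>q. G [p, q, bs ! 0] \<longleftrightarrow> G [p', q, bs ! 0])))"
  have d\<Phi>1: "dfb L M [ss, ?\<Gamma>1, \<Gamma>\<delta>] \<Phi>1"
  proof -
    let ?\<Gamma>s = "[\<Gamma>p, \<Gamma>p, ss, ?\<Gamma>1, \<Gamma>\<delta>]"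
    have 1: "dfb L M (\<Gamma>q # ?\<Gamma>s) (\<lambda>bs. G [bs ! 1, bs ! 0, bs ! 3])"
      using dfb_reindex[OF dG, of "\<Gamma>q # ?\<Gamma>s" "[1, 0, 3]"] by simp
    have 2: "dfb L M (\<Gamma>q # ?\<Gamma>s) (\<lambda>bs. G [bs ! 2, bs ! 0, bs ! 3])"
      using dfb_reindex[OF dG, of "\<Gamma>q # ?\<Gamma>s" "[2, 0, 3]"] by simp
    have 3: "dfb L M ?\<Gamma>s (\<lambda>bs. \<forall>q\<in>tuples M \<Gamma>q. G [bs ! 0, q, bs ! 2] \<longleftrightarrow> G [bs ! 1, q, bs ! 2])"
      using dfb_all[OF dfb_iff[OF 1 2] sorts(2)] by simp
    have 4: "dfb L M ?\<Gamma>s (\<lambda>bs. \<theta>1 [bs ! 0, bs ! 3])"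
      using dfb_reindex[OF \<tau>1(2), of ?\<Gamma>s "[0, 3]"] by simp
    have 5: "dfb L M ?\<Gamma>s (\<lambda>bs. over (bs ! 0) (bs ! 4))" by (rule dover[OF _ _ _ _ 3]) simp_all
    have 6: "dfb L M [\<Gamma>p, ss, ?\<Gamma>1, \<Gamma>\<delta>] (\<lambda>bs. \<forall>p\<in>tuples M \<Gamma>p. \<theta>1 [p, bs ! 2] \<longleftrightarrow>
        over p (bs ! 3) \<and> (\<forall>q\<in>tuples M \<Gamma>q. G [p, q, bs ! 1] \<longleftrightarrow> G [bs ! 0, q, bs ! 1]))"
      using dfb_all[OF dfb_iff[OF 4 dfb_conj[OF 5 3]] sorts(1)] by simp
    have 7: "dfb L M [\<Gamma>p, ss, ?\<Gamma>1, \<Gamma>\<delta>] (\<lambda>bs. over (bs ! 0) (bs ! 3))" by (rule dover[OF _ _ _ _ 6]) simp_all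
    show ?thesis using dfb_ex[OF dfb_conj[OF 7 6] sorts(1)] by (simp add: \<Phi>1_def)
  qed
  have code1: "(Quot ?\<Gamma>1 ?G1, Class (?G1 `` {\<tau>1})) \<in> acl_e"
  proof (rule acl_code[OF F X d\<Phi>1 G1 \<delta>0t \<delta>0acl \<tau>1(1) ex(1)])
    show "\<Phi>1 [x0, \<tau>1, \<delta>0]" using p0 over0 \<theta>1_iff unfolding \<Phi>1_def by auto
    fix \<delta>'
    let ?W = "(\<lambda>A. {p \<in> tuples M \<Gamma>p. over p \<delta>' \<and> {q \<in> tuples M \<Gamma>q. G [p, q, x0]} = A}) `
      ((\<lambda>p. {q \<in> tuples M \<Gamma>q. G [p, q, x0]}) ` {p \<in> tuples M \<Gamma>p. over p \<delta>'})"
    show "finite ((\<lambda>t. ?G1 `` {t}) ` {t \<in> tuples M ?\<Gamma>1. \<exists>x\<in>X. \<Phi>1 [x, t, \<delta>']})"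
    proof (rule class_by_section)
      show "finite ?W" using finG by (rule finite_imageI)
      fix t assume t: "t \<in> {t \<in> tuples M ?\<Gamma>1. \<exists>x\<in>X. \<Phi>1 [x, t, \<delta>']}"
      then obtain x p' where x: "x \<in> X" "p' \<in> tuples M \<Gamma>p" "over p' \<delta>'"
        "\<forall>p\<in>tuples M \<Gamma>p. \<theta>1 [p, t] \<longleftrightarrow> over p \<delta>' \<and> (\<forall>q\<in>tuples M \<Gamma>q. G [p, q, x] \<longleftrightarrow> G [p', q, x])"
        unfolding \<Phi>1_def by auto
      have "{p \<in> tuples M \<Gamma>p. \<theta>1 [p, t]} =
          {p \<in> tuples M \<Gamma>p. over p \<delta>' \<and> {q \<in> tuples M \<Gamma>q. G [p, q, x0]} = {q \<in> tuples M \<Gamma>q. G [p', q, x0]}}"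
        using x(4) G_class[OF x(1)] by auto
      then show "t \<in> tuples M ?\<Gamma>1 \<and> {p \<in> tuples M \<Gamma>p. \<theta>1 [p, t]} \<in> ?W" using t x(2,3) by blast
    qed
  qed

  \<comment> \<open>Likewise \<open>t\<close> codes the section at some unspecified point over
    \<delta>.\<close>
  define \<Phi>2 where "\<Phi>2 = (\<lambda>bs. \<exists>p'\<in>tuples M \<Gamma>p. over p' (bs ! 2) \<and>
    (\<forall>q\<in>tuples M \<Gamma>q. \<theta>2 [q, bs ! 1] \<longleftrightarrow> G [p', q, bs ! 0]))"
  have d\<Phi>2: "dfb L M [ss, ?\<Gamma>2, \<Gamma>\<delta>] \<Phi>2"
  proof -
    let ?\<Gamma>s = "[\<Gamma>p, ss, ?\<Gamma>2, \<Gamma>\<delta>]"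
    have 1: "dfb L M (\<Gamma>q # ?\<Gamma>s) (\<lambda>bs. G [bs ! 1, bs ! 0, bs ! 2])"
      using dfb_reindex[OF dG, of "\<Gamma>q # ?\<Gamma>s" "[1, 0, 2]"] by simp
    have 2: "dfb L M (\<Gamma>q # ?\<Gamma>s) (\<lambda>bs. \<theta>2 [bs ! 0, bs ! 3])"
      using dfb_reindex[OF \<tau>2(2), of "\<Gamma>q # ?\<Gamma>s" "[0, 3]"] by simp
    have 3: "dfb L M ?\<Gamma>s (\<lambda>bs. \<forall>q\<in>tuples M \<Gamma>q. \<theta>2 [q, bs ! 2] \<longleftrightarrow> G [bs ! 0, q, bs ! 1])"
      using dfb_all[OF dfb_iff[OF 2 1] sorts(2)] by simp
    have 4: "dfb L M ?\<Gamma>s (\<lambda>bs. over (bs ! 0) (bs ! 3))" by (rule dover[OF _ _ _ _ 3]) simp_all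
    show ?thesis using dfb_ex[OF dfb_conj[OF 4 3] sorts(1)] by (simp add: \<Phi>2_def)
  qed
  have code2: "(Quot ?\<Gamma>2 ?G2, Class (?G2 `` {\<tau>2})) \<in> acl_e"
  proof (rule acl_code[OF F X d\<Phi>2 G2 \<delta>0t \<delta>0acl \<tau>2(1) ex(1)])
    show "\<Phi>2 [x0, \<tau>2, \<delta>0]" using p0 over0 \<theta>2_iff unfolding \<Phi>2_def by auto
    fix \<delta>'
    show "finite ((\<lambda>t. ?G2 `` {t}) ` {t \<in> tuples M ?\<Gamma>2. \<exists>x\<in>X. \<Phi>2 [x, t, \<delta>']})"
    proof (rule class_by_section[OF finG])
      fix t assume t: "t \<in> {t \<in> tuples M ?\<Gamma>2. \<exists>x\<in>X. \<Phi>2 [x, t, \<delta>']}"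
      then obtain x p' where x: "x \<in> X" "p' \<in> tuples M \<Gamma>p" "over p' \<delta>'"
        "\<forall>q\<in>tuples M \<Gamma>q. \<theta>2 [q, t] \<longleftrightarrow> G [p', q, x]"
        unfolding \<Phi>2_def by auto
      have "{q \<in> tuples M \<Gamma>q. \<theta>2 [q, t]} = {q \<in> tuples M \<Gamma>q. G [p', q, x0]}"
        using x(4) G_class[OF x(1)] by auto
      then show "t \<in> tuples M ?\<Gamma>2 \<and> {q \<in> tuples M \<Gamma>q. \<theta>2 [q, t]} \<in>
          (\<lambda>p. {q \<in> tuples M \<Gamma>q. G [p, q, x0]}) ` {p \<in> tuples M \<Gamma>p. over p \<delta>'}"
        using t x(2,3) by blast
    qed
  qed

  have zipB: "set (zip \<Gamma>p p) \<subseteq> B_fibres M v D S" if p: "p \<in> fibre \<Gamma>p p0" for p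
  proof
    fix sx assume "sx \<in> set (zip \<Gamma>p p)"
    then obtain i where i: "i < ?N" "sx = (\<Gamma>p ! i, p ! i)" by (auto simp: set_zip)
    have pi: "p ! i \<in> univ M (\<Gamma>p ! i)" using tuples_nth[OF fibre_in[OF p] i(1)] .
    show "sx \<in> B_fibres M v D S"
    proof (cases "\<Gamma>p ! i")
      case (SA y)
      then have "SA y \<in> set \<Gamma>p" using i(1) by (metis nth_mem)
      from news(1)[OF this] SA i pi show ?thesis by (cases y) (auto simp: B_fibres_def)
    next
      case SB
      then obtain b where b: "p ! i = EB b" using pi by (auto simp: univ_SB)
      have "v (bv p i) = v (bv p0 i)" using p i(1) by (simp add: fibre_def)
      then have "v b \<in> D" using \<Delta>[OF i(1)] b by simp
      then show ?thesis using i SB b by (simp add: B_fibres_def)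
    next
      case (SC y) then show ?thesis using side(1) i(1) by (auto simp: side_AB_def)
    qed
  qed
  have zipC: "set (zip \<Gamma>q q) \<subseteq> C_set M S" if q: "q \<in> tuples M \<Gamma>q" for q
  proof
    fix sx assume "sx \<in> set (zip \<Gamma>q q)"
    then obtain i where i: "i < ?nq" "sx = (\<Gamma>q ! i, q ! i)" by (auto simp: set_zip)
    have qi: "q ! i \<in> univ M (\<Gamma>q ! i)" using tuples_nth[OF q i(1)] .
    obtain y where y: "\<Gamma>q ! i = SC y" using side(2) i(1) by (auto simp: side_C_def)
    then have "SC y \<in> set \<Gamma>q" using i(1) by (metis nth_mem)
    then show "sx \<in> C_set M S"
      using news(2) y i qi by (cases y) (auto simp: C_set_def univ_SC_Core)
  qed
  have "set (zip ?\<Gamma>1 \<tau>1) \<subseteq> B_fibres M v D S"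
  proof -
    have "set (zip \<Gamma>p x) \<subseteq> B_fibres M v D S" if "RU [x, y, p0]" for x y
      using that zipB by (simp add: RU_def)
    then show ?thesis using \<tau>1(4) zipB[OF fibre_self[OF p0]] by blast
  qed
  then have part1: "(Quot ?\<Gamma>1 ?G1, Class (?G1 `` {\<tau>1})) \<in> eq_part L M (B_fibres M v D S) acl_e"
    unfolding eq_part_def using code1 G1 \<tau>1(1) by blast
  have "set (zip ?\<Gamma>2 \<tau>2) \<subseteq> C_set M S"
  proof -
    have "set (zip \<Gamma>\<delta> \<delta>0) \<subseteq> C_set M S" by (auto simp: \<Gamma>\<delta>_def \<delta>0_def C_set_def set_zip)
    then have "set (zip (\<Gamma>q @ \<Gamma>\<delta>) (q0 @ \<delta>0)) \<subseteq> C_set M S" using zipC[OF q0] tuples_length[OF q0] by simp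
    then show ?thesis using \<tau>2(4) zipC by blast
  qed
  then have part2: "(Quot ?\<Gamma>2 ?G2, Class (?G2 `` {\<tau>2})) \<in> eq_part L M (C_set M S) acl_e"
    unfolding eq_part_def using code2 G2 \<tau>2(1) by blast

  \<comment> \<open>The elements having coordinates in the coded rectangle; these all belong to
    \<open>X\<close>, and \<open>x0\<close> is one of them.\<close>
  define \<Phi> where "\<Phi> = (\<lambda>bs. \<exists>q\<in>tuples M \<Gamma>q. \<exists>p\<in>tuples M \<Gamma>p. \<theta>1 [p, bs ! 1] \<and> \<theta>2 [q, bs ! 2] \<and> \<rho> [p, q, bs ! 0])"
  have d\<Phi>: "dfb L M [ss, ?\<Gamma>1, ?\<Gamma>2] \<Phi>"
  proof -
    let ?\<Gamma>s = "[\<Gamma>p, \<Gamma>q, ss, ?\<Gamma>1, ?\<Gamma>2]"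
    have 1: "dfb L M ?\<Gamma>s (\<lambda>bs. \<theta>1 [bs ! 0, bs ! 3])"
      using dfb_reindex[OF \<tau>1(2), of ?\<Gamma>s "[0, 3]"] by simp
    have 2: "dfb L M ?\<Gamma>s (\<lambda>bs. \<theta>2 [bs ! 1, bs ! 4])"
      using dfb_reindex[OF \<tau>2(2), of ?\<Gamma>s "[1, 4]"] by simp
    have 3: "dfb L M ?\<Gamma>s (\<lambda>bs. \<rho> [bs ! 0, bs ! 1, bs ! 2])"
      using dfb_reindex[OF \<rho>, of ?\<Gamma>s "[0, 1, 2]"] by simp
    have "dfb L M [\<Gamma>q, ss, ?\<Gamma>1, ?\<Gamma>2]
        (\<lambda>bs. \<exists>p\<in>tuples M \<Gamma>p. \<theta>1 [p, bs ! 2] \<and> \<theta>2 [bs ! 0, bs ! 3] \<and> \<rho> [p, bs ! 0, bs ! 1])"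
      using dfb_ex[OF dfb_conj[OF 1 dfb_conj[OF 2 3]] sorts(1)] by simp
    from dfb_ex[OF this sorts(2)] show ?thesis by (simp add: \<Phi>_def)
  qed
  show ?thesis
  proof (rule dcl_codes[OF F X d\<Phi> G1 G2 \<tau>1(1) \<tau>2(1) ex(1)])
    have "\<theta>1 [p0, \<tau>1]" using \<theta>1_iff[OF p0] over0 by simp
    moreover have "\<theta>2 [q0, \<tau>2]" using \<theta>2_iff[OF q0] G0 by simp
    ultimately show "\<Phi> [x0, \<tau>1, \<tau>2]" using p0 q0 ex(2) unfolding \<Phi>_def by auto
  next
    fix x t1 t2 assume a: "x \<in> tuples M ss" "(\<tau>1, t1) \<in> ?G1" "(\<tau>2, t2) \<in> ?G2" "\<Phi> [x, t1, t2]"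
    then obtain p q where pq: "p \<in> tuples M \<Gamma>p" "q \<in> tuples M \<Gamma>q" "\<theta>1 [p, t1]" "\<theta>2 [q, t2]" "\<rho> [p, q, x]"
      unfolding \<Phi>_def by auto
    have "\<theta>1 [p, \<tau>1]" using a(2) pq(1,3) by (simp add: code_rel_def)
    moreover have "\<theta>2 [q, \<tau>2]" using a(3) pq(2,4) by (simp add: code_rel_def)
    ultimately have "G [p, q, x0]" using \<theta>1_iff[OF pq(1)] \<theta>2_iff[OF pq(2)] pq(2) by blast
    then show "x \<in> X" using G_sound pq(5) a(1) by blast
  next
    show "(Quot ?\<Gamma>1 ?G1, Class (?G1 `` {\<tau>1})) \<in>
        eq_part L M (C_set M S) acl_e \<union> eq_part L M (B_fibres M v D S) acl_e"
      using part1 by (rule UnI2)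
    show "(Quot ?\<Gamma>2 ?G2, Class (?G2 `` {\<tau>2})) \<in>
        eq_part L M (C_set M S) acl_e \<union> eq_part L M (B_fibres M v D S) acl_e"
      using part2 by (rule UnI1)
  qed
qed

end

end

text \<open>The sorts of the two coordinates of an entry: \<open>\<A>\<close> is taken into
  \<open>\<B>\<close> by \<iota>, as the fibre over 0, while an entry that has nothing to contribute
  on one side gets a dummy core sort there. Thus position \<open>i\<close> means the same in the
  tuple and in both coordinate tuples.\<close>

definition psort :: "('x, 'y) seq_sort \<Rightarrow> ('x, 'y) seq_sort" where
  "psort s = (case s of SA (New y) \<Rightarrow> SA (New y) | _ \<Rightarrow> SB)"

definition qsort :: "('x, 'y) seq_sort \<Rightarrow> ('x, 'y) seq_sort" where
  "qsort s = (case s of SC t \<Rightarrow> SC t | _ \<Rightarrow> SC Core)"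

lemma psort_simps [simp]:
  "psort (SA Core) = SB" "psort (SA (New y)) = SA (New y)" "psort SB = SB" "psort (SC t) = SB"
  by (simp_all add: psort_def)

lemma qsort_simps [simp]: "qsort (SA s) = SC Core" "qsort SB = SC Core" "qsort (SC t) = SC t"
  by (simp_all add: qsort_def)

section \<open>Coordinates for the representatives of a class\<close>

context exact_sequence
begin

lemma sort_cases:
  fixes s :: "('x, 'y) seq_sort"
  obtains "s = SA Core" | y where "s = SA (New y)" | "s = SB" | t where "s = SC t"
  by (metis seq_sort.exhaust side_sort.exhaust)

lemma univ_SA_Core: "x \<in> univ M (SA Core) \<longleftrightarrow> (\<exists>a. x = EA (CoreEl a))"
  by (auto simp: univ_SA core_A)

lemma univ_SB_iff: "x \<in> univ M SB \<longleftrightarrow> (\<exists>b. x = EB b)"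
  by (auto simp: univ_SB)

lemma dcl_quot:
  assumes F: "definable_equiv L M ss F" and X: "X \<in> tuples M ss // F"
    and alg: "\<And>l c. l \<noteq> 0 \<Longrightarrow> \<exists>b. v b \<in> mult_coset scC l c \<and> (SB, EB b) \<in> acl L M {}"
  defines "A \<equiv> acl_eq L M {(Quot ss F, Class X)}"
  shows "(Quot ss F, Class X) \<in> dcl_eq L M
    (eq_part L M (C_set M (set ss)) A \<union> eq_part L M (B_fibres M v (C_points A) (set ss)) A)"
proof -
  let ?n = "length ss" and ?D = "C_points A"
  obtain \<phi> where \<phi>: "wf_fm L (ss @ ss) \<phi>"
    "\<And>x y. x \<in> tuples M ss \<Longrightarrow> y \<in> tuples M ss \<Longrightarrow> sat M (x @ y) \<phi> \<longleftrightarrow> (x, y) \<in> F"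
  proof -
    obtain \<phi> where \<phi>: "wf_fm L (concat [ss, ss]) \<phi>"
      "\<forall>bs. env M [ss, ss] bs \<longrightarrow> sat M (concat bs) \<phi> = ((bs ! 0, bs ! 1) \<in> F)"
      using definable_equivD(3)[OF F] unfolding dfb_def by blast
    have "sat M (x @ y) \<phi> \<longleftrightarrow> (x, y) \<in> F" if "x \<in> tuples M ss" "y \<in> tuples M ss" for x y
      using \<phi>(2)[rule_format, of "[x, y]"] that by simp
    then show ?thesis using that \<phi>(1) by simp
  qed
  obtain T l where T: "finite T" "l \<noteq> 0" "invariant (ss @ ss) \<phi> T l"
    using invariant_exists[OF \<phi>(1)] by blast
  obtain d where d: "d \<in> X" using X_nonempty[OF F X] by blast
  have dt: "d \<in> tuples M ss" using X_sub[OF F X d] .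
  \<comment> \<open>The coset of c modulo l contains the image of an algebraic element; this
    decomposes c with an algebraic first part.\<close>
  have "\<exists>b y. v (bv d i) = v b + scC l (v y) \<and> (SB, EB b) \<in> acl L M {}" for i
  proof -
    obtain b where b: "v b \<in> mult_coset scC l (v (bv d i))" "(SB, EB b) \<in> acl L M {}" using alg[OF T(2)] by blast
    obtain c where "v b = v (bv d i) + scC l c" using b(1) by (auto simp: mult_coset_def)
    moreover obtain y where "v y = - c" using v_surj by blast
    ultimately show ?thesis using b(2) by (intro exI[of _ b] exI[of _ y]) simp
  qed
  then have "\<forall>i. \<exists>by. v (bv d i) = v (fst by) + scC l (v (snd by)) \<and> (SB, EB (fst by)) \<in> acl L M {}"
    by (metis fst_conv snd_conv)
  from choice[OF this] obtain \<beta>y where \<beta>y: "\<forall>i. v (bv d i) = v (fst (\<beta>y i)) + scC l (v (snd (\<beta>y i))) \<and>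
    (SB, EB (fst (\<beta>y i))) \<in> acl L M {}" ..
  define \<beta> y where "\<beta> = (\<lambda>i. fst (\<beta>y i))" and "y = (\<lambda>i. snd (\<beta>y i))"
  have c_eq: "v (bv d i) = v (\<beta> i) + scC l (v (y i))" and \<beta>_alg: "(SB, EB (\<beta> i)) \<in> acl L M {}" for i
    using \<beta>y by (simp_all add: \<beta>_def y_def)
  have \<beta>D: "v (\<beta> i) \<in> ?D" for i
    unfolding A_def by (rule D_v[OF F X acl_of_empty[OF F X \<beta>_alg]])
  have zeroD: "0 \<in> ?D" unfolding A_def by (rule D_zero[OF F X])
  let ?c = "\<lambda>i. v (bv d i)"
  obtain rs where rs: "set rs = {t \<in> T. lin scC ss t ?c \<in> ?D}"
    using finite_list[of "{t \<in> T. lin scC ss t ?c \<in> ?D}"] T(1) by auto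
  define K where "K = length rs"
  \<comment> \<open>l times this value is r\<cdot>c - r\<cdot>v(\<beta>), a difference of points of
    \<open>?D\<close>, and \<open>?D\<close> is closed under division by l.\<close>
  have yD: "v (lin scB ss (rs ! j) y) \<in> ?D" if "j < K" for j
  proof -
    let ?r = "rs ! j"
    have "rs ! j \<in> set rs" using that by (simp add: K_def)
    then have 1: "lin scC ss ?r ?c \<in> ?D" using rs by blast
    have 2: "lin scC ss ?r (\<lambda>i. v (\<beta> i)) \<in> ?D" unfolding A_def by (rule D_lin[OF F X]) (rule \<beta>D[unfolded A_def])
    have "lin scC ss ?r ?c = lin scC ss ?r (\<lambda>i. v (\<beta> i)) + scC l (lin scC ss ?r (\<lambda>i. v (y i)))"
      by (simp only: c_eq C.lin_add C.lin_scale)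
    then have "scC l (lin scC ss ?r (\<lambda>i. v (y i))) =
        lin scC ss ?r ?c + scC (- 1) (lin scC ss ?r (\<lambda>i. v (\<beta> i)))"
      by simp
    then show ?thesis unfolding v_lin A_def
      by (rule D_closed[OF F X 1[unfolded A_def] 2[unfolded A_def] T(2)])
  qed
  define \<Gamma>p where "\<Gamma>p = map psort ss @ replicate K SB"
  define \<Gamma>q where "\<Gamma>q = map qsort ss"
  define p0 where "p0 = map (\<lambda>i. case ss ! i of SA Core \<Rightarrow> EB (\<iota> (the_core (the_EA (d ! i)))) | SA (New _) \<Rightarrow> d ! i
      | SB \<Rightarrow> EB (bv d i - scB l (y i)) | SC _ \<Rightarrow> EB 0) [0..<?n] @ map (\<lambda>j. EB (lin scB ss (rs ! j) y)) [0..<K]"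
  define q0 where "q0 = map (\<lambda>i. case ss ! i of SC _ \<Rightarrow> d ! i | SB \<Rightarrow> EC (CoreEl (v (y i)))
      | _ \<Rightarrow> EC (CoreEl 0)) [0..<?n]"
  define \<rho>i where "\<rho>i = (\<lambda>i (b :: ('a, 'u, 'b, 'c, 'w) seq_elem list) (p :: ('a, 'u, 'b, 'c, 'w) seq_elem list) q x. case ss ! i of
      SA s \<Rightarrow> (case s of Core \<Rightarrow> bval (p ! i) = \<iota> (the_core (the_EA (x ! i))) | New _ \<Rightarrow> p ! i = x ! i)
    | SB \<Rightarrow> bval (x ! i) = bval (p ! i) + scB l (bval (b ! i)) \<and> v (bval (b ! i)) = cval (q ! i)
    | SC _ \<Rightarrow> q ! i = (x ! i :: ('a, 'u, 'b, 'c, 'w) seq_elem))"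
  \<comment> \<open>The lift of \<open>q\<close> to \<open>\<B>\<close> is not itself a coordinate
    and is quantified. Two lifts with the same images and the same values under the relations
    \<open>rs\<close> differ by an element of \<open>\<A>\<^sup>n\<close> annihilated by
    \<open>rs\<close>, which is an admissible translation.\<close>
  define \<rho> where "\<rho> = (\<lambda>bs. \<exists>b\<in>tuples M (replicate ?n SB). (\<forall>i\<in>{..<?n}. \<rho>i i b (bs ! 0) (bs ! 1) (bs ! 2)) \<and>
    (\<forall>j\<in>{..<K}. lin scB ss (rs ! j) (\<lambda>i. bval (b ! (0 + i))) = bval (bs ! 0 ! (?n + j))))"
  have psort_nth: "\<Gamma>p ! i = psort (ss ! i)" and qsort_nth: "\<Gamma>q ! i = qsort (ss ! i)" if "i < ?n" for i
    using that by (simp_all add: \<Gamma>p_def \<Gamma>q_def nth_append)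
  have tail_nth: "\<Gamma>p ! (?n + j) = SB" if "j < K" for j
    using that by (simp add: \<Gamma>p_def nth_append)
  have len: "length \<Gamma>p = ?n + K" "length \<Gamma>q = ?n" by (simp_all add: \<Gamma>p_def \<Gamma>q_def)
  have d_nth: "d ! i \<in> univ M (ss ! i)" if "i < ?n" for i using tuples_nth[OF dt that] .
  have d\<rho>: "dfb L M [\<Gamma>p, \<Gamma>q, ss] \<rho>"
  proof -
    let ?\<Gamma>s = "[replicate ?n SB, \<Gamma>p, \<Gamma>q, ss]"
    have triv: "dfb L M ?\<Gamma>s (\<lambda>bs. 0 = (0 :: 'b))" by (rule dfb_eqB[OF dtb_zero dtb_zero])
    have 1: "dfb L M ?\<Gamma>s (\<lambda>bs. \<rho>i i (bs ! 0) (bs ! 1) (bs ! 2) (bs ! 3))" if i: "i < ?n" for i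
    proof (cases "ss ! i" rule: sort_cases)
      case 1
      have "dft L M ?\<Gamma>s (\<lambda>bs. bs ! 3 ! i) (SA Core)"
        using dft_var[of 3 ?\<Gamma>s i] i 1 by simp
      then have "dfb L M ?\<Gamma>s (\<lambda>bs. bval (bs ! 1 ! i) = \<iota> (the_core (the_EA (bs ! 3 ! i))))"
        by (intro dfb_eqB dtb_iota dtb_var) (use i 1 len psort_nth in auto)
      then show ?thesis by (simp add: \<rho>i_def 1)
    next
      case (2 t)
      have "dfb L M ?\<Gamma>s (\<lambda>bs. bs ! 1 ! i = bs ! 3 ! i)"
        using dft_var[of 1 ?\<Gamma>s i] dft_var[of 3 ?\<Gamma>s i] i 2 len psort_nth[OF i]
        by (intro dfb_eq[of _ _ _ _ "SA (New t)"]) simp_all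
      then show ?thesis by (simp add: \<rho>i_def 2)
    next
      case 3
      have "dfb L M ?\<Gamma>s (\<lambda>bs. bval (bs ! 3 ! i) = bval (bs ! 1 ! i) + scB l (bval (bs ! 0 ! i)) \<and>
          v (bval (bs ! 0 ! i)) = cval (bs ! 2 ! i))"
        by (intro dfb_conj dfb_eqB dfb_eqC dtc_v dtb_add dtb_scale dtb_var dtc_var)
          (use i 3 len psort_nth qsort_nth in auto)
      then show ?thesis by (simp add: \<rho>i_def 3)
    next
      case (4 t)
      have "dfb L M ?\<Gamma>s (\<lambda>bs. bs ! 2 ! i = bs ! 3 ! i)"
        using dft_var[of 2 ?\<Gamma>s i] dft_var[of 3 ?\<Gamma>s i] i 4 len qsort_nth[OF i]
        by (intro dfb_eq[of _ _ _ _ "SC t"]) simp_all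
      then show ?thesis by (simp add: \<rho>i_def 4)
    qed
    have 2: "dfb L M ?\<Gamma>s (\<lambda>bs. lin scB ss (rs ! j) (\<lambda>i. bval (bs ! 0 ! (0 + i))) = bval (bs ! 1 ! (?n + j)))"
      if "j < K" for j
      by (intro dfb_eqB dtb_lin dtb_var) (use that len tail_nth in auto)
    have "dfb L M ?\<Gamma>s (\<lambda>bs. (\<forall>i\<in>{..<?n}. \<rho>i i (bs ! 0) (bs ! 1) (bs ! 2) (bs ! 3)) \<and>
        (\<forall>j\<in>{..<K}. lin scB ss (rs ! j) (\<lambda>i. bval (bs ! 0 ! (0 + i))) = bval (bs ! 1 ! (?n + j))))"
      by (intro dfb_conj dfb_ball[OF finite_lessThan _ triv] 1 2) simp_all
    then have "dfb L M [\<Gamma>p, \<Gamma>q, ss] (\<lambda>bs. \<exists>b\<in>tuples M (replicate ?n SB).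
        (\<forall>i\<in>{..<?n}. \<rho>i i b (bs ! 0) (bs ! 1) (bs ! 2)) \<and>
        (\<forall>j\<in>{..<K}. lin scB ss (rs ! j) (\<lambda>i. bval (b ! (0 + i))) = bval (bs ! 0 ! (?n + j))))"
      using dfb_ex[of L M "replicate ?n SB" "[\<Gamma>p, \<Gamma>q, ss]"] by fastforce
    then show ?thesis by (simp only: \<rho>_def)
  qed
  have p0_nth: "p0 ! i = (case ss ! i of SA Core \<Rightarrow> EB (\<iota> (the_core (the_EA (d ! i)))) | SA (New _) \<Rightarrow> d ! i
      | SB \<Rightarrow> EB (bv d i - scB l (y i)) | SC _ \<Rightarrow> EB 0)" if "i < ?n" for i
    using that by (simp add: p0_def nth_append split: seq_sort.split side_sort.split)
  have p0_tail: "p0 ! (?n + j) = EB (lin scB ss (rs ! j) y)" if "j < K" for j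
    using that by (simp add: p0_def nth_append)
  have q0_nth: "q0 ! i = (case ss ! i of SC _ \<Rightarrow> d ! i | SB \<Rightarrow> EC (CoreEl (v (y i)))
      | _ \<Rightarrow> EC (CoreEl 0))" if "i < ?n" for i
    using that by (simp add: q0_def split: seq_sort.split)
  have split_index: "\<exists>j<K. i = ?n + j" if "i < length \<Gamma>p" "\<not> i < ?n" for i
    using that len(1) by (intro exI[of _ "i - ?n"]) auto
  have sF: "set ss \<subseteq> sorts L" using definable_equivD(2)[OF F] .
  have p0t: "p0 \<in> tuples M \<Gamma>p"
    unfolding tuples_iff list_all2_conv_all_nth
  proof (intro conjI allI impI)
    show l0: "length p0 = length \<Gamma>p" by (simp add: p0_def len)
    fix i assume i: "i < length p0"
    show "p0 ! i \<in> univ M (\<Gamma>p ! i)"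
    proof (cases "i < ?n")
      case True
      then show ?thesis using d_nth[OF True]
        by (cases "ss ! i" rule: sort_cases) (simp_all add: p0_nth psort_nth)
    next
      case False
      then obtain j where "j < K" "i = ?n + j" using split_index i l0 by auto
      then show ?thesis by (simp add: p0_tail tail_nth)
    qed
  qed
  have q0t: "q0 \<in> tuples M \<Gamma>q"
    unfolding tuples_iff list_all2_conv_all_nth
  proof (intro conjI allI impI)
    fix i assume "i < length q0"
    then have i: "i < ?n" by (simp add: q0_def)
    show "q0 ! i \<in> univ M (\<Gamma>q ! i)" using d_nth[OF i]
      by (cases "ss ! i" rule: sort_cases) (simp_all add: q0_nth[OF i] qsort_nth[OF i])
  qed (simp add: q0_def len)
  show ?thesis
    unfolding A_def
  proof (rule dcl_from_coordinates[OF F X d\<rho> _ _ _ _ _ _ p0t q0t d])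
    show "side_AB \<Gamma>p"
      unfolding side_AB_def
    proof (intro allI impI)
      fix i s assume i: "i < length \<Gamma>p"
      show "\<Gamma>p ! i \<noteq> SC s"
      proof (cases "i < ?n")
        case True
        then show ?thesis by (cases "ss ! i" rule: sort_cases) (simp_all add: psort_nth)
      next
        case False
        then show ?thesis using split_index[OF i] tail_nth by auto
      qed
    qed
    show "side_C \<Gamma>q"
      unfolding side_C_def
    proof (intro allI impI)
      fix i assume "i < length \<Gamma>q"
      then have "i < ?n" by (simp add: len)
      then show "\<exists>s. \<Gamma>q ! i = SC s" by (cases "ss ! i" rule: sort_cases) (simp_all add: qsort_nth)
    qed
    have "psort s \<in> sorts L" if "s \<in> sorts L" for s
      using that by (cases s rule: sort_cases) simp_all
    then show "set \<Gamma>p \<subseteq> sorts L" using sF by (auto simp: \<Gamma>p_def)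
    have "qsort s \<in> sorts L" if "s \<in> sorts L" for s
      using that by (cases s rule: sort_cases) simp_all
    then show "set \<Gamma>q \<subseteq> sorts L" using sF by (auto simp: \<Gamma>q_def)
    show "t \<noteq> Core \<and> SA t \<in> set ss" if "SA t \<in> set \<Gamma>p" for t
    proof -
      obtain s where s: "s \<in> set ss" "psort s = SA t" using \<open>SA t \<in> set \<Gamma>p\<close> by (auto simp: \<Gamma>p_def)
      then show ?thesis by (cases s rule: sort_cases) auto
    qed
    show "SC (New t) \<in> set ss" if "SC (New t) \<in> set \<Gamma>q" for t
    proof -
      obtain s where s: "s \<in> set ss" "qsort s = SC (New t)" using \<open>SC (New t) \<in> set \<Gamma>q\<close> by (auto simp: \<Gamma>q_def)
      then show ?thesis by (cases s rule: sort_cases) auto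
    qed
    show "v (bv p0 i) \<in> C_points (acl_eq L M {(Quot ss F, Class X)})" if i: "i < length \<Gamma>p" for i
    proof (cases "i < ?n")
      case True
      have "v (bv d i - scB l (y i)) = v (\<beta> i)" by (simp add: v.diff v.scale c_eq)
      then show ?thesis using d_nth[OF True] zeroD \<beta>D[of i]
        by (cases "ss ! i" rule: sort_cases) (auto simp: p0_nth[OF True] A_def univ_SA v.zero)
    next
      case False
      then obtain j where "j < K" "i = ?n + j" using split_index[OF i] by auto
      then show ?thesis using yD[of j] p0_tail[of j] by (simp add: A_def)
    qed
    show "\<rho> [p0, q0, d]"
    proof -
      let ?b = "map (\<lambda>i. EB (y i)) [0..<?n] :: ('a, 'u, 'b, 'c, 'w) seq_elem list"
      have "?b \<in> tuples M (replicate ?n SB)" by (auto simp: tuples_iff list_all2_conv_all_nth)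
      moreover have "\<rho>i i ?b p0 q0 d" if i: "i < ?n" for i
        using d_nth[OF i]
        by (cases "ss ! i" rule: sort_cases) (auto simp: \<rho>i_def p0_nth[OF i] q0_nth[OF i] i)
      moreover have "lin scB ss (rs ! j) (\<lambda>i. bval (?b ! (0 + i))) = bval (p0 ! (?n + j))" if "j < K" for j
        unfolding p0_tail[OF that] by (simp, rule lin_cong) simp
      ultimately show ?thesis unfolding \<rho>_def by (intro bexI[of _ ?b]) simp_all
    qed
    fix x assume x: "x \<in> tuples M ss" "\<rho> [p0, q0, x]"
    then obtain b where b: "b \<in> tuples M (replicate ?n SB)" "\<forall>i\<in>{..<?n}. \<rho>i i b p0 q0 x"
      "\<forall>j\<in>{..<K}. lin scB ss (rs ! j) (\<lambda>i. bval (b ! (0 + i))) = bval (p0 ! (?n + j))"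
      by (auto simp: \<rho>_def)
    \<comment> \<open>Outside \<open>SB\<close> the entries of \<open>b\<close> and \<open>y\<close>
      are unrelated, so \<open>g\<close> is set to 0 there in order to have
      \<open>v (g i) = 0\<close> everywhere.\<close>
    define g where "g = (\<lambda>i. if i < ?n \<and> ss ! i = SB then bv b i - y i else 0)"
    have vg: "v (g i) = 0" for i
    proof (cases "i < ?n \<and> ss ! i = SB")
      case True
      then have "\<rho>i i b p0 q0 x" using b(2) by simp
      then have "v (bv b i) = v (y i)" using True by (simp add: \<rho>i_def q0_nth)
      then show ?thesis using True by (simp add: g_def v.diff)
    next
      case False then show ?thesis by (auto simp: g_def v.zero)
    qed
    have kill: "lin scB ss t g = 0" if t: "t \<in> T" "lin scC ss t ?c \<in> ?D" for t
    proof -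
      obtain j where j: "j < K" "t = rs ! j" using rs t unfolding K_def by (metis (no_types, lifting) in_set_conv_nth mem_Collect_eq)
      have "lin scB ss t g = lin scB ss t (\<lambda>i. bv b i - y i)" by (rule lin_cong) (simp add: g_def)
      also have "\<dots> = 0" using b(3) j p0_tail[OF j(1)] by (simp add: B.lin_diff)
      finally show ?thesis .
    qed
    have "x = shift d (\<lambda>i. scB l (g i))"
    proof (rule nth_equalityI)
      show "length x = length (shift d (\<lambda>i. scB l (g i)))" using tuples_length[OF x(1)] tuples_length[OF dt] by simp
      fix i assume "i < length x"
      then have i: "i < ?n" using tuples_length[OF x(1)] by simp
      then have id: "i < length d" using tuples_length[OF dt] by simp
      have \<rho>i: "\<rho>i i b p0 q0 x" using b(2) i by simp
      have xi: "x ! i \<in> univ M (ss ! i)" using tuples_nth[OF x(1) i] .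
      show "x ! i = shift d (\<lambda>i. scB l (g i)) ! i"
        unfolding shift_nth[OF id] using \<rho>i xi d_nth[OF i]
        by (cases "ss ! i" rule: sort_cases)
          (auto simp: \<rho>i_def p0_nth[OF i] q0_nth[OF i] univ_SA_Core univ_SB_iff univ_SA core_A univ_SC g_def i iota_inj
             B.scale_right_diff_distrib)
    qed
    then show "x \<in> X"
      using shift_in_class[OF F X T(3,1) \<phi>(2) d vg] kill unfolding A_def by simp
  qed
qed

section \<open>Imaginaries that are elements of a home sort\<close>

lemma home_acl:
  assumes k: "dfb L M [[t], [s]] (\<lambda>bs. bs ! 0 ! 0 = k (bs ! 1 ! 0))" and s: "s \<in> sorts L" "t \<in> sorts L"
    and x: "x \<in> univ M s" "k x \<in> univ M t"
  shows "(Home t, Real (k x)) \<in> acl_eq L M {(Home s, Real x)}"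
proof -
  have "dfb (eq_language L M) (eq_struct M) (map (map Home) [[t], [s]])
      (\<lambda>bs. the_real (bs ! 0 ! 0) = k (the_real (bs ! 1 ! 0)))"
    by (rule dfb_cong[OF dfb_lift[OF k]]) (auto simp: env_Cons_iff tuples_Cons_iff)
  then have "dfb (eq_language L M) (eq_struct M) [[Home t], map fst [(Home s, Real x)]]
      (\<lambda>bs. the_real (bs ! 0 ! 0) = k (the_real (bs ! 1 ! 0)))"
    by simp
  from definable_overI[OF this, of "{(Home s, Real x)}"]
  have "definable_over (eq_language L M) (eq_struct M) {(Home s, Real x)} [Home t]
      {xs \<in> tuples (eq_struct M) [Home t]. the_real (xs ! 0) = k x}"
    using s x by (simp add: elems_def eq_language_simps eq_struct_simps)
  moreover have "{xs \<in> tuples (eq_struct M) [Home t]. the_real (xs ! 0) = k x} = {[Real (k x)]}"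
    using x by (auto simp: tuples_Cons_iff eq_struct_simps)
  ultimately show ?thesis unfolding acl_eq_def acl_def by auto
qed

text \<open>\<open>eq_part\<close> consists of classes only, so a real element enters it as the
  class of \<open>k x\<close> under equality. The map \<open>k\<close> is the identity, or \<iota>
  for an element of \<open>\<A>\<close>, and is injective at \<open>x\<close>, so the class recovers
  \<open>x\<close>.\<close>

lemma home_code:
  assumes k: "dfb L M [[t], [s]] (\<lambda>bs. bs ! 0 ! 0 = k (bs ! 1 ! 0))" and s: "s \<in> sorts L" "t \<in> sorts L"
    and x: "x \<in> univ M s" "k x \<in> univ M t" and inj: "\<And>z. z \<in> univ M s \<Longrightarrow> k z = k x \<Longrightarrow> z = x"
    and Z: "(t, k x) \<in> Z" and P: "eq_part L M Z (acl_eq L M {(Home s, Real x)}) \<subseteq> P"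
  shows "(Home s, Real x) \<in> dcl_eq L M P"
proof -
  let ?L = "eq_language L M" and ?M = "eq_struct M"
  define I where "I = Id_on (tuples M [t])"
  have I: "definable_equiv L M [t] I"
  proof (rule definable_equivI)
    show "equiv (tuples M [t]) I" by (rule equivI) (auto simp: I_def refl_on_def sym_def trans_def)
    have "dfb L M [[t], [t]] (\<lambda>bs. bs ! 0 ! 0 = bs ! 1 ! 0)"
      using dft_var[of 0 "[[t], [t]]" 0] dft_var[of 1 "[[t], [t]]" 0] by (intro dfb_eq[of _ _ _ _ t]) simp_all
    then show "dfb L M [[t], [t]] (\<lambda>bs. (bs ! 0, bs ! 1) \<in> I)"
      by (rule dfb_cong) (auto simp: I_def env_Cons_iff tuples_Cons_iff)
  qed (use s in simp)
  let ?q = "Quot [t] I" and ?y = "Class (I `` {[k x]})"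
  have cls: "I `` {[z]} = {[z]}" if "z \<in> univ M t" for z using that by (auto simp: I_def)
  define Q where "Q = (\<lambda>bs. \<exists>b\<in>tuples M [t]. Class (I `` {b}) = bs ! 0 ! 0 \<and>
    the_real (map Real b ! 0) = k (the_real (tl bs ! 0 ! 0)))"
  have "dfb ?L ?M (map (map Home) [[t], [s]]) (\<lambda>bs. the_real (bs ! 0 ! 0) = k (the_real (bs ! 1 ! 0)))"
    by (rule dfb_cong[OF dfb_lift[OF k]]) (auto simp: env_Cons_iff tuples_Cons_iff)
  then have "dfb ?L ?M (map Home [t] # [[Home s]]) (\<lambda>bs. the_real (bs ! 0 ! 0) = k (the_real (bs ! 1 ! 0)))"
    by simp
  from dfb_quot[OF this I] have dQ: "dfb ?L ?M [[?q], [Home s]] Q" by (simp add: Q_def)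
  have Q_iff: "Q [[w], [Real z]] \<longleftrightarrow> w = Class {[k z]} \<and> k z \<in> univ M t" for w z
  proof -
    have "(\<exists>b\<in>tuples M [t]. R b) \<longleftrightarrow> (\<exists>a\<in>univ M t. R [a])" for R by (auto simp: tuples_Cons_iff)
    then have "Q [[w], [Real z]] \<longleftrightarrow> (\<exists>a\<in>univ M t. Class (I `` {[a]}) = w \<and> a = k z)" by (simp add: Q_def)
    also have "\<dots> \<longleftrightarrow> (\<exists>a\<in>univ M t. Class {[a]} = w \<and> a = k z)" by (rule bex_cong) (simp_all add: cls)
    finally show ?thesis by blast
  qed
  have eS: "(Home s, Real x) \<in> elems ?L ?M"
    using s x by (simp add: elems_def eq_language_simps eq_struct_simps)
  have yS: "(?q, ?y) \<in> elems ?L ?M"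
  proof -
    have "I `` {[k x]} \<in> tuples M [t] // I" using x(2) by (intro quotientI) simp
    then show ?thesis using I by (simp add: elems_def eq_language_simps eq_struct_simps)
  qed
  have "(?q, ?y) \<in> acl_eq L M {(Home s, Real x)}"
  proof -
    have "dfb ?L ?M [[?q], map fst [(Home s, Real x)]] Q" using dQ by simp
    from definable_overI[OF this, of "{(Home s, Real x)}"]
    have "definable_over ?L ?M {(Home s, Real x)} [?q] {xs \<in> tuples ?M [?q]. Q [xs, [Real x]]}"
      using eS I by (simp add: eq_language_simps)
    moreover have "{xs \<in> tuples ?M [?q]. Q [xs, [Real x]]} = {[?y]}"
    proof (intro set_eqI iffI)
      fix xs assume "xs \<in> {xs \<in> tuples ?M [?q]. Q [xs, [Real x]]}"
      then have xs: "xs \<in> tuples ?M [?q]" "Q [xs, [Real x]]" by blast+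
      obtain w where "xs = [w]" using xs(1) by (auto simp: tuples_Cons_iff)
      moreover from this xs(2) have "Q [[w], [Real x]]" by simp
      ultimately show "xs \<in> {[?y]}" using Q_iff[of w x] cls[OF x(2)] by simp
    next
      fix xs assume "xs \<in> {[?y]}"
      moreover have "Q [[?y], [Real x]]" unfolding Q_iff using cls[OF x(2)] x(2) by simp
      ultimately show "xs \<in> {xs \<in> tuples ?M [?q]. Q [xs, [Real x]]}"
        using yS unfolding elems_def by simp
    qed
    ultimately show ?thesis unfolding acl_eq_def acl_def by auto
  qed
  then have "(?q, ?y) \<in> eq_part L M Z (acl_eq L M {(Home s, Real x)})"
    unfolding eq_part_def using I x(2) Z
    by (intro IntI CollectI exI[of _ "[t]"] exI[of _ I] exI[of _ "[k x]"]) simp_all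
  then have yP: "(?q, ?y) \<in> P" using P by blast
  have "dfb ?L ?M [[Home s], map fst [(?q, ?y)]] (\<lambda>bs. Q (map ((!) bs) [1, 0]))"
    by (rule dfb_reindex[OF dQ]) simp_all
  from definable_overI[OF this, of P]
  have "definable_over ?L ?M P [Home s] {xs \<in> tuples ?M [Home s]. Q [[?y], xs]}"
    using yS yP s by (simp add: eq_language_simps)
  moreover have "{xs \<in> tuples ?M [Home s]. Q [[?y], xs]} = {[Real x]}"
  proof -
    have "Q [[?y], [Real z]] \<longleftrightarrow> z = x" if "z \<in> univ M s" for z
    proof -
      have "Q [[?y], [Real z]] \<longleftrightarrow> k z = k x \<and> k z \<in> univ M t" unfolding Q_iff cls[OF x(2)] by auto
      then show ?thesis using inj[OF that] x(2) by metis
    qed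
    moreover have "xs \<in> tuples ?M [Home s] \<longleftrightarrow> (\<exists>z\<in>univ M s. xs = [Real z])" for xs
      by (auto simp: tuples_Cons_iff eq_struct_simps)
    ultimately show ?thesis using x(1) by (intro set_eqI) (simp only: mem_Collect_eq, blast)
  qed
  ultimately show ?thesis unfolding dcl_eq_def dcl_def by simp
qed

text \<open>An element of \<open>\<B>\<close> lies over its own image under \<open>v\<close>, which
  is definable from it, and one of \<open>\<A>\<close> is moved by \<iota> to the fibre over 0; all
  other elements already belong to one of the two sets.\<close>

lemma dcl_home:
  assumes s: "s \<in> sorts L" and x: "x \<in> univ M s"
  defines "A \<equiv> acl_eq L M {(Home s, Real x)}"
  shows "(Home s, Real x) \<in> dcl_eq L M
    (eq_part L M (C_set M {s}) A \<union> eq_part L M (B_fibres M v (C_points A) {s}) A)" (is "_ \<in> dcl_eq L M ?P")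
proof -
  have same: "dfb L M [[s], [s]] (\<lambda>bs. bs ! 0 ! 0 = id (bs ! 1 ! 0))"
    using dft_var[of 0 "[[s], [s]]" 0] dft_var[of 1 "[[s], [s]]" 0]
    by (intro dfb_eq[of _ _ _ _ s]) simp_all
  have direct: "(Home s, Real x) \<in> dcl_eq L M ?P"
    if "(s, x) \<in> C_set M {s} \<or> (s, x) \<in> B_fibres M v (C_points A) {s}"
    using that
  proof
    assume "(s, x) \<in> C_set M {s}"
    then show ?thesis
      by (intro home_code[OF same s s x, of "C_set M {s}"]) (use x in \<open>auto simp: A_def\<close>)
  next
    assume "(s, x) \<in> B_fibres M v (C_points A) {s}"
    then show ?thesis
      by (intro home_code[OF same s s x, of "B_fibres M v (C_points A) {s}"]) (use x in \<open>auto simp: A_def\<close>)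
  qed
  show ?thesis
  proof (cases s rule: sort_cases)
    case 1
    then obtain a where a: "x = EA (CoreEl a)" using x by (auto simp: univ_SA_Core)
    let ?k = "\<lambda>z. EB (\<iota> (the_core (the_EA z)))"
    have "dft L M [[SB], [s]] (\<lambda>bs. bs ! 1 ! 0) (SA Core)" using dft_var[of 1 "[[SB], [s]]" 0] 1 by simp
    then have "dft L M [[SB], [s]] (\<lambda>bs. ?k (bs ! 1 ! 0)) SB" using dtb_iota unfolding dtb_def by blast
    moreover have "dft L M [[SB], [s]] (\<lambda>bs. bs ! 0 ! 0) SB" using dft_var[of 0 "[[SB], [s]]" 0] by simp
    ultimately have k: "dfb L M [[SB], [s]] (\<lambda>bs. bs ! 0 ! 0 = ?k (bs ! 1 ! 0))" by (intro dfb_eq)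
    have "dfb L M [[SC Core], [s]] (\<lambda>bs. bs ! 0 ! 0 = EC (CoreEl 0))"
      using dft_var[of 0 "[[SC Core], [s]]" 0] dtc_zero[of "[[SC Core], [s]]"]
      by (intro dfb_eq[of _ _ _ _ "SC Core"]) (simp_all add: dtc_def)
    from home_acl[OF this s _ x] have "0 \<in> C_points A" by (simp add: C_points_def A_def)
    then have "(SB, ?k x) \<in> B_fibres M v (C_points A) {s}" by (simp add: B_fibres_def)
    then show ?thesis
      by (intro home_code[OF k s _ x, of "B_fibres M v (C_points A) {s}"])
        (use 1 a in \<open>auto simp: A_def univ_SA_Core iota_inj\<close>)
  next
    case (2 y)
    then show ?thesis using x by (intro direct) (auto simp: B_fibres_def)
  next
    case 3
    then obtain b where b: "x = EB b" using x by (auto simp: univ_SB_iff)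
    have "dfb L M [[SC Core], [s]] (\<lambda>bs. bs ! 0 ! 0 = EC (CoreEl (v (bval (bs ! 1 ! 0)))))"
      using dft_var[of 0 "[[SC Core], [s]]" 0] dtc_v[OF dtb_var[of 1 "[[SC Core], [s]]" 0]] 3
      by (intro dfb_eq[of _ _ _ _ "SC Core"]) (simp_all add: dtc_def)
    from home_acl[OF this s _ x] have "v b \<in> C_points A" by (simp add: C_points_def A_def b)
    then show ?thesis using 3 b by (intro direct) (simp add: B_fibres_def)
  next
    case (4 t)
    then show ?thesis using x by (intro direct, cases t) (auto simp: C_set_def univ_SC_Core)
  qed
qed

end

theorem theorem5p4:
  fixes scA :: "'r::idom \<Rightarrow> 'a::ab_group_add \<Rightarrow> 'a"
    and scB :: "'r \<Rightarrow> 'b::ab_group_add \<Rightarrow> 'b"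
    and scC :: "'r \<Rightarrow> 'c::ab_group_add \<Rightarrow> 'c"
    and \<iota> :: "'a \<Rightarrow> 'b" and v :: "'b \<Rightarrow> 'c"
    and LA :: "('x side_sort, 'f, 'p) language"
    and MA :: "('x side_sort, ('a, 'u) side_elem, 'f, 'p) struct"
    and LC :: "('y side_sort, 'g, 'q) language"
    and MC :: "('y side_sort, ('c, 'w) side_elem, 'g, 'q) struct"
    and L :: "(('x, 'y) seq_sort, ('r, 'f, 'g) seq_fun, ('p, 'q) seq_rel) language"
    and M :: "(('x, 'y) seq_sort, ('a, 'u, 'b, 'c, 'w) seq_elem,
               ('r, 'f, 'g) seq_fun, ('p, 'q) seq_rel) struct"
    and e :: "(('x, 'y) seq_sort, ('a, 'u, 'b, 'c, 'w) seq_elem) imag"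
    and E :: "(('x, 'y) seq_sort, ('a, 'u, 'b, 'c, 'w) seq_elem) imag set"
    and \<Delta> :: "'c set"
  assumes "short_exact scA scB scC \<iota> v"
    and "side_enrichment LA MA" and "side_enrichment LC MC"
    and "L = seq_language LA LC" and "M = seq_struct scA scB scC \<iota> v MA MC"
    and "pure_submodule scB (range \<iota>)"
    and "torsion_free scC"
    and "\<And>l. l \<noteq> 0 \<Longrightarrow> finite (range (mult_coset scC l))"
    and "\<And>l c. l \<noteq> 0 \<Longrightarrow> \<exists>b. v b \<in> mult_coset scC l c \<and> (SB, EB b) \<in> acl L M {}"
    and "e \<in> eq_elems L M"
    and "E = acl_eq L M {e}"
    and "\<Delta> = C_points E"
  shows "e \<in> dcl_eq L M
           (eq_part L M (C_set M (base_sorts (fst e))) E \<union>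
            eq_part L M (B_fibres M v \<Delta> (base_sorts (fst e))) E)"
proof -
  interpret exact_sequence scA scB scC \<iota> v LA MA LC MC L M
    by unfold_locales (use assms(1-5,7,8) in auto)
  obtain \<sigma> x where e: "e = (\<sigma>, x)" by (cases e)
  have elem: "\<sigma> \<in> sorts (eq_language L M)" "x \<in> univ (eq_struct M) \<sigma>"
    using assms(10) e by (auto simp: eq_elems_def elems_def)
  show ?thesis
  proof (cases \<sigma>)
    case (Home s)
    then obtain z where "x = Real z" "z \<in> univ M s" "s \<in> sorts L"
      using elem by (auto simp: eq_language_simps eq_struct_simps)
    then show ?thesis using dcl_home[of s z] by (simp add: e Home assms(11,12))
  next
    case (Quot ss F)
    then obtain X where "x = Class X" "X \<in> tuples M ss // F" "definable_equiv L M ss F"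
      using elem by (auto simp: eq_language_simps eq_struct_simps)
    then show ?thesis using dcl_quot[OF _ _ assms(9), of ss F X] by (simp add: e Quot assms(11,12))
  qed
qed

end
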